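(* Up to isomorphism, the spreading models of $Z(\mathcal T)$ are the Hilbert space $\ell_2$ and the Orlicz space $\ell_M$.
   Context: $\omega$ is the space of all complex sequences with pointwise convergence; $c_{00}$ is the space of finitely supported sequences. Spreading model: let $(x_j)$ be a bounded sequence in a Banach space $Y$ without convergent subsequences. By Brunel and Sucheston there is a subsequence $(x'_j)$ such that for all $n$ and scalars $a_1,\dots,a_n$ there is a number $L(a_1,\dots,a_n)$ with: for every $\varepsilon>0$ there is $\nu$ with $\big|\,\|\sum_{j=1}^n a_jx'_{k_j}\|-L(a_1,\dots,a_n)\big|<\varepsilon$ whenever $\nu\le k_1<\dots<k_n$. The completion of $c_{00}$ under the norm $\|\sum_{j=1}^n a_je_j\|:=L(a_1,\dots,a_n)$ is a spreading model of $Y$ (generated by $(x_j)$). Tsirelson's space. For $x\in c_{00}$ let $\|x\|_0=\max_j|x_j|$ and $\|x\|_{n+1}=\max\{\|x\|_n,\frac12\max\sum_{j=1}^k\|A_jx\|_n\}$, where the inner maximum is over all $k$ and finite subsets $k\le A_1<\dots<A_k$ of $\mathbb N$ ($A_j<A_{j+1}$ means $\max A_j<\min A_{j+1}$; $A_jx$ is the restriction of $x$ to $A_j$). $\mathcal T$ is the completion of $c_{00}$ under $\|x\|=\lim_n\|x\|_n$. The space $Z(X)$. Let $X$ be a space with an unconditional basis $(e_j)$, regarded as a sequence space in $\omega$ through the basis, with $X^*$ regarded as a sequence space through $x^*\mapsto(x^*(e_j))_j$. Let $\mathbb S=\{z\in\mathbb C:0\le \operatorname{Re}z\le 1\}$.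 $\mathcal F_\infty(X,X^* )$ is the space of functions $F:\mathbb S\to\omega$, bounded and continuous on $\mathbb S$, analytic in its interior, such that $t\mapsto F(it)\in X$ and $t\mapsto F(1+it)\in X^*$ are bounded and continuous, with norm $\max(\sup_t\|F(it)\|_X,\sup_t\|F(1+it)\|_{X^*})$. The interpolation space $(X,X^* )_{1/2}=\{F(1/2):F\in\mathcal F_\infty(X,X^* )\}$ with the quotient norm equals $\ell_2$ up to an equivalent norm. Fix a homogeneous selection $x\in\ell_2\mapsto B(x)\in\mathcal F_\infty(X,X^* )$ with $B(x)(1/2)=x$ and $\|B(x)\|\le C\|x\|_2$, and put $\Omega(x)=B(x)'(1/2)\in\omega$. Then $Z(X)=\{(x,y)\in\omega\times\omega: y\in\ell_2,\ x-\Omega(y)\in\ell_2\}$ with the quasi-norm $\|(x,y)\|=\|x-\Omega(y)\|_2+\|y\|_2$, which is equivalent to a norm; different selections give equivalent quasi-norms. Kalton-Peck space: $Z_2=\{(x,y)\in\omega\times\omega:\ y\in\ell_2,\ x-\mathcal K(y)\in\ell_2\}$ with $\|(x,y)\|_{Z_2}=\|x-\mathcal K(y)\|_2+\|y\|_2$, where $\mathcal K(y)=\sum_j y_j\log|y_j|\,e_j$ for $\|y\|_2=1$ (with $0\log 0=0$), extended homogeneously. $\ell_M$ is the closed linear span of $\{(0,e_j)\}_{j=1}^\infty$ in $Z_2$; it is an Orlicz sequence space. *)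

theory Defs
  imports "HOL-Complex_Analysis.Complex_Analysis" "HOL-Library.Function_Algebras"
begin

section \<open>Complex vector spaces and normed subspaces\<close>

class complex_vec = ab_group_add +
  fixes scaleC :: "complex \<Rightarrow> 'a \<Rightarrow> 'a" (infixr "*\<^sub>C" 75)
  assumes scaleC_add_right: "a *\<^sub>C (x + y) = a *\<^sub>C x + a *\<^sub>C y"
    and scaleC_add_left: "(a + b) *\<^sub>C x = a *\<^sub>C x + b *\<^sub>C x"
    and scaleC_scaleC: "a *\<^sub>C b *\<^sub>C x = (a * b) *\<^sub>C x"
    and scaleC_one: "1 *\<^sub>C x = x"

global_interpretation complex_vec: vector_space "scaleC :: complex \<Rightarrow> 'a \<Rightarrow> 'a::complex_vec"
  defines cspan = "complex_vec.span"
    and csubspace = "complex_vec.subspace"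
  by unfold_locales (rule scaleC_add_right scaleC_add_left scaleC_scaleC scaleC_one)+

instantiation complex :: complex_vec
begin
definition scaleC_complex :: "complex \<Rightarrow> complex \<Rightarrow> complex"
  where "scaleC_complex c x = c * x"
instance by standard (simp_all add: scaleC_complex_def algebra_simps)
end

instantiation "fun" :: (type, complex_vec) complex_vec
begin
definition scaleC_fun :: "complex \<Rightarrow> ('a \<Rightarrow> 'b) \<Rightarrow> 'a \<Rightarrow> 'b"
  where "scaleC_fun c f = (\<lambda>i. c *\<^sub>C f i)"
instance
  by standard
    (simp_all add: scaleC_fun_def plus_fun_def fun_eq_iff scaleC_add_right scaleC_add_left
      scaleC_scaleC scaleC_one)
end

instantiation prod :: (complex_vec, complex_vec) complex_vec
begin
definition scaleC_prod :: "complex \<Rightarrow> 'a \<times> 'b \<Rightarrow> 'a \<times> 'b"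
  where "scaleC_prod c v = (c *\<^sub>C fst v, c *\<^sub>C snd v)"
instance
  by standard
    (simp_all add: scaleC_prod_def prod_eq_iff scaleC_add_right scaleC_add_left
      scaleC_scaleC scaleC_one)
end

text \<open>A (quasi-)normed space is given by its underlying set inside some complex vector space and
  its (quasi-)norm; only the values of the latter on the underlying set matter.\<close>

record 'v nspace =
  carr :: "'v set"
  nrm :: "'v \<Rightarrow> real"

definition is_norm_on :: "'v::complex_vec set \<Rightarrow> ('v \<Rightarrow> real) \<Rightarrow> bool" where
  "is_norm_on V N \<longleftrightarrow>
     (\<forall>v\<in>V. 0 \<le> N v \<and> (N v = 0 \<longleftrightarrow> v = 0)) \<and>
     (\<forall>c. \<forall>v\<in>V. N (c *\<^sub>C v) = cmod c * N v) \<and>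
     (\<forall>v\<in>V. \<forall>w\<in>V. N (v + w) \<le> N v + N w)"

definition equivalent_on :: "'v set \<Rightarrow> ('v \<Rightarrow> real) \<Rightarrow> ('v \<Rightarrow> real) \<Rightarrow> bool" where
  "equivalent_on V p q \<longleftrightarrow> (\<exists>c>0. \<exists>C>0. \<forall>v\<in>V. c * p v \<le> q v \<and> q v \<le> C * p v)"

definition converges_in :: "'v::complex_vec nspace \<Rightarrow> (nat \<Rightarrow> 'v) \<Rightarrow> 'v \<Rightarrow> bool" where
  "converges_in Y u v \<longleftrightarrow> v \<in> carr Y \<and> (\<lambda>n. nrm Y (u n - v)) \<longlonglongrightarrow> 0"

definition cauchy_in :: "'v::complex_vec nspace \<Rightarrow> (nat \<Rightarrow> 'v) \<Rightarrow> bool" where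
  "cauchy_in Y u \<longleftrightarrow> (\<forall>e>0. \<exists>M. \<forall>m\<ge>M. \<forall>n\<ge>M. nrm Y (u m - u n) < e)"

definition is_banach :: "'v::complex_vec nspace \<Rightarrow> bool" where
  "is_banach Y \<longleftrightarrow> csubspace (carr Y) \<and> is_norm_on (carr Y) (nrm Y) \<and>
     (\<forall>u. (\<forall>n. u n \<in> carr Y) \<longrightarrow> cauchy_in Y u \<longrightarrow> (\<exists>v. converges_in Y u v))"

definition linear_on_space :: "'v::complex_vec set \<Rightarrow> ('v \<Rightarrow> 'w::complex_vec) \<Rightarrow> bool" where
  "linear_on_space V f \<longleftrightarrow>
     (\<forall>v\<in>V. \<forall>w\<in>V. f (v + w) = f v + f w) \<and> (\<forall>c. \<forall>v\<in>V. f (c *\<^sub>C v) = c *\<^sub>C f v)"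

definition isomorphic :: "'v::complex_vec nspace \<Rightarrow> 'w::complex_vec nspace \<Rightarrow> bool"
    (infix "\<simeq>\<^sub>B" 50) where
  "Y \<simeq>\<^sub>B W \<longleftrightarrow> (\<exists>f. linear_on_space (carr Y) f \<and> bij_betw f (carr Y) (carr W) \<and>
     equivalent_on (carr Y) (nrm Y) (\<lambda>v. nrm W (f v)))"

definition is_completion :: "'v::complex_vec nspace \<Rightarrow> 'w::complex_vec nspace \<Rightarrow> bool" where
  "is_completion Y W \<longleftrightarrow> csubspace (carr Y) \<and> is_norm_on (carr Y) (nrm Y) \<and> is_banach W \<and>
     (\<exists>J. linear_on_space (carr Y) J \<and> J ` carr Y \<subseteq> carr W \<and>
        (\<forall>v\<in>carr Y. nrm W (J v) = nrm Y v) \<and>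
        (\<forall>w\<in>carr W. \<forall>e>0. \<exists>v\<in>carr Y. nrm W (w - J v) < e))"

definition closed_span :: "'v::complex_vec nspace \<Rightarrow> 'v set \<Rightarrow> 'v nspace" where
  "closed_span Y A =
     \<lparr>carr = {v \<in> carr Y. \<forall>e>0. \<exists>u\<in>cspan A. nrm Y (v - u) < e}, nrm = nrm Y\<rparr>"


section \<open>Sequence spaces\<close>

type_synonym cseq = "nat \<Rightarrow> complex"

definition c00 :: "cseq set" where
  "c00 = {x. finite {j. x j \<noteq> 0}}"

definition unit_seq :: "nat \<Rightarrow> cseq" where
  "unit_seq j = (\<lambda>i. if i = j then 1 else 0)"

definition restrict_seq :: "nat set \<Rightarrow> cseq \<Rightarrow> cseq" where
  "restrict_seq A x = (\<lambda>j. if j \<in> A then x j else 0)"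

definition l2norm :: "cseq \<Rightarrow> real" where
  "l2norm x = sqrt (\<Sum>j. (cmod (x j))\<^sup>2)"

definition ell2 :: "cseq nspace" where
  "ell2 = \<lparr>carr = {x. summable (\<lambda>j. (cmod (x j))\<^sup>2)}, nrm = l2norm\<rparr>"

text \<open>The completion of \<^const>\<open>c00\<close> under a norm \<open>p\<close> for which the unit vectors form a
  Schauder basis of the completion, its elements being identified with their coefficient
  sequences: \<open>x\<close> belongs to it iff \<open>\<Sum>j. x j e\<^sub>j\<close> converges in the completion, that is, iff the
  partial sums are Cauchy, and then its norm is the limit of the norms of the partial sums.\<close>

definition basis_completion :: "(cseq \<Rightarrow> real) \<Rightarrow> cseq nspace" where
  "basis_completion p =
     \<lparr>carr = {x. cauchy_in \<lparr>carr = c00, nrm = p\<rparr> (\<lambda>n. restrict_seq {..<n} x)},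
      nrm = (\<lambda>x. lim (\<lambda>n. p (restrict_seq {..<n} x)))\<rparr>"

definition is_functional :: "cseq nspace \<Rightarrow> (cseq \<Rightarrow> complex) \<Rightarrow> bool" where
  "is_functional X \<phi> \<longleftrightarrow>
     linear_on_space (carr X) \<phi> \<and> (\<exists>K. \<forall>x\<in>carr X. cmod (\<phi> x) \<le> K * nrm X x)"

definition functional_norm :: "cseq nspace \<Rightarrow> (cseq \<Rightarrow> complex) \<Rightarrow> real" where
  "functional_norm X \<phi> = Sup {cmod (\<phi> x) | x. x \<in> carr X \<and> nrm X x \<le> 1}"

text \<open>The dual of a sequence space \<open>X\<close> with basis \<open>(e\<^sub>j)\<close>, as a sequence space through
  \<open>\<phi> \<mapsto> (\<phi> e\<^sub>j)\<^sub>j\<close>. The values \<open>\<phi> e\<^sub>j\<close> determine \<open>\<phi>\<close> on \<open>X\<close>, so the description of the norm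
  is unique.\<close>

definition dual_seq :: "cseq nspace \<Rightarrow> cseq nspace" where
  "dual_seq X =
     \<lparr>carr = {f. \<exists>\<phi>. is_functional X \<phi> \<and> (\<forall>j. f j = \<phi> (unit_seq j))},
      nrm = (\<lambda>f. THE r. \<exists>\<phi>. is_functional X \<phi> \<and> (\<forall>j. f j = \<phi> (unit_seq j)) \<and>
                               r = functional_norm X \<phi>)\<rparr>"


section \<open>Tsirelson's space\<close>

text \<open>Coordinates are numbered from 0 here, so the coordinate \<open>j\<close> is the classical coordinate
  \<open>j + 1\<close>; this is why the admissibility condition \<open>k \<le> min A\<^sub>1\<close> has a successor.\<close>

definition admissible :: "nat \<Rightarrow> (nat \<Rightarrow> nat set) \<Rightarrow> bool" where
  "admissible k A \<longleftrightarrow> 1 \<le> k \<and> (\<forall>i<k. finite (A i) \<and> A i \<noteq> {}) \<and>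
     (\<forall>i. Suc i < k \<longrightarrow> Max (A i) < Min (A (Suc i))) \<and> k \<le> Suc (Min (A 0))"

text \<open>For \<open>x\<close> in \<^const>\<open>c00\<close> both suprema range over finite sets, hence are maxima.\<close>

primrec tsirelson_norm_step :: "nat \<Rightarrow> cseq \<Rightarrow> real" where
  "tsirelson_norm_step 0 x = (SUP j. cmod (x j))"
| "tsirelson_norm_step (Suc n) x = max (tsirelson_norm_step n x)
     (1/2 * Sup {\<Sum>i<k. tsirelson_norm_step n (restrict_seq (A i) x) | k A. admissible k A})"

definition tsirelson_norm :: "cseq \<Rightarrow> real" where
  "tsirelson_norm x = lim (\<lambda>n. tsirelson_norm_step n x)"

definition tsirelson :: "cseq nspace" where
  "tsirelson = basis_completion tsirelson_norm"


section \<open>Interpolation between a sequence space and its dual\<close>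

definition strip :: "complex set" where
  "strip = {z. 0 \<le> Re z \<and> Re z \<le> 1}"

definition bounded_continuous_into :: "cseq nspace \<Rightarrow> (real \<Rightarrow> cseq) \<Rightarrow> bool" where
  "bounded_continuous_into X g \<longleftrightarrow> (\<forall>t. g t \<in> carr X) \<and> (\<exists>K. \<forall>t. nrm X (g t) \<le> K) \<and>
     (\<forall>t. ((\<lambda>s. nrm X (g s - g t)) \<longlongrightarrow> 0) (at t))"

text \<open>Boundedness, continuity and analyticity of a function with values in \<open>\<omega>\<close>, which carries
  the topology of pointwise convergence, are coordinatewise.\<close>

definition interp_carrier :: "cseq nspace \<Rightarrow> cseq nspace \<Rightarrow> (complex \<Rightarrow> cseq) set" where
  "interp_carrier X0 X1 = {F.
     (\<forall>j. bounded ((\<lambda>z. F z j) ` strip) \<and> continuous_on strip (\<lambda>z. F z j) \<and>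
          (\<lambda>z. F z j) holomorphic_on interior strip) \<and>
     bounded_continuous_into X0 (\<lambda>t. F (\<i> * of_real t)) \<and>
     bounded_continuous_into X1 (\<lambda>t. F (1 + \<i> * of_real t))}"

definition interp_norm :: "cseq nspace \<Rightarrow> cseq nspace \<Rightarrow> (complex \<Rightarrow> cseq) \<Rightarrow> real" where
  "interp_norm X0 X1 F = max (SUP t. nrm X0 (F (\<i> * of_real t)))
                             (SUP t. nrm X1 (F (1 + \<i> * of_real t)))"

definition homogeneous_selection :: "cseq nspace \<Rightarrow> (cseq \<Rightarrow> complex \<Rightarrow> cseq) \<Rightarrow> bool" where
  "homogeneous_selection X B \<longleftrightarrow>
     (\<forall>x\<in>carr ell2. B x \<in> interp_carrier X (dual_seq X) \<and> B x (1/2) = x) \<and>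
     (\<forall>c. \<forall>x\<in>carr ell2. \<forall>z\<in>strip. B (c *\<^sub>C x) z = c *\<^sub>C B x z) \<and>
     (\<exists>C. \<forall>x\<in>carr ell2. interp_norm X (dual_seq X) (B x) \<le> C * l2norm x)"

definition Omega :: "(cseq \<Rightarrow> complex \<Rightarrow> cseq) \<Rightarrow> cseq \<Rightarrow> cseq" where
  "Omega B x = (\<lambda>j. deriv (\<lambda>z. B x z j) (1/2))"


section \<open>Twisted Hilbert spaces\<close>

definition twisted_ell2 :: "(cseq \<Rightarrow> cseq) \<Rightarrow> (cseq \<times> cseq) nspace" where
  "twisted_ell2 \<Phi> =
     \<lparr>carr = {(x, y). y \<in> carr ell2 \<and> x - \<Phi> y \<in> carr ell2},
      nrm = (\<lambda>(x, y). l2norm (x - \<Phi> y) + l2norm y)\<rparr>"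

text \<open>\<open>Z(X)\<close>, computed with the selection \<open>B\<close> for the couple \<open>(X, X\<^sup>*)\<close>.\<close>

definition Z_space :: "(cseq \<Rightarrow> complex \<Rightarrow> cseq) \<Rightarrow> (cseq \<times> cseq) nspace" where
  "Z_space B = twisted_ell2 (Omega B)"

definition kalton_peck_sphere :: "cseq \<Rightarrow> cseq" where
  "kalton_peck_sphere y = (\<lambda>j. if y j = 0 then 0 else y j * of_real (ln (cmod (y j))))"

definition kalton_peck :: "cseq \<Rightarrow> cseq" where
  "kalton_peck y = (if y = 0 then 0 else
     of_real (l2norm y) *\<^sub>C kalton_peck_sphere (of_real (1 / l2norm y) *\<^sub>C y))"

definition Z2 :: "(cseq \<times> cseq) nspace" where
  "Z2 = twisted_ell2 kalton_peck"

definition ell_M :: "(cseq \<times> cseq) nspace" where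
  "ell_M = closed_span Z2 (range (\<lambda>j. (0, unit_seq j)))"


section \<open>Spreading models\<close>

text \<open>A finitely supported sequence \<open>a\<close> stands for \<open>\<Sum>j. a\<^sub>j e\<^sub>j\<close> as well as for each tuple
  \<open>(a\<^sub>0, \<dots>, a\<^sub>n\<^sub>-\<^sub>1)\<close> containing its support, so the limit function lives on \<^const>\<open>c00\<close>.\<close>

definition spreading_limit ::
    "'v::complex_vec nspace \<Rightarrow> (nat \<Rightarrow> 'v) \<Rightarrow> (cseq \<Rightarrow> real) \<Rightarrow> bool" where
  "spreading_limit Y x' L \<longleftrightarrow>
     (\<forall>n. \<forall>a. (\<forall>j\<ge>n. a j = 0) \<longrightarrow>
        (\<forall>e>0. \<exists>\<nu>. \<forall>k. strict_mono_on {..<n} k \<and> (\<forall>j<n. \<nu> \<le> k j) \<longrightarrow>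
           \<bar>nrm Y (\<Sum>j<n. a j *\<^sub>C x' (k j)) - L a\<bar> < e))"

definition spreading_model :: "'v::complex_vec nspace \<Rightarrow> 'w::complex_vec nspace \<Rightarrow> bool" where
  "spreading_model Y S \<longleftrightarrow>
     (\<exists>x. (\<forall>j. x j \<in> carr Y) \<and> (\<exists>K. \<forall>j. nrm Y (x j) \<le> K) \<and>
        (\<forall>r :: nat \<Rightarrow> nat. strict_mono r \<longrightarrow> (\<nexists>v. converges_in Y (x \<circ> r) v)) \<and>
        (\<exists>r L. strict_mono r \<and> spreading_limit Y (x \<circ> r) L \<and>
           is_completion \<lparr>carr = c00, nrm = L\<rparr> S))"

end

theory Submission
  imports Defs "HOL-Library.Ramsey" "HOL-Library.Diagonal_Subsequence"
begin


text \<open>A function \<open>F\<close> bounded by 1 on the boundary of the strip, in Tsirelson's space and in its dual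
  respectively, satisfies \<open>\<parallel>F(1/2)\<parallel> \<le> 1\<close> in \<open>l_2\<close>, by the three lines theorem for
  \<open>\<Sum> F\<^sub>j(z) cnj (F\<^sub>j(1 - cnj z))\<close>. Dividing \<open>F - B y\<close>, \<open>y = F(1/2)\<close>, by \<open>z - 1/2\<close> shows that \<open>F'(1/2)\<close>
  agrees with \<open>\<Omega>(y)\<close> up to a bounded error in \<open>l_2\<close>. Blocks \<open>v\<^sub>1 < \<dots> < v\<^sub>n\<close> supported beyond \<open>n\<close> span
  \<open>l_1\<close> in Tsirelson's space and \<open>l_\<infinity>\<close> in the dual, so that
  \<open>F(z) = \<Sum> a\<^sub>k (|a\<^sub>k| / \<parallel>a\<parallel>)\<^sup>1\<^sup>-\<^sup>2\<^sup>z B(v\<^sub>k)(z)\<close> is admissible; hence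
  \<open>\<Omega>(\<Sum> a\<^sub>k v\<^sub>k)\<close> is \<open>\<Sum> a\<^sub>k \<Omega>(v\<^sub>k) - 2 \<Sum> K(a)\<^sub>k v\<^sub>k\<close> up to a bounded error, \<open>K\<close> being the
  Kalton-Peck map.

  A bounded sequence without convergent subsequences has a subsequence of the form \<open>w + (u\<^sub>k, v\<^sub>k)\<close>
  with blocks \<open>(u\<^sub>k, v\<^sub>k)\<close>, up to null errors. If \<open>v\<^sub>k\<close> tends to \<open>0\<close> along a subsequence, the blocks behave
  like the unit vectors of \<open>l_2\<close>, otherwise like those of \<open>l_M\<close>. If \<open>w \<noteq> 0\<close>, the norm of the
  spreading model gains the term \<open>|\<Sum> a\<^sub>k|\<close>; the sum being unbounded on both spaces, the
  completion is the direct sum with a line, which is isomorphic to the space itself. That both spaces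
  occur is seen on \<open>(e\<^sub>k, 0)\<close> and \<open>(0, e\<^sub>k)\<close>, with spreading limits provided by Ramsey's theorem.\<close>

section \<open>Sequences in \<open>l_2\<close>\<close>

text \<open>The map \<open>\<Omega>\<close> is inexplicit and fixed by a selection only up to
  bounded errors, and no l_p embeds into Tsirelson's space, so an exact formula for
  \<open>\<Omega>\<close> on long sums of blocks is out of reach. A spreading limit, however, tests
  tuples of fixed length n arbitrarily far out, and far out every n-tuple of blocks is admissible.
  The error in the block formula is then independent of n, and what survives is the Kalton-Peck
  term. Its factor -2 comes from the exponent 1 - 2z and affects constants only. Weak compactness is
  replaced by coordinatewise limits: a bounded sequence of pairs has a coordinatewise convergent
  subsequence, and its limit stays in the space by an argument in the style of Fatou's lemma. The
  completion in a spreading model is an abstract space. It is compared with its target on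
  \<open>c00\<close> alone, where the limit L is squeezed between multiples of the target norm. Both
  targets are treated as domains of quasilinear maps on l_2, namely of 0 and of the Kalton-Peck map,
  so that completeness, density and the correction by a line are proved once.\<close>

lemma scaleC_seq_apply [simp]: "(c *\<^sub>C x) j = c * (x j :: complex)"
  by (simp add: scaleC_fun_def scaleC_complex_def)

lemma sum_seq_apply [simp]: "(\<Sum>k\<in>A. f k) j = (\<Sum>k\<in>A. f k j :: complex)" for f :: "'a \<Rightarrow> cseq"
  by (induction A rule: infinite_finite_induct) auto

lemma restrict_seq_apply: "restrict_seq A x j = (if j \<in> A then x j else 0)"
  by (simp add: restrict_seq_def)

lemma restrict_seq_add: "restrict_seq A (x + y) = restrict_seq A x + restrict_seq A y"
  by (auto simp: restrict_seq_def fun_eq_iff)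

lemma restrict_seq_diff: "restrict_seq A (x - y) = restrict_seq A x - restrict_seq A y"
  by (auto simp: restrict_seq_def fun_eq_iff)

lemma restrict_seq_scale: "restrict_seq A (c *\<^sub>C x) = c *\<^sub>C restrict_seq A x"
  by (auto simp: restrict_seq_def fun_eq_iff)

lemma restrict_seq_sum: "restrict_seq A (\<Sum>k\<in>K. f k) = (\<Sum>k\<in>K. restrict_seq A (f k))"
  by (auto simp: restrict_seq_def fun_eq_iff)

lemma restrict_seq_restrict: "restrict_seq A (restrict_seq A' x) = restrict_seq (A \<inter> A') x"
  by (auto simp: restrict_seq_def fun_eq_iff)

lemma restrict_seq_split: "restrict_seq {..<m} x + restrict_seq {m..} x = x"
  by (auto simp: restrict_seq_def fun_eq_iff)

lemma restrict_seq_0 [simp]: "restrict_seq A 0 = 0"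
  by (auto simp: restrict_seq_def fun_eq_iff)

lemma restrict_seq_id: "(\<And>j. j \<notin> A \<Longrightarrow> x j = 0) \<Longrightarrow> restrict_seq A x = x"
  by (auto simp: restrict_seq_def fun_eq_iff)

lemma scaleC_zero_right [simp]: "c *\<^sub>C (0::'a::complex_vec) = 0"
  by (rule complex_vec.scale_zero_right)

lemma scaleC_zero_left [simp]: "0 *\<^sub>C (x::'a::complex_vec) = 0"
  by (rule complex_vec.scale_zero_left)

lemma scaleC_minus1: "(- 1) *\<^sub>C (x::'a::complex_vec) = - x"
  using complex_vec.scale_minus_left[of 1 x] by (simp add: scaleC_one)

lemma scaleC_diff_right: "c *\<^sub>C (x - y) = c *\<^sub>C x - c *\<^sub>C (y::'a::complex_vec)"
  by (rule complex_vec.scale_right_diff_distrib)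

lemma scaleC_sum_right: "c *\<^sub>C (\<Sum>k\<in>A. f k) = (\<Sum>k\<in>A. c *\<^sub>C (f k :: 'a::complex_vec))"
  by (rule complex_vec.scale_sum_right)

text \<open>Membership and bound are tied together because \<open>l2norm\<close> rests on
  \<open>suminf\<close>, whose value carries no information for a divergent series. By
  \<open>ell2_le_iff\<close> both amount to one uniform bound on finite sections.\<close>

definition ell2_le :: "real \<Rightarrow> cseq \<Rightarrow> bool" where
  "ell2_le M x \<longleftrightarrow> x \<in> carr ell2 \<and> l2norm x \<le> M"

lemma ell2_le_iff: "ell2_le M x \<longleftrightarrow> (\<forall>n. L2_set (\<lambda>j. cmod (x j)) {..<n} \<le> M)"
proof
  assume *: "ell2_le M x"
  show "\<forall>n. L2_set (\<lambda>j. cmod (x j)) {..<n} \<le> M"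
  proof
    fix n
    have s: "summable (\<lambda>j. (cmod (x j))\<^sup>2)" using * by (simp add: ell2_le_def ell2_def)
    have "L2_set (\<lambda>j. cmod (x j)) {..<n} \<le> l2norm x"
      unfolding L2_set_def l2norm_def
      by (intro real_sqrt_le_mono sum_le_suminf s) auto
    then show "L2_set (\<lambda>j. cmod (x j)) {..<n} \<le> M" using * by (simp add: ell2_le_def)
  qed
next
  assume *: "\<forall>n. L2_set (\<lambda>j. cmod (x j)) {..<n} \<le> M"
  have M: "0 \<le> M" using *[rule_format, of 0] by simp
  have **: "(\<Sum>j<n. (cmod (x j))\<^sup>2) \<le> M\<^sup>2" for n
    using *[rule_format, of n] unfolding L2_set_def
    using real_le_lsqrt real_sqrt_le_iff real_sqrt_unique sqrt_le_D by (simp add: sqrt_le_D)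
  have s: "summable (\<lambda>j. (cmod (x j))\<^sup>2)"
    by (rule summableI_nonneg_bounded[OF _ **]) auto
  have "l2norm x \<le> M" unfolding l2norm_def
    by (intro real_le_lsqrt M suminf_le_const s **)
  then show "ell2_le M x" using s by (simp add: ell2_le_def ell2_def)
qed

lemma l2norm_nonneg [simp]: "x \<in> carr ell2 \<Longrightarrow> 0 \<le> l2norm x"
  unfolding l2norm_def by (auto intro!: suminf_nonneg simp: ell2_def)

lemma ell2_le_nonneg: "ell2_le M x \<Longrightarrow> 0 \<le> M"
  unfolding ell2_le_iff by (drule spec[of _ 0]) simp

lemma ell2_le_refl: "x \<in> carr ell2 \<Longrightarrow> ell2_le (l2norm x) x"
  by (simp add: ell2_le_def)

lemma ell2_le_mem: "ell2_le M x \<Longrightarrow> x \<in> carr ell2"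
  by (simp add: ell2_le_def)

lemma ell2_le_le: "ell2_le M x \<Longrightarrow> l2norm x \<le> M"
  by (simp add: ell2_le_def)

lemma ell2_le_weaken: "ell2_le M x \<Longrightarrow> M \<le> M' \<Longrightarrow> ell2_le M' x"
  by (simp add: ell2_le_def)

lemma ell2_le_dominated: "ell2_le M y \<Longrightarrow> (\<And>j. cmod (x j) \<le> cmod (y j)) \<Longrightarrow> ell2_le M x"
  unfolding ell2_le_iff by (meson L2_set_mono norm_ge_zero order_trans)

lemma ell2_le_add: assumes "ell2_le M x" "ell2_le M' y" shows "ell2_le (M + M') (x + y)"
  unfolding ell2_le_iff
proof
  fix n
  have "L2_set (\<lambda>j. cmod ((x + y) j)) {..<n} \<le> L2_set (\<lambda>j. cmod (x j) + cmod (y j)) {..<n}"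
    by (rule L2_set_mono) (auto intro: norm_triangle_ineq)
  also have "\<dots> \<le> L2_set (\<lambda>j. cmod (x j)) {..<n} + L2_set (\<lambda>j. cmod (y j)) {..<n}"
    by (rule L2_set_triangle_ineq)
  also have "\<dots> \<le> M + M'" using assms by (intro add_mono) (auto simp: ell2_le_iff)
  finally show "L2_set (\<lambda>j. cmod ((x + y) j)) {..<n} \<le> M + M'" .
qed

lemma ell2_le_scale: assumes "ell2_le M x" shows "ell2_le (cmod c * M) (c *\<^sub>C x)"
  unfolding ell2_le_iff
proof
  fix n
  have "L2_set (\<lambda>j. cmod ((c *\<^sub>C x) j)) {..<n} = cmod c * L2_set (\<lambda>j. cmod (x j)) {..<n}"
    by (simp add: norm_mult L2_set_right_distrib)
  also have "\<dots> \<le> cmod c * M" using assms by (intro mult_left_mono) (auto simp: ell2_le_iff)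
  finally show "L2_set (\<lambda>j. cmod ((c *\<^sub>C x) j)) {..<n} \<le> cmod c * M" .
qed

lemma ell2_le_minus: "ell2_le M x \<Longrightarrow> ell2_le M (- x)"
  by (erule ell2_le_dominated) (simp add: fun_Compl_def)

lemma ell2_le_diff: "ell2_le M x \<Longrightarrow> ell2_le M' y \<Longrightarrow> ell2_le (M + M') (x - y)"
  using ell2_le_add[of M x M' "- y"] ell2_le_minus[of M' y] by simp

lemma ell2_le_restrict: "ell2_le M x \<Longrightarrow> ell2_le M (restrict_seq A x)"
  by (erule ell2_le_dominated) (simp add: restrict_seq_def)

lemma ell2_le_0: "0 \<le> M \<Longrightarrow> ell2_le M 0"
  by (simp add: ell2_le_iff L2_set_0')

lemma ell2_le_coord: assumes "ell2_le M x" shows "cmod (x j) \<le> M"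
proof -
  have "cmod (x j) \<le> L2_set (\<lambda>j. cmod (x j)) {..<Suc j}"
    by (rule member_le_L2_set) auto
  also have "\<dots> \<le> M" using assms by (auto simp: ell2_le_iff)
  finally show ?thesis .
qed

text \<open>Fatou's lemma for l_2: finite sections depend on finitely many coordinates, so their
  norms converge. The bound may vary with \<open>n\<close>, for estimates one part of which tends to
  0.\<close>

lemma ell2_le_limit:
  assumes "\<And>j. (\<lambda>n. x n j) \<longlonglongrightarrow> y j" "\<forall>\<^sub>F n in sequentially. ell2_le (M n) (x n)" "M \<longlonglongrightarrow> M'"
  shows "ell2_le M' y"
  unfolding ell2_le_iff
proof
  fix m
  have "(\<lambda>n. L2_set (\<lambda>j. cmod (x n j)) {..<m}) \<longlonglongrightarrow> L2_set (\<lambda>j. cmod (y j)) {..<m}"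
    unfolding L2_set_def by (intro tendsto_intros assms)
  moreover have "\<forall>\<^sub>F n in sequentially. L2_set (\<lambda>j. cmod (x n j)) {..<m} \<le> M n"
    using assms(2) by eventually_elim (auto simp: ell2_le_iff)
  ultimately show "L2_set (\<lambda>j. cmod (y j)) {..<m} \<le> M'"
    by (rule tendsto_le[OF sequentially_bot assms(3)])
qed

lemma l2norm_triangle:
  "x \<in> carr ell2 \<Longrightarrow> y \<in> carr ell2 \<Longrightarrow> l2norm (x + y) \<le> l2norm x + l2norm y"
  using ell2_le_add ell2_le_le ell2_le_refl by blast

lemma l2norm_triangle_diff:
  "x \<in> carr ell2 \<Longrightarrow> y \<in> carr ell2 \<Longrightarrow> l2norm (x - y) \<le> l2norm x + l2norm y"
  using ell2_le_diff ell2_le_le ell2_le_refl by blast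

lemma ell2_0 [simp]: "0 \<in> carr ell2"
  using ell2_le_0 ell2_le_mem by blast

lemma ell2_add: "x \<in> carr ell2 \<Longrightarrow> y \<in> carr ell2 \<Longrightarrow> x + y \<in> carr ell2"
  using ell2_le_add ell2_le_mem ell2_le_refl by blast

lemma ell2_diff: "x \<in> carr ell2 \<Longrightarrow> y \<in> carr ell2 \<Longrightarrow> x - y \<in> carr ell2"
  using ell2_le_diff ell2_le_mem ell2_le_refl by blast

lemma ell2_minus: "x \<in> carr ell2 \<Longrightarrow> - x \<in> carr ell2"
  using ell2_le_minus ell2_le_mem ell2_le_refl by blast

lemma ell2_scale: "x \<in> carr ell2 \<Longrightarrow> c *\<^sub>C x \<in> carr ell2"
  using ell2_le_scale ell2_le_mem ell2_le_refl by blast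

lemma ell2_restrict: "x \<in> carr ell2 \<Longrightarrow> restrict_seq A x \<in> carr ell2"
  using ell2_le_restrict ell2_le_mem ell2_le_refl by blast

lemma ell2_sum: "(\<And>k. k \<in> K \<Longrightarrow> f k \<in> carr ell2) \<Longrightarrow> (\<Sum>k\<in>K. f k) \<in> carr ell2"
  by (induction K rule: infinite_finite_induct) (auto intro: ell2_add)

lemma l2norm_0 [simp]: "l2norm 0 = 0"
  by (simp add: l2norm_def)

lemma l2norm_eq_0:
  assumes "x \<in> carr ell2"
  shows "l2norm x = 0 \<longleftrightarrow> x = 0"
proof
  assume "l2norm x = 0"
  then show "x = 0" using assms ell2_le_coord[of 0 x] by (auto simp: ell2_le_def fun_eq_iff)
qed simp

lemma l2norm_scale: "l2norm (c *\<^sub>C x) = cmod c * l2norm x" if "x \<in> carr ell2"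
proof -
  have "summable (\<lambda>j. (cmod (x j))\<^sup>2)" using that by (simp add: ell2_def)
  then show ?thesis
    by (simp add: l2norm_def norm_mult power_mult_distrib suminf_mult real_sqrt_mult)
qed

lemma l2norm_minus: "l2norm (- x) = l2norm x"
  by (simp add: l2norm_def fun_Compl_def)

lemma l2norm_minus_commute: "l2norm (x - y) = l2norm (y - x)"
  using l2norm_minus[of "x - y"] by simp

lemma l2norm_restrict_le: "x \<in> carr ell2 \<Longrightarrow> l2norm (restrict_seq A x) \<le> l2norm x"
  by (intro ell2_le_le ell2_le_restrict ell2_le_refl)

lemma l2norm_coord: "x \<in> carr ell2 \<Longrightarrow> cmod (x j) \<le> l2norm x"
  by (intro ell2_le_coord ell2_le_refl)

lemma l2norm_finite:
  assumes "\<forall>j\<ge>n. x j = 0"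
  shows "x \<in> carr ell2" "(l2norm x)\<^sup>2 = (\<Sum>j<n. (cmod (x j))\<^sup>2)"
proof -
  have z: "\<And>j. j \<notin> {..<n} \<Longrightarrow> (cmod (x j))\<^sup>2 = 0" using assms by auto
  show "x \<in> carr ell2" using summable_finite[OF _ z, of "{..<n}"] by (simp add: ell2_def)
  have "(\<Sum>j. (cmod (x j))\<^sup>2) = (\<Sum>j<n. (cmod (x j))\<^sup>2)"
    using suminf_finite[OF _ z, of "{..<n}"] by simp
  then show "(l2norm x)\<^sup>2 = (\<Sum>j<n. (cmod (x j))\<^sup>2)"
    by (simp add: l2norm_def sum_nonneg)
qed

lemma l2norm_unit_seq: "unit_seq i \<in> carr ell2" "l2norm (unit_seq i) = 1"
proof -
  have z: "\<forall>j\<ge>Suc i. unit_seq i j = 0" by (auto simp: unit_seq_def)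
  show mem: "unit_seq i \<in> carr ell2" by (rule l2norm_finite[OF z])
  have "(\<Sum>j<Suc i. (cmod (unit_seq i j))\<^sup>2) = 1"
    by (subst sum.remove[of _ i]) (auto simp: unit_seq_def intro!: sum.neutral)
  then have "(l2norm (unit_seq i))\<^sup>2 = 1" using l2norm_finite(2)[OF z] by simp
  then show "l2norm (unit_seq i) = 1" 
    using l2norm_nonneg[OF mem] by (auto simp: power2_eq_1_iff)
qed

lemma c00_support: "x \<in> c00 \<longleftrightarrow> (\<exists>n. \<forall>j\<ge>n. x j = 0)"
proof
  assume "x \<in> c00"
  then have "finite {j. x j \<noteq> 0}" by (simp add: c00_def)
  then obtain n where "\<forall>j\<in>{j. x j \<noteq> 0}. j < n" using finite_nat_set_iff_bounded by auto
  then show "\<exists>n. \<forall>j\<ge>n. x j = 0" by (intro exI[of _ n]) force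
next
  assume "\<exists>n. \<forall>j\<ge>n. x j = 0"
  then obtain n where "\<forall>j\<ge>n. x j = 0" by blast
  then have "{j. x j \<noteq> 0} \<subseteq> {..<n}" by (auto simp: not_le[symmetric])
  then show "x \<in> c00" using finite_subset by (auto simp: c00_def)
qed

lemma c00_ell2: "x \<in> c00 \<Longrightarrow> x \<in> carr ell2"
  using l2norm_finite(1) by (auto simp: c00_support)

lemma restrict_lessThan_c00: "restrict_seq {..<n} x \<in> c00"
  by (auto simp: c00_support restrict_seq_def intro!: exI[of _ n])

lemma l2norm_tail: assumes "x \<in> carr ell2"
  shows "(\<lambda>m. l2norm (restrict_seq {m..} x)) \<longlonglongrightarrow> 0"
proof -
  let ?f = "\<lambda>j. (cmod (x j))\<^sup>2"
  have s: "summable ?f" using assms by (simp add: ell2_def)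
  have eq: "l2norm (restrict_seq {m..} x) = sqrt (suminf ?f - (\<Sum>j<m. ?f j))" for m
  proof -
    let ?g = "\<lambda>j. (cmod (restrict_seq {m..} x j))\<^sup>2" and ?h = "\<lambda>j. (cmod (restrict_seq {..<m} x j))\<^sup>2"
    have g: "summable ?g" using ell2_restrict[OF assms] by (simp add: ell2_def)
    have h: "summable ?h" using ell2_restrict[OF assms] by (simp add: ell2_def)
    have "suminf ?f = (\<Sum>j. ?h j + ?g j)"
      by (rule suminf_cong) (auto simp: restrict_seq_def)
    also have "\<dots> = suminf ?h + suminf ?g" using suminf_add[OF h g] by simp
    also have "suminf ?h = (\<Sum>j<m. ?h j)" by (rule suminf_finite) (auto simp: restrict_seq_def)
    also have "\<dots> = (\<Sum>j<m. ?f j)" by (rule sum.cong) (auto simp: restrict_seq_def)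
    finally show ?thesis by (simp add: l2norm_def)
  qed
  have "(\<lambda>m. sqrt (suminf ?f - (\<Sum>j<m. ?f j))) \<longlonglongrightarrow> sqrt (suminf ?f - suminf ?f)"
    by (intro tendsto_intros summable_LIMSEQ s)
  then show ?thesis by (simp add: eq)
qed

text \<open>Pythagoras: at each coordinate at most one summand is nonzero, so the squares add up
  pointwise before the sum over coordinates is taken.\<close>

lemma l2norm_disjoint_sum:
  fixes n :: nat
  assumes disj: "\<And>i j. i < n \<Longrightarrow> j < n \<Longrightarrow> i \<noteq> j \<Longrightarrow> I i \<inter> I j = {}"
    and supp: "\<And>k j. k < n \<Longrightarrow> j \<notin> I k \<Longrightarrow> w k j = 0"
    and w: "\<And>k. k < n \<Longrightarrow> w k \<in> carr ell2"
  shows "(l2norm (\<Sum>k<n. c k *\<^sub>C w k))\<^sup>2 = (\<Sum>k<n. (cmod (c k) * l2norm (w k))\<^sup>2)"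
proof -
  have pt: "(cmod ((\<Sum>k<n. c k *\<^sub>C w k) j))\<^sup>2 = (\<Sum>k<n. (cmod (c k))\<^sup>2 * (cmod (w k j))\<^sup>2)" for j
  proof (cases "\<exists>i<n. j \<in> I i")
    case True
    then obtain i where i: "i < n" "j \<in> I i" by blast
    have z: "w k j = 0" if "k < n" "k \<noteq> i" for k
      using disj[of k i] supp[of k j] that i by auto
    have "(\<Sum>k<n. c k * w k j) = (\<Sum>k\<in>{i}. c k * w k j)"
      by (rule sum.mono_neutral_right) (use i z in auto)
    moreover have "(\<Sum>k<n. (cmod (c k))\<^sup>2 * (cmod (w k j))\<^sup>2) = (\<Sum>k\<in>{i}. (cmod (c k))\<^sup>2 * (cmod (w k j))\<^sup>2)"
      by (rule sum.mono_neutral_right) (use i z in auto)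
    ultimately show ?thesis
      by (simp only: sum_seq_apply scaleC_seq_apply) (simp add: norm_mult power_mult_distrib)
  next
    case False
    then have "w k j = 0" if "k < n" for k using that supp[of k j] by blast
    then show ?thesis by simp
  qed
  have s: "summable (\<lambda>j. (cmod (w k j))\<^sup>2)" if "k < n" for k using w[OF that] by (simp add: ell2_def)
  have mem: "(\<Sum>k<n. c k *\<^sub>C w k) \<in> carr ell2" by (intro ell2_sum ell2_scale w) auto
  then have "(l2norm (\<Sum>k<n. c k *\<^sub>C w k))\<^sup>2 = (\<Sum>j. (cmod ((\<Sum>k<n. c k *\<^sub>C w k) j))\<^sup>2)"
    unfolding l2norm_def by (subst real_sqrt_pow2) (auto intro!: suminf_nonneg simp: ell2_def)
  also have "\<dots> = (\<Sum>j. \<Sum>k<n. (cmod (c k))\<^sup>2 * (cmod (w k j))\<^sup>2)" by (simp only: pt)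
  also have "\<dots> = (\<Sum>k<n. \<Sum>j. (cmod (c k))\<^sup>2 * (cmod (w k j))\<^sup>2)"
    by (rule suminf_sum) (auto intro: s)
  also have "\<dots> = (\<Sum>k<n. (cmod (c k) * l2norm (w k))\<^sup>2)"
  proof (rule sum.cong)
    fix k assume "k \<in> {..<n}"
    then have "(l2norm (w k))\<^sup>2 = (\<Sum>j. (cmod (w k j))\<^sup>2)"
      unfolding l2norm_def by (subst real_sqrt_pow2) (auto intro!: suminf_nonneg s)
    then show "(\<Sum>j. (cmod (c k))\<^sup>2 * (cmod (w k j))\<^sup>2) = (cmod (c k) * l2norm (w k))\<^sup>2"
      using s \<open>k \<in> {..<n}\<close> by (simp add: suminf_mult power_mult_distrib)
  qed auto
  finally show ?thesis .
qed

lemma l2norm_disjoint_bounds: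
  fixes n :: nat
  assumes disj: "\<And>i j. i < n \<Longrightarrow> j < n \<Longrightarrow> i \<noteq> j \<Longrightarrow> I i \<inter> I j = {}"
    and supp: "\<And>k j. k < n \<Longrightarrow> j \<notin> I k \<Longrightarrow> w k j = 0"
    and w: "\<And>k. k < n \<Longrightarrow> w k \<in> carr ell2"
    and c: "\<forall>j\<ge>n. c j = 0"
  shows "(\<And>k. k < n \<Longrightarrow> l2norm (w k) \<le> R) \<Longrightarrow> 0 \<le> R \<Longrightarrow> l2norm (\<Sum>k<n. c k *\<^sub>C w k) \<le> R * l2norm c"
    and "(\<And>k. k < n \<Longrightarrow> d \<le> l2norm (w k)) \<Longrightarrow> 0 \<le> d \<Longrightarrow> d * l2norm c \<le> l2norm (\<Sum>k<n. c k *\<^sub>C w k)"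
proof -
  have eq: "(l2norm (\<Sum>k<n. c k *\<^sub>C w k))\<^sup>2 = (\<Sum>k<n. (cmod (c k) * l2norm (w k))\<^sup>2)"
    by (rule l2norm_disjoint_sum[OF disj supp w])
  have c2: "(l2norm c)\<^sup>2 = (\<Sum>j<n. (cmod (c j))\<^sup>2)" using c by (rule l2norm_finite)
  show "l2norm (\<Sum>k<n. c k *\<^sub>C w k) \<le> R * l2norm c"
    if "\<And>k. k < n \<Longrightarrow> l2norm (w k) \<le> R" "0 \<le> R"
  proof (rule power2_le_imp_le)
    show "(l2norm (\<Sum>k<n. c k *\<^sub>C w k))\<^sup>2 \<le> (R * l2norm c)\<^sup>2"
      unfolding eq power_mult_distrib c2 sum_distrib_left
      by (rule sum_mono) (use that w in \<open>auto simp: mult.commute intro!: mult_mono power_mono\<close>)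
  qed (use that l2norm_finite(1)[OF c] in auto)
  show "d * l2norm c \<le> l2norm (\<Sum>k<n. c k *\<^sub>C w k)"
    if "\<And>k. k < n \<Longrightarrow> d \<le> l2norm (w k)" "0 \<le> d"
  proof (rule power2_le_imp_le)
    show "(d * l2norm c)\<^sup>2 \<le> (l2norm (\<Sum>k<n. c k *\<^sub>C w k))\<^sup>2"
      unfolding eq power_mult_distrib c2 sum_distrib_left
      by (rule sum_mono) (use that in \<open>auto simp: mult.commute intro!: mult_mono power_mono\<close>)
  qed (intro l2norm_nonneg ell2_sum ell2_scale w, simp)
qed


section \<open>Bounded analytic functions on the strip\<close>

definition strip_fun :: "(complex \<Rightarrow> complex) \<Rightarrow> bool" where
  "strip_fun g \<longleftrightarrow> bounded (g ` strip) \<and> continuous_on strip g \<and> g holomorphic_on interior strip"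

lemma interior_strip: "interior strip = {z. 0 < Re z \<and> Re z < 1}"
proof -
  have "strip = {z. 0 \<le> 1 \<bullet> z} \<inter> {z. 1 \<bullet> z \<le> (1::real)}" by (auto simp: strip_def)
  then have "interior strip = interior {z::complex. 0 \<le> 1 \<bullet> z} \<inter> interior {z::complex. 1 \<bullet> z \<le> (1::real)}"
    by (simp only: interior_Int[symmetric])
  also have "interior {z::complex. 0 \<le> 1 \<bullet> z} = {z. 0 < 1 \<bullet> z}"
    using interior_halfspace_ge[of "1::complex" 0] by simp
  also have "interior {z::complex. 1 \<bullet> z \<le> (1::real)} = {z. 1 \<bullet> z < 1}"
    by (rule interior_halfspace_le) simp
  finally show ?thesis by auto
qed

lemma half_in_strip: "1/2 \<in> interior strip" "1/2 \<in> strip"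
  unfolding interior_strip by (simp_all add: strip_def)

lemma strip_fun_bound: assumes "strip_fun g" obtains K where "0 < K" "\<And>z. z \<in> strip \<Longrightarrow> cmod (g z) \<le> K"
  using assms unfolding strip_fun_def bounded_pos by auto

lemma strip_funI:
  assumes "\<And>z. z \<in> strip \<Longrightarrow> cmod (g z) \<le> K" "continuous_on strip g" "g holomorphic_on interior strip"
  shows "strip_fun g"
  using assms unfolding strip_fun_def bounded_iff by auto

lemma strip_fun_const: "strip_fun (\<lambda>z. c)"
  by (rule strip_funI[where K = "cmod c"]) auto

lemma strip_fun_add: assumes "strip_fun f" "strip_fun g" shows "strip_fun (\<lambda>z. f z + g z)"
proof -
  obtain K L where "\<And>z. z \<in> strip \<Longrightarrow> cmod (f z) \<le> K" "\<And>z. z \<in> strip \<Longrightarrow> cmod (g z) \<le> L"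
    using assms strip_fun_bound by metis
  then have "\<And>z. z \<in> strip \<Longrightarrow> cmod (f z + g z) \<le> K + L"
    by (meson add_mono norm_triangle_le)
  then show ?thesis
    using assms by (intro strip_funI) (auto simp: strip_fun_def intro!: continuous_intros holomorphic_intros)
qed

lemma strip_fun_mult: assumes "strip_fun f" "strip_fun g" shows "strip_fun (\<lambda>z. f z * g z)"
proof -
  obtain K L where K: "0 < K" "\<And>z. z \<in> strip \<Longrightarrow> cmod (f z) \<le> K"
    and L: "\<And>z. z \<in> strip \<Longrightarrow> cmod (g z) \<le> L"
    using assms strip_fun_bound by metis
  then have "\<And>z. z \<in> strip \<Longrightarrow> cmod (f z * g z) \<le> K * L"
    unfolding norm_mult by (intro mult_mono) auto
  then show ?thesis
    using assms by (intro strip_funI) (auto simp: strip_fun_def intro!: continuous_intros holomorphic_intros)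
qed

lemma strip_fun_sum: "(\<And>k. k \<in> A \<Longrightarrow> strip_fun (f k)) \<Longrightarrow> strip_fun (\<lambda>z. \<Sum>k\<in>A. f k z)"
  by (induction A rule: infinite_finite_induct) (auto intro: strip_fun_add strip_fun_const)

text \<open>The map \<open>z \<mapsto> 1 - cnj z\<close> reflects the strip in the line
  \<open>Re z = 1/2\<close> and is antiholomorphic; the outer conjugation restores
  holomorphy.\<close>

lemma strip_fun_reflect: assumes "strip_fun g" shows "strip_fun (\<lambda>z. cnj (g (1 - cnj z)))"
proof -
  obtain K where "\<And>z. z \<in> strip \<Longrightarrow> cmod (g z) \<le> K" using assms strip_fun_bound by metis
  moreover have s: "z \<in> strip \<Longrightarrow> 1 - cnj z \<in> strip" for z by (auto simp: strip_def)
  ultimately have "\<And>z. z \<in> strip \<Longrightarrow> cmod (cnj (g (1 - cnj z))) \<le> K" by simp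
  moreover have "continuous_on strip (\<lambda>z. cnj (g (1 - cnj z)))"
  proof (rule continuous_on_cnj)
    show "continuous_on strip (\<lambda>z. g (1 - cnj z))"
      by (rule continuous_on_compose2[of strip g strip "\<lambda>z. 1 - cnj z"])
        (use assms s in \<open>auto simp: strip_fun_def intro!: continuous_intros\<close>)
  qed
  moreover have "(\<lambda>z. cnj (g (1 - cnj z))) holomorphic_on interior strip"
  proof -
    have "(g \<circ> (\<lambda>w. 1 - w)) holomorphic_on cnj ` interior strip"
      using assms unfolding strip_fun_def
      by (intro holomorphic_on_compose_gen[where t = "interior strip"] holomorphic_intros)
         (auto simp: interior_strip)
    then have "cnj \<circ> (g \<circ> (\<lambda>w. 1 - w)) \<circ> cnj holomorphic_on interior strip"
      by (rule holomorphic_on_compose_cnj_cnj) auto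
    then show ?thesis by (simp add: o_def)
  qed
  ultimately show ?thesis by (rule strip_funI)
qed

text \<open>The three lines theorem at the centre. The maximum principle is applied on a rectangle;
  since \<open>h\<close> is bounded on the whole strip, by a \<open>K\<close> of any size, a linear
  denominator suffices to control the horizontal sides.\<close>

lemma strip_fun_half_bound:
  assumes h: "strip_fun h"
    and b0: "\<And>t. cmod (h (\<i> * of_real t)) \<le> M" and b1: "\<And>t. cmod (h (1 + \<i> * of_real t)) \<le> M"
  shows "cmod (h (1/2)) \<le> M"
proof -
  obtain K where K: "0 < K" "\<And>z. z \<in> strip \<Longrightarrow> cmod (h z) \<le> K" using h strip_fun_bound by metis
  have M: "0 \<le> M" using b0 norm_ge_zero order_trans by blast
  have main: "cmod (h (1/2)) \<le> (M + e) * (1 + e / 2)" if e: "0 < e" for e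
  proof -
    \<comment> \<open>The denominator has modulus at least 1 on the strip and forces decay at infinity.\<close>
    define g where "g z = h z / (1 + of_real e * z)" for z
    \<comment> \<open>On the horizontal sides the denominator has modulus at least
      \<open>e * R\<close>, so this height turns the crude bound \<open>K\<close> into exactly
      \<open>M + e\<close>.\<close>
    define R where "R = K / (e * (M + e))"
    have R: "0 < R" using K M e by (simp add: R_def)
    let ?S = "cbox (Complex 0 (- R)) (Complex 1 R)"
    have sub: "?S \<subseteq> strip" by (auto simp: strip_def in_cbox_complex_iff)
    have re: "1 \<le> cmod (1 + of_real e * z)" if "z \<in> strip" for z
    proof -
      have "1 \<le> Re (1 + of_real e * z)" using that e by (simp add: strip_def)
      then show ?thesis using complex_Re_le_cmod order_trans by blast
    qed
    then have nz: "1 + of_real e * z \<noteq> 0" if "z \<in> strip" for z using that by fastforce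
    have "cmod (g (1/2)) \<le> M + e"
    proof (rule maximum_modulus_frontier[of g ?S])
      show "g holomorphic_on interior ?S"
        unfolding g_def using h nz interior_mono[OF sub] interior_subset[of strip] unfolding strip_fun_def
        by (intro holomorphic_intros) (auto intro: holomorphic_on_subset)
      show "continuous_on (closure ?S) g"
        unfolding g_def using h nz sub unfolding strip_fun_def
        by (intro continuous_intros) (auto intro: continuous_on_subset)
      show "1/2 \<in> ?S" using R by (simp add: in_cbox_complex_iff)
      show "cmod (g z) \<le> M + e" if "z \<in> frontier ?S" for z
      proof -
        have z: "z \<in> ?S" "z \<notin> box (Complex 0 (- R)) (Complex 1 R)"
          using that by (auto simp: frontier_def interior_cbox)
        then have zs: "z \<in> strip" using sub by auto
        have "Re z = 0 \<or> Re z = 1 \<or> \<bar>Im z\<bar> = R" using z by (auto simp: in_cbox_complex_iff in_box_complex_iff)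
        then show ?thesis
        proof (elim disjE)
          assume "\<bar>Im z\<bar> = R"
          moreover have "\<bar>Im (1 + of_real e * z)\<bar> \<le> cmod (1 + of_real e * z)" by (rule abs_Im_le_cmod)
          ultimately have "e * R \<le> cmod (1 + of_real e * z)" using e by (simp add: abs_mult)
          then have "cmod (h z) / cmod (1 + of_real e * z) \<le> K / (e * R)"
            using K zs e R by (intro frac_le) auto
          also have "K / (e * R) = M + e" using K e M by (simp add: R_def)
          finally show ?thesis by (simp add: g_def norm_divide)
        next
          assume "Re z = 0"
          then have "z = \<i> * of_real (Im z)" by (simp add: complex_eq_iff)
          then have "cmod (h z) \<le> M" using b0 by metis
          then have "cmod (h z) / cmod (1 + of_real e * z) \<le> M / 1"
            using re[OF zs] M by (intro frac_le) auto
          then show ?thesis using e by (simp add: g_def norm_divide)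
        next
          assume "Re z = 1"
          then have "z = 1 + \<i> * of_real (Im z)" by (simp add: complex_eq_iff)
          then have "cmod (h z) \<le> M" using b1 by metis
          then have "cmod (h z) / cmod (1 + of_real e * z) \<le> M / 1"
            using re[OF zs] M by (intro frac_le) auto
          then show ?thesis using e by (simp add: g_def norm_divide)
        qed
      qed
    qed simp
    moreover have "cmod (1 + complex_of_real e * (1/2)) = 1 + e/2"
    proof -
      have "1 + complex_of_real e * (1/2) = of_real (1 + e/2)" by simp
      then show ?thesis using e by (simp only: norm_of_real)
    qed
    ultimately have "cmod (h (1/2)) / (1 + e/2) \<le> M + e" by (simp add: g_def norm_divide)
    then show ?thesis using e by (simp add: field_simps)
  qed
  have "((\<lambda>e. (M + e) * (1 + e / 2)) \<longlongrightarrow> (M + 0) * (1 + 0 / 2)) (at_right 0)"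
    by (intro tendsto_intros) auto
  moreover have "\<forall>\<^sub>F e in at_right 0. cmod (h (1/2)) \<le> (M + e) * (1 + e / 2)"
    using eventually_at_right_less[of 0] by (rule eventually_mono) (rule main)
  ultimately show ?thesis using tendsto_lowerbound[of _ _ "at_right (0::real)"] by fastforce
qed

text \<open>The singularity is removable, so the point is boundedness: near the centre it follows
  from compactness of a disc inside the strip, elsewhere from
  \<open>|z - 1/2| \<ge> 1/4\<close>.\<close>

lemma strip_fun_quotient:
  assumes g: "strip_fun g" and z: "g (1/2) = 0"
  shows "strip_fun (\<lambda>z. if z = 1/2 then deriv g (1/2) else g z / (z - 1/2))" (is "strip_fun ?q")
proof -
  have hol: "?q holomorphic_on interior strip"
    using pole_lemma_open[of g "interior strip" "1/2"] g by (simp add: strip_fun_def z cong: if_cong)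
  have cont: "continuous_on strip ?q"
  proof -
    have "continuous (at z within strip) ?q" if "z \<in> strip" for z
    proof (cases "z = 1/2")
      case True
      have "isCont ?q z"
        using holomorphic_on_imp_continuous_on[OF hol] half_in_strip True
        by (metis continuous_on_eq_continuous_at open_interior)
      then show ?thesis using continuous_at_imp_continuous_at_within by blast
    next
      case False
      have "continuous_on (strip - {1/2}) ?q"
      proof -
        have "continuous_on (strip - {1/2}) (\<lambda>z. g z / (z - 1/2))"
          using g unfolding strip_fun_def
          by (intro continuous_intros) (auto intro: continuous_on_subset)
        then show ?thesis by (rule continuous_on_eq) auto
      qed
      then have "continuous (at z within strip - {1/2}) ?q"
        using that False by (simp add: continuous_on_eq_continuous_within)
      moreover have "at z within strip - {1/2} = at z within strip"
        using False at_within_nhd[of z "- {1/2}" "strip - {1/2}" strip] by auto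
      ultimately show ?thesis by simp
    qed
    then show ?thesis by (simp add: continuous_on_eq_continuous_within)
  qed
  have "compact (cball (1/2) (1/4) :: complex set)" "cball (1/2) (1/4) \<subseteq> strip"
  proof -
    show "cball (1/2) (1/4) \<subseteq> strip"
    proof
      fix w :: complex assume "w \<in> cball (1/2) (1/4)"
      then have "cmod (w - 1/2) \<le> 1/4" by (simp add: dist_norm norm_minus_commute)
      then have "\<bar>Re (w - 1/2)\<bar> \<le> 1/4" using abs_Re_le_cmod order_trans by blast
      then have "\<bar>Re w - 1/2\<bar> \<le> 1/4" by simp
      then have "0 \<le> Re w \<and> Re w \<le> 1" by linarith
      then show "w \<in> strip" by (simp add: strip_def)
    qed
  qed simp
  then have "bounded (?q ` cball (1/2) (1/4))"
    using cont by (intro compact_imp_bounded compact_continuous_image) (auto intro: continuous_on_subset)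
  then obtain L where L: "\<And>w. w \<in> cball (1/2) (1/4) \<Longrightarrow> cmod (?q w) \<le> L"
    unfolding bounded_iff by blast
  obtain K where K: "0 < K" "\<And>z. z \<in> strip \<Longrightarrow> cmod (g z) \<le> K" using g strip_fun_bound by metis
  have "cmod (?q w) \<le> max L (4 * K)" if "w \<in> strip" for w
  proof (cases "w \<in> cball (1/2) (1/4)")
    case True then show ?thesis using L[OF True] by linarith
  next
    case False
    then have f: "1/4 \<le> cmod (w - 1/2)" by (simp add: dist_norm norm_minus_commute)
    have "w \<noteq> 1/2"
    proof
      assume "w = 1/2"
      with f have "1/4 \<le> cmod (1/2 - 1/2 :: complex)" by blast
      then show False by (simp only: diff_self norm_zero)
    qed
    moreover have "cmod (g w) / cmod (w - 1/2) \<le> K / (1/4)"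
      using K that f by (intro frac_le) auto
    ultimately show ?thesis by (simp add: norm_divide)
  qed
  then show ?thesis using cont hol by (rule strip_funI)
qed

lemma strip_fun_deriv:
  "strip_fun g \<Longrightarrow> (g has_field_derivative deriv g (1/2)) (at (1/2))"
  unfolding strip_fun_def using half_in_strip holomorphic_derivI open_interior by blast


section \<open>Tsirelson's norm and its dual\<close>

lemma c00I: "\<forall>j\<ge>m. x j = 0 \<Longrightarrow> x \<in> c00"
  by (auto simp: c00_support)

lemma c00_dominated: "y \<in> c00 \<Longrightarrow> (\<And>j. cmod (x j) \<le> cmod (y j)) \<Longrightarrow> x \<in> c00"
  unfolding c00_def by (auto elim!: rev_finite_subset) (metis norm_le_zero_iff norm_zero)

lemma c00_restrict: "x \<in> c00 \<Longrightarrow> restrict_seq A x \<in> c00"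
  by (erule c00_dominated) (simp add: restrict_seq_def)

lemma c00_add: "x \<in> c00 \<Longrightarrow> y \<in> c00 \<Longrightarrow> x + y \<in> c00"
  unfolding c00_def by (auto intro: finite_subset[of _ "{j. x j \<noteq> 0} \<union> {j. y j \<noteq> 0}"])

lemma c00_scale: "x \<in> c00 \<Longrightarrow> c *\<^sub>C x \<in> c00"
  unfolding c00_support by auto

lemma c00_0 [simp]: "0 \<in> c00"
  by (simp add: c00_support)

lemma c00_sum: "(\<And>k. k \<in> A \<Longrightarrow> f k \<in> c00) \<Longrightarrow> (\<Sum>k\<in>A. f k) \<in> c00"
  by (induction A rule: infinite_finite_induct) (auto intro: c00_add)

lemma c00_unit_seq [simp]: "unit_seq j \<in> c00"
  by (rule c00I[where m = "Suc j"]) (auto simp: unit_seq_def)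

lemma c00_csubspace: "csubspace c00"
  by (rule complex_vec.subspaceI) (auto intro: c00_add c00_scale)

lemma unit_seq_expansion: "\<forall>j\<ge>m. x j = 0 \<Longrightarrow> x = (\<Sum>j<m. x j *\<^sub>C unit_seq j)"
proof
  fix i assume *: "\<forall>j\<ge>m. x j = 0"
  have "(\<Sum>j<m. x j * (if i = j then 1 else 0)) = (if i < m then x i else 0)"
    by (simp add: if_distrib cong: if_cong)
  moreover have "i < m \<or> x i = 0" using * not_le by blast
  ultimately show "x i = (\<Sum>j<m. x j *\<^sub>C unit_seq j) i" by (auto simp: unit_seq_def)
qed

section \<open>Admissible families and the stages of Tsirelson's norm\<close>

lemma admissible_less:
  assumes "admissible k A" "i < j" "j < k" "a \<in> A i" "b \<in> A j"
  shows "a < b"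
  using assms(2,3,5)
proof (induction j arbitrary: b)
  case (Suc j)
  have fin: "finite (A l)" "A l \<noteq> {}" if "l < k" for l using assms(1) that by (auto simp: admissible_def)
  have "Max (A j) < Min (A (Suc j))" using assms(1) Suc.prems by (auto simp: admissible_def)
  moreover have "Min (A (Suc j)) \<le> b" using fin Suc.prems by auto
  moreover have "a \<le> Max (A j)"
  proof (cases "i = j")
    case True then show ?thesis using fin Suc.prems assms(4) by auto
  next
    case False
    then have "a < Max (A j)" using fin Suc.prems by (intro Suc.IH) auto
    then show ?thesis by simp
  qed
  ultimately show ?case by simp
qed simp

lemma admissible_disjoint:
  assumes "admissible k A" "i < k" "j < k" "i \<noteq> j"
  shows "A i \<inter> A j = {}"
proof -
  have "a \<notin> A j" if "a \<in> A i" for a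
  proof
    assume "a \<in> A j"
    consider "i < j" | "j < i" using assms(4) by linarith
    then show False
      using admissible_less[OF assms(1) _ assms(3) that \<open>a \<in> A j\<close>]
        admissible_less[OF assms(1) _ assms(2) \<open>a \<in> A j\<close> that]
      by cases blast+
  qed
  then show ?thesis by blast
qed

lemma admissible_exists: "\<exists>k A. admissible k A"
  by (rule exI[of _ 1], rule exI[of _ "\<lambda>_. {0}"]) (auto simp: admissible_def)

abbreviation ts_sums :: "nat \<Rightarrow> cseq \<Rightarrow> real set" where
  "ts_sums n x \<equiv> {\<Sum>i<k. tsirelson_norm_step n (restrict_seq (A i) x) | k A. admissible k A}"

lemma ts_sums_nonempty: "ts_sums n x \<noteq> {}"
  using admissible_exists by blast

text \<open>Members of an admissible family are disjoint, so each coordinate is counted at most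
  once.\<close>

lemma admissible_l1:
  assumes A: "admissible k A"
  shows "(\<Sum>i<k. \<Sum>j<m. cmod (restrict_seq (A i) x j)) \<le> (\<Sum>j<m. cmod (x j))"
proof -
  have "(\<Sum>i<k. \<Sum>j<m. cmod (restrict_seq (A i) x j)) = (\<Sum>j<m. \<Sum>i<k. cmod (restrict_seq (A i) x j))"
    by (rule sum.swap)
    also have "\<dots> \<le> (\<Sum>j<m. cmod (x j))"
    proof (rule sum_mono)
      fix j
      show "(\<Sum>i<k. cmod (restrict_seq (A i) x j)) \<le> cmod (x j)"
      proof (cases "\<exists>i<k. j \<in> A i")
        case True
        then obtain i where i: "i < k" "j \<in> A i" by blast
        then have "(\<Sum>i<k. cmod (restrict_seq (A i) x j)) = (\<Sum>i\<in>{i}. cmod (restrict_seq (A i) x j))"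
          using admissible_disjoint[OF A] by (intro sum.mono_neutral_right) (auto simp: restrict_seq_def)
        then show ?thesis using i by (simp add: restrict_seq_def)
      next
        case False
        then have "(\<Sum>i<k. cmod (restrict_seq (A i) x j)) = 0"
          by (intro sum.neutral) (auto simp: restrict_seq_def)
        then show ?thesis by simp
      qed
    qed
    finally show ?thesis .
qed

text \<open>The l_1 norm dominates every stage of the recursion; from this come the finiteness of
  the suprema and the convergence of the stages. The induction bounds suprema by
  \<open>cSup_least\<close>, so it can precede \<open>ts_sums_bdd\<close>.\<close>

lemma tsirelson_step_le_l1:
  "\<forall>j\<ge>m. x j = 0 \<Longrightarrow> tsirelson_norm_step n x \<le> (\<Sum>j<m. cmod (x j))"
proof (induction n arbitrary: x)
  case 0
  have "cmod (x j) \<le> (\<Sum>j<m. cmod (x j))" for j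
  proof (cases "j < m")
    case True then show ?thesis by (intro member_le_sum) auto
  next
    case False then show ?thesis using 0 by (simp add: sum_nonneg)
  qed
  then show ?case by (simp add: cSUP_least)
next
  case (Suc n)
  have "s \<le> (\<Sum>j<m. cmod (x j))" if s_mem: "s \<in> ts_sums n x" for s
  proof -
    obtain k A where A: "admissible k A" and s: "s = (\<Sum>i<k. tsirelson_norm_step n (restrict_seq (A i) x))"
      using s_mem by blast
    have "s \<le> (\<Sum>i<k. \<Sum>j<m. cmod (restrict_seq (A i) x j))"
      unfolding s using Suc.prems by (intro sum_mono Suc.IH) (auto simp: restrict_seq_def)
    also have "\<dots> \<le> (\<Sum>j<m. cmod (x j))" by (rule admissible_l1[OF A])
    finally show ?thesis .
  qed
  then have "Sup (ts_sums n x) \<le> (\<Sum>j<m. cmod (x j))"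
    using ts_sums_nonempty by (intro cSup_least) auto
  moreover have "0 \<le> (\<Sum>j<m. cmod (x j))" by (simp add: sum_nonneg)
  ultimately show ?case using Suc.IH[OF Suc.prems]
    unfolding tsirelson_norm_step.simps by linarith
qed

lemma ts_range_bdd: assumes "x \<in> c00" shows "bdd_above (range (\<lambda>j. cmod (x j)))"
proof -
  obtain m where m: "\<forall>j\<ge>m. x j = 0" using assms c00_support by auto
  have "cmod (x j) \<le> (\<Sum>j<m. cmod (x j))" for j
  proof (cases "j < m")
    case True then show ?thesis by (intro member_le_sum) auto
  next
    case False then show ?thesis using m by (simp add: sum_nonneg)
  qed
  then show ?thesis by (intro bdd_aboveI[of _ "\<Sum>j<m. cmod (x j)"]) auto
qed

lemma ts_sums_bdd: assumes "x \<in> c00" shows "bdd_above (ts_sums n x)"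
proof -
  obtain m where m: "\<forall>j\<ge>m. x j = 0" using assms c00_support by auto
  have "s \<le> (\<Sum>j<m. cmod (x j))" if s_mem: "s \<in> ts_sums n x" for s
  proof -
    obtain k A where A: "admissible k A" and s: "s = (\<Sum>i<k. tsirelson_norm_step n (restrict_seq (A i) x))"
      using s_mem by blast
    have "s \<le> (\<Sum>i<k. \<Sum>j<m. cmod (restrict_seq (A i) x j))"
      unfolding s using m by (intro sum_mono tsirelson_step_le_l1) (auto simp: restrict_seq_def)
    also have "\<dots> \<le> (\<Sum>j<m. cmod (x j))" by (rule admissible_l1[OF A])
    finally show ?thesis .
  qed
  then show ?thesis by (intro bdd_aboveI[of _ "\<Sum>j<m. cmod (x j)"]) auto
qed

lemma tsirelson_step_mono:
  "y \<in> c00 \<Longrightarrow> (\<And>j. cmod (x j) \<le> cmod (y j)) \<Longrightarrow> tsirelson_norm_step n x \<le> tsirelson_norm_step n y"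
proof (induction n arbitrary: x y)
  case 0
  show ?case unfolding tsirelson_norm_step.simps
    by (rule cSUP_mono) (use 0 ts_range_bdd in auto)
next
  case (Suc n)
  have "Sup (ts_sums n x) \<le> Sup (ts_sums n y)"
  proof (rule cSup_least[OF ts_sums_nonempty])
    fix s assume "s \<in> ts_sums n x"
    then obtain k A where A: "admissible k A" and s: "s = (\<Sum>i<k. tsirelson_norm_step n (restrict_seq (A i) x))"
      by blast
    have "s \<le> (\<Sum>i<k. tsirelson_norm_step n (restrict_seq (A i) y))"
      unfolding s by (intro sum_mono Suc.IH c00_restrict Suc.prems) (auto simp: restrict_seq_def Suc.prems)
    also have "\<dots> \<le> Sup (ts_sums n y)"
      using A by (intro cSup_upper ts_sums_bdd Suc.prems) blast
    finally show "s \<le> Sup (ts_sums n y)" .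
  qed
  moreover have "tsirelson_norm_step n x \<le> tsirelson_norm_step n y" by (rule Suc.IH) (use Suc.prems in auto)
  ultimately show ?case unfolding tsirelson_norm_step.simps by linarith
qed

lemma tsirelson_step_add:
  "x \<in> c00 \<Longrightarrow> y \<in> c00 \<Longrightarrow>
    tsirelson_norm_step n (x + y) \<le> tsirelson_norm_step n x + tsirelson_norm_step n y"
proof (induction n arbitrary: x y)
  case 0
  have "cmod ((x + y) j) \<le> (SUP j. cmod (x j)) + (SUP j. cmod (y j))" for j
  proof -
    have "cmod (x j) \<le> (SUP j. cmod (x j))" "cmod (y j) \<le> (SUP j. cmod (y j))"
      using 0 ts_range_bdd by (auto intro: cSUP_upper)
    then show ?thesis using norm_triangle_ineq[of "x j" "y j"] by simp
  qed
  then show ?case unfolding tsirelson_norm_step.simps by (intro cSUP_least) auto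
next
  case (Suc n)
  have "Sup (ts_sums n (x + y)) \<le> Sup (ts_sums n x) + Sup (ts_sums n y)"
  proof (rule cSup_least[OF ts_sums_nonempty])
    fix s assume "s \<in> ts_sums n (x + y)"
    then obtain k A where A: "admissible k A"
      and s: "s = (\<Sum>i<k. tsirelson_norm_step n (restrict_seq (A i) (x + y)))"
      by blast
    have "s \<le> (\<Sum>i<k. tsirelson_norm_step n (restrict_seq (A i) x) + tsirelson_norm_step n (restrict_seq (A i) y))"
      unfolding s restrict_seq_add by (intro sum_mono Suc.IH c00_restrict Suc.prems)
    also have "\<dots> = (\<Sum>i<k. tsirelson_norm_step n (restrict_seq (A i) x)) + (\<Sum>i<k. tsirelson_norm_step n (restrict_seq (A i) y))"
      by (rule sum.distrib)
    also have "\<dots> \<le> Sup (ts_sums n x) + Sup (ts_sums n y)"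
      using A by (intro add_mono cSup_upper ts_sums_bdd Suc.prems) blast+
    finally show "s \<le> Sup (ts_sums n x) + Sup (ts_sums n y)" .
  qed
  moreover have "tsirelson_norm_step n (x + y) \<le> tsirelson_norm_step n x + tsirelson_norm_step n y"
    by (rule Suc.IH[OF Suc.prems])
  ultimately show ?case unfolding tsirelson_norm_step.simps by linarith
qed

lemma tsirelson_step_scale:
  "x \<in> c00 \<Longrightarrow> tsirelson_norm_step n (c *\<^sub>C x) \<le> cmod c * tsirelson_norm_step n x"
proof (induction n arbitrary: x)
  case 0
  have "cmod ((c *\<^sub>C x) j) \<le> cmod c * (SUP j. cmod (x j))" for j
    using ts_range_bdd[OF 0] by (auto simp: norm_mult intro!: mult_left_mono cSUP_upper)
  then show ?case unfolding tsirelson_norm_step.simps by (intro cSUP_least) auto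
next
  case (Suc n)
  have "Sup (ts_sums n (c *\<^sub>C x)) \<le> cmod c * Sup (ts_sums n x)"
  proof (rule cSup_least[OF ts_sums_nonempty])
    fix s assume "s \<in> ts_sums n (c *\<^sub>C x)"
    then obtain k A where A: "admissible k A"
      and s: "s = (\<Sum>i<k. tsirelson_norm_step n (restrict_seq (A i) (c *\<^sub>C x)))"
      by blast
    have "s \<le> (\<Sum>i<k. cmod c * tsirelson_norm_step n (restrict_seq (A i) x))"
      unfolding s restrict_seq_scale by (intro sum_mono Suc.IH c00_restrict Suc.prems)
    also have "\<dots> = cmod c * (\<Sum>i<k. tsirelson_norm_step n (restrict_seq (A i) x))"
      by (simp add: sum_distrib_left)
    also have "\<dots> \<le> cmod c * Sup (ts_sums n x)"
      using A by (intro mult_left_mono cSup_upper ts_sums_bdd Suc.prems) auto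
    finally show "s \<le> cmod c * Sup (ts_sums n x)" .
  qed
  moreover have "tsirelson_norm_step n (c *\<^sub>C x) \<le> cmod c * tsirelson_norm_step n x"
    by (rule Suc.IH[OF Suc.prems])
  moreover have "cmod c * tsirelson_norm_step n x \<le> cmod c * tsirelson_norm_step (Suc n) x"
    by (rule mult_left_mono) auto
  moreover have "cmod c * (1/2 * Sup (ts_sums n x)) \<le> cmod c * tsirelson_norm_step (Suc n) x"
    by (rule mult_left_mono) auto
  ultimately show ?case by (subst tsirelson_norm_step.simps) simp
qed

section \<open>The limit of the stages\<close>

lemma tsirelson_step_tendsto:
  assumes "x \<in> c00" shows "(\<lambda>n. tsirelson_norm_step n x) \<longlonglongrightarrow> tsirelson_norm x"
proof -
  obtain m where m: "\<forall>j\<ge>m. x j = 0" using assms c00_support by auto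
  have inc: "incseq (\<lambda>n. tsirelson_norm_step n x)" by (rule incseq_SucI) simp
  have "\<forall>n. tsirelson_norm_step n x \<le> (\<Sum>j<m. cmod (x j))"
    using tsirelson_step_le_l1[OF m] by blast
  then obtain l where "(\<lambda>n. tsirelson_norm_step n x) \<longlonglongrightarrow> l"
    using incseq_convergent[OF inc] by blast
  then show ?thesis unfolding tsirelson_norm_def by (simp add: limI)
qed

lemma tsirelson_step_le: "x \<in> c00 \<Longrightarrow> tsirelson_norm_step n x \<le> tsirelson_norm x"
  by (rule incseq_le[OF _ tsirelson_step_tendsto]) (auto intro: incseq_SucI)

lemma tsirelson_norm_coord: assumes "x \<in> c00" shows "cmod (x j) \<le> tsirelson_norm x"
proof -
  have "cmod (x j) \<le> tsirelson_norm_step 0 x"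
    unfolding tsirelson_norm_step.simps by (rule cSUP_upper[OF _ ts_range_bdd[OF assms]]) simp
  then show ?thesis using tsirelson_step_le[OF assms, of 0] by linarith
qed

lemma tsirelson_norm_nonneg: "x \<in> c00 \<Longrightarrow> 0 \<le> tsirelson_norm x"
  using tsirelson_norm_coord norm_ge_zero order_trans by blast

lemma tsirelson_norm_le_l1:
  assumes "\<forall>j\<ge>m. x j = 0" shows "tsirelson_norm x \<le> (\<Sum>j<m. cmod (x j))"
  using tsirelson_step_le_l1[OF assms]
  by (intro LIMSEQ_le_const2[OF tsirelson_step_tendsto[OF c00I[OF assms]]]) blast

lemma tsirelson_norm_0 [simp]: "tsirelson_norm 0 = 0"
  using tsirelson_norm_le_l1[of 0 0] tsirelson_norm_nonneg[of 0] by simp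

text \<open>This contains 1-unconditionality: the norm depends on moduli only and does not increase
  under restriction. Phases can therefore be changed freely below.\<close>

lemma tsirelson_norm_mono:
  assumes "y \<in> c00" "\<And>j. cmod (x j) \<le> cmod (y j)"
  shows "tsirelson_norm x \<le> tsirelson_norm y"
  by (rule LIMSEQ_le[OF tsirelson_step_tendsto tsirelson_step_tendsto])
     (use assms in \<open>auto intro: c00_dominated tsirelson_step_mono\<close>)

lemma tsirelson_norm_add:
  assumes "x \<in> c00" "y \<in> c00"
  shows "tsirelson_norm (x + y) \<le> tsirelson_norm x + tsirelson_norm y"
  by (rule LIMSEQ_le[OF tsirelson_step_tendsto tendsto_add[OF tsirelson_step_tendsto tsirelson_step_tendsto]])
     (use assms in \<open>auto intro: c00_add tsirelson_step_add simp del: plus_fun_apply\<close>)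

lemma tsirelson_norm_scale:
  assumes "x \<in> c00"
  shows "tsirelson_norm (c *\<^sub>C x) \<le> cmod c * tsirelson_norm x"
  by (rule LIMSEQ_le[OF tsirelson_step_tendsto tendsto_mult_left[OF tsirelson_step_tendsto]])
     (use assms in \<open>auto intro: c00_scale tsirelson_step_scale\<close>)

lemma tsirelson_norm_sum:
  "(\<And>k. k \<in> A \<Longrightarrow> f k \<in> c00) \<Longrightarrow> tsirelson_norm (\<Sum>k\<in>A. f k) \<le> (\<Sum>k\<in>A. tsirelson_norm (f k))"
proof (induction A rule: infinite_finite_induct)
  case (insert a A)
  have "tsirelson_norm (f a + (\<Sum>k\<in>A. f k)) \<le> tsirelson_norm (f a) + tsirelson_norm (\<Sum>k\<in>A. f k)"
    using insert by (intro tsirelson_norm_add c00_sum) auto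
  moreover have "tsirelson_norm (\<Sum>k\<in>A. f k) \<le> (\<Sum>k\<in>A. tsirelson_norm (f k))"
    using insert by blast
  ultimately show ?case unfolding sum.insert[OF insert(1,2)] by linarith
qed auto

text \<open>The lower l_1 estimate for admissible families, the feature of Tsirelson's norm on which
  the block formula rests. The constant 2 is the reciprocal of the 1/2 in the recursion: stage
  \<open>n\<close> on the pieces is bounded by twice stage \<open>Suc n\<close> on
  \<open>x\<close>.\<close>

lemma tsirelson_norm_admissible:
  assumes x: "x \<in> c00" and A: "admissible k A"
  shows "(\<Sum>i<k. tsirelson_norm (restrict_seq (A i) x)) \<le> 2 * tsirelson_norm x"
proof (rule LIMSEQ_le_const2)
  show "(\<lambda>n. \<Sum>i<k. tsirelson_norm_step n (restrict_seq (A i) x))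
        \<longlonglongrightarrow> (\<Sum>i<k. tsirelson_norm (restrict_seq (A i) x))"
    by (intro tendsto_sum tsirelson_step_tendsto c00_restrict x)
  have "(\<Sum>i<k. tsirelson_norm_step n (restrict_seq (A i) x)) \<le> 2 * tsirelson_norm x" for n
  proof -
    have "(\<Sum>i<k. tsirelson_norm_step n (restrict_seq (A i) x)) \<le> Sup (ts_sums n x)"
      using A by (intro cSup_upper ts_sums_bdd x) blast
    also have "\<dots> \<le> 2 * tsirelson_norm_step (Suc n) x" by simp
    also have "\<dots> \<le> 2 * tsirelson_norm x" using tsirelson_step_le[OF x, of "Suc n"] by linarith
    finally show ?thesis .
  qed
  then show "\<exists>N. \<forall>n\<ge>N. (\<Sum>i<k. tsirelson_norm_step n (restrict_seq (A i) x)) \<le> 2 * tsirelson_norm x"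
    by blast
qed


section \<open>Elements of Tsirelson's space through their truncations\<close>

lemma tsirelson_partial_tendsto:
  assumes "x \<in> carr tsirelson"
  shows "(\<lambda>n. tsirelson_norm (restrict_seq {..<n} x)) \<longlonglongrightarrow> nrm tsirelson x"
proof -
  let ?P = "\<lambda>n. restrict_seq {..<n} x"
  have c: "?P n \<in> c00" for n by (rule restrict_lessThan_c00)
  have "Cauchy (\<lambda>n. tsirelson_norm (?P n))"
  proof (rule metric_CauchyI)
    fix e :: real assume "0 < e"
    then obtain M where M: "\<And>m n. m \<ge> M \<Longrightarrow> n \<ge> M \<Longrightarrow> tsirelson_norm (?P m - ?P n) < e"
      using assms unfolding tsirelson_def basis_completion_def cauchy_in_def by (simp del: minus_apply) metis
    have "\<bar>tsirelson_norm (?P m) - tsirelson_norm (?P n)\<bar> < e" if "m \<ge> M" "n \<ge> M" for m n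
    proof -
      have d: "tsirelson_norm (?P i) \<le> tsirelson_norm (?P i - ?P j) + tsirelson_norm (?P j)" for i j
      proof -
        have "?P i - ?P j \<in> c00" using c00_add[OF c c00_scale[OF c, of "-1"]] by (simp add: scaleC_minus1)
        from tsirelson_norm_add[OF this c, of j] show ?thesis by (simp only: diff_add_cancel)
      qed
      show ?thesis using d[of m n] d[of n m] M[OF that] M[OF that(2,1)] by linarith
    qed
    then show "\<exists>M. \<forall>m\<ge>M. \<forall>n\<ge>M. dist (tsirelson_norm (?P m)) (tsirelson_norm (?P n)) < e"
      unfolding dist_real_def by blast
  qed
  then show ?thesis
    unfolding tsirelson_def basis_completion_def
    by (simp add: convergent_LIMSEQ_iff[symmetric] Cauchy_convergent)
qed

lemma tsirelson_partial_le:
  assumes "x \<in> carr tsirelson"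
  shows "tsirelson_norm (restrict_seq {..<n} x) \<le> nrm tsirelson x"
proof (rule incseq_le[OF _ tsirelson_partial_tendsto[OF assms]])
  show "incseq (\<lambda>n. tsirelson_norm (restrict_seq {..<n} x))"
    by (intro incseq_SucI tsirelson_norm_mono restrict_lessThan_c00) (auto simp: restrict_seq_def)
qed

lemma c00_tsirelson:
  assumes "x \<in> c00"
  shows "x \<in> carr tsirelson" "nrm tsirelson x = tsirelson_norm x"
proof -
  obtain m where m: "\<forall>j\<ge>m. x j = 0" using assms c00_support by auto
  have P: "restrict_seq {..<n} x = x" if "n \<ge> m" for n
    by (rule restrict_seq_id) (use that m in auto)
  show mem: "x \<in> carr tsirelson"
    unfolding tsirelson_def basis_completion_def cauchy_in_def
    by (auto intro!: exI[of _ m] simp: P simp del: minus_apply)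
  have "(\<lambda>n. tsirelson_norm (restrict_seq {..<n} x)) \<longlonglongrightarrow> tsirelson_norm x"
    by (rule tendsto_eventually) (auto simp: eventually_sequentially P intro!: exI[of _ m])
  then show "nrm tsirelson x = tsirelson_norm x"
    using tsirelson_partial_tendsto[OF mem] LIMSEQ_unique by blast
qed

text \<open>Late truncations of the tail past \<open>n\<close> are differences
  \<open>?P m - ?P n\<close> of partial sums of \<open>x\<close>, so both claims reduce to the
  Cauchy condition that defines membership.\<close>

lemma tsirelson_tail:
  assumes x: "x \<in> carr tsirelson"
  shows "restrict_seq {n..} x \<in> carr tsirelson"
    and "(\<lambda>n. nrm tsirelson (restrict_seq {n..} x)) \<longlonglongrightarrow> 0"
proof -
  let ?P = "\<lambda>n. restrict_seq {..<n} x" and ?Q = "\<lambda>n. restrict_seq {n..} x"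
  have PQ: "restrict_seq {..<m} (?Q n) = ?P m - ?P n" if "n \<le> m" for m n
    using that by (auto simp: fun_eq_iff restrict_seq_def)
  have M: "\<exists>M. \<forall>m\<ge>M. \<forall>n\<ge>M. tsirelson_norm (?P m - ?P n) < e" if "0 < e" for e
    using x that unfolding tsirelson_def basis_completion_def cauchy_in_def by (simp del: minus_apply)
  show Q: "?Q n \<in> carr tsirelson" for n
  proof -
    have "\<exists>M. \<forall>m\<ge>M. \<forall>l\<ge>M. tsirelson_norm (restrict_seq {..<m} (?Q n) - restrict_seq {..<l} (?Q n)) < e"
      if e: "0 < e" for e
    proof -
      obtain M where M: "\<forall>m\<ge>M. \<forall>n\<ge>M. tsirelson_norm (?P m - ?P n) < e" using M[OF e] by blast
      have "restrict_seq {..<m} (?Q n) - restrict_seq {..<l} (?Q n) = ?P m - ?P l"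
        if "m \<ge> max M n" "l \<ge> max M n" for m l
        using that by (simp add: PQ del: minus_apply)
      then show ?thesis using M by (intro exI[of _ "max M n"]) simp
    qed
    then show ?thesis unfolding tsirelson_def basis_completion_def cauchy_in_def by (simp del: minus_apply)
  qed
  show "(\<lambda>n. nrm tsirelson (?Q n)) \<longlonglongrightarrow> 0"
  proof (rule LIMSEQ_I)
    fix e :: real assume e: "0 < e"
    then obtain M where M: "\<And>m n. m \<ge> M \<Longrightarrow> n \<ge> M \<Longrightarrow> tsirelson_norm (?P m - ?P n) < e/2"
      using M[of "e/2"] by auto
    have "norm (nrm tsirelson (?Q n) - 0) < e" if "n \<ge> M" for n
    proof -
      have "nrm tsirelson (?Q n) \<le> e/2"
      proof (rule LIMSEQ_le_const2[OF tsirelson_partial_tendsto[OF Q]])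
        show "\<exists>N. \<forall>m\<ge>N. tsirelson_norm (restrict_seq {..<m} (?Q n)) \<le> e/2"
          using M that by (intro exI[of _ n]) (auto simp: PQ intro!: less_imp_le simp del: minus_apply)
      qed
      moreover have "0 \<le> nrm tsirelson (?Q n)"
        using tsirelson_partial_le[OF Q, of 0 n] tsirelson_norm_nonneg restrict_lessThan_c00 order_trans by blast
      ultimately show ?thesis using e by simp
    qed
    then show "\<exists>N. \<forall>n\<ge>N. norm (nrm tsirelson (?Q n) - 0) < e" by blast
  qed
qed

section \<open>Functionals on Tsirelson's space and the dual norm\<close>

lemma linear_on_space_sum:
  assumes lin: "linear_on_space V f" and V: "csubspace V" and b: "\<And>k. k \<in> A \<Longrightarrow> b k \<in> V"
  shows "f (\<Sum>k\<in>A. c k *\<^sub>C b k) = (\<Sum>k\<in>A. c k *\<^sub>C f (b k))"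
proof -
  have z: "f 0 = 0"
  proof -
    have "f (0 *\<^sub>C 0) = 0 *\<^sub>C f 0"
      using lin complex_vec.subspace_0[OF V] unfolding linear_on_space_def by blast
    then show ?thesis by simp
  qed
  show ?thesis using b
  proof (induction A rule: infinite_finite_induct)
    case (insert a A)
    have "f (c a *\<^sub>C b a + (\<Sum>k\<in>A. c k *\<^sub>C b k)) = f (c a *\<^sub>C b a) + f (\<Sum>k\<in>A. c k *\<^sub>C b k)"
      using lin V insert.prems unfolding linear_on_space_def
      by (metis (no_types, lifting) complex_vec.subspace_scale complex_vec.subspace_sum insertCI)
    also have "f (c a *\<^sub>C b a) = c a *\<^sub>C f (b a)"
      using lin insert.prems unfolding linear_on_space_def by blast
    finally show ?case using insert by simp
  qed (use z in auto)
qed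

lemma linear_on_space_subset: "linear_on_space V f \<Longrightarrow> W \<subseteq> V \<Longrightarrow> linear_on_space W f"
  unfolding linear_on_space_def by blast

lemma tsirelson_functional_eval:
  assumes "is_functional tsirelson \<phi>" "\<forall>j\<ge>m. x j = 0"
  shows "\<phi> x = (\<Sum>j<m. x j * \<phi> (unit_seq j))"
proof -
  have "linear_on_space c00 \<phi>"
    using assms(1) c00_tsirelson(1) unfolding is_functional_def
    by (blast intro: linear_on_space_subset)
  then have *: "\<phi> (\<Sum>j<m. x j *\<^sub>C unit_seq j) = (\<Sum>j<m. x j *\<^sub>C \<phi> (unit_seq j))"
    by (intro linear_on_space_sum[OF _ c00_csubspace]) auto
  have "\<phi> x = \<phi> (\<Sum>j<m. x j *\<^sub>C unit_seq j)"
    by (rule arg_cong[OF unit_seq_expansion[OF assms(2)]])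
  then show ?thesis unfolding * by (simp add: scaleC_complex_def)
qed

text \<open>Truncations converge in norm, so a bounded functional is determined by its values on
  unit vectors. This makes the \<open>THE\<close> in \<open>dual_seq\<close> well defined.\<close>

lemma tsirelson_functional_unique:
  assumes \<phi>: "is_functional tsirelson \<phi>" and \<psi>: "is_functional tsirelson \<psi>"
    and eq: "\<And>j. \<phi> (unit_seq j) = \<psi> (unit_seq j)" and x: "x \<in> carr tsirelson"
  shows "\<phi> x = \<psi> x"
proof -
  have lim: "(\<lambda>n. \<Sum>j<n. x j * \<phi> (unit_seq j)) \<longlonglongrightarrow> \<phi> x" if \<phi>: "is_functional tsirelson \<phi>" for \<phi>
  proof -
    obtain K where K: "\<And>y. y \<in> carr tsirelson \<Longrightarrow> cmod (\<phi> y) \<le> K * nrm tsirelson y"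
      using \<phi> unfolding is_functional_def by blast
    have eq: "\<phi> x - (\<Sum>j<n. x j * \<phi> (unit_seq j)) = \<phi> (restrict_seq {n..} x)" for n
    proof -
      have "\<phi> (restrict_seq {..<n} x + restrict_seq {n..} x)
            = \<phi> (restrict_seq {..<n} x) + \<phi> (restrict_seq {n..} x)"
        using \<phi> tsirelson_tail(1)[OF x] c00_tsirelson(1)[OF restrict_lessThan_c00]
        unfolding is_functional_def linear_on_space_def by blast
      moreover have "\<phi> (restrict_seq {..<n} x) = (\<Sum>j<n. x j * \<phi> (unit_seq j))"
        by (subst tsirelson_functional_eval[OF \<phi>, of n]) (auto simp: restrict_seq_def)
      ultimately show ?thesis by (simp add: restrict_seq_split)
    qed
    have "(\<lambda>n. K * nrm tsirelson (restrict_seq {n..} x)) \<longlonglongrightarrow> 0"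
      using tendsto_mult_right_zero[OF tsirelson_tail(2)[OF x]] by simp
    then have "(\<lambda>n. \<phi> (restrict_seq {n..} x)) \<longlonglongrightarrow> 0"
      by (rule Lim_null_comparison[rotated]) (use K tsirelson_tail(1)[OF x] in auto)
    then have "(\<lambda>n. \<phi> x - (\<phi> x - (\<Sum>j<n. x j * \<phi> (unit_seq j)))) \<longlonglongrightarrow> \<phi> x - 0"
      unfolding eq by (intro tendsto_intros)
    then show ?thesis by simp
  qed
  from lim[OF \<phi>] lim[OF \<psi>] show ?thesis unfolding eq using LIMSEQ_unique by blast
qed

text \<open>The moduli may stand inside the sum because the norm ignores phases. This is the form in
  which the dual norm enters the interpolation estimates.\<close>

lemma dual_tsirelson_pairing:
  assumes f: "f \<in> carr (dual_seq tsirelson)"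
  shows "(\<Sum>j<m. cmod (f j) * cmod (x j)) \<le> nrm (dual_seq tsirelson) f * tsirelson_norm (restrict_seq {..<m} x)"
proof -
  obtain \<phi> where \<phi>: "is_functional tsirelson \<phi>" and f\<phi>: "\<And>j. f j = \<phi> (unit_seq j)"
    using f unfolding dual_seq_def by auto
  have "nrm (dual_seq tsirelson) f = (THE r. \<exists>\<phi>. is_functional tsirelson \<phi> \<and>
      (\<forall>j. f j = \<phi> (unit_seq j)) \<and> r = functional_norm tsirelson \<phi>)"
    by (simp add: dual_seq_def)
  also have "\<dots> = functional_norm tsirelson \<phi>"
  proof (rule the_equality)
    fix r assume "\<exists>\<phi>. is_functional tsirelson \<phi> \<and> (\<forall>j. f j = \<phi> (unit_seq j)) \<and> r = functional_norm tsirelson \<phi>"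
    then obtain \<psi> where \<psi>: "is_functional tsirelson \<psi>" "\<forall>j. f j = \<psi> (unit_seq j)"
      "r = functional_norm tsirelson \<psi>" by blast
    have eq: "\<psi> x = \<phi> x" if "x \<in> carr tsirelson" for x
      by (rule tsirelson_functional_unique[OF \<psi>(1) \<phi> _ that]) (use \<psi>(2) f\<phi> in metis)
    have "{cmod (\<psi> x) | x. x \<in> carr tsirelson \<and> nrm tsirelson x \<le> 1} =
          {cmod (\<phi> x) | x. x \<in> carr tsirelson \<and> nrm tsirelson x \<le> 1}"
      using eq by (auto; metis)
    then show "r = functional_norm tsirelson \<phi>"
      unfolding \<psi>(3) functional_norm_def by simp
  qed (use \<phi> f\<phi> in blast)
  finally have nf: "nrm (dual_seq tsirelson) f = functional_norm tsirelson \<phi>" .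
  obtain K where K: "\<And>y. y \<in> carr tsirelson \<Longrightarrow> cmod (\<phi> y) \<le> K * nrm tsirelson y"
    using \<phi> unfolding is_functional_def by blast
  have bdd: "bdd_above {cmod (\<phi> x) | x. x \<in> carr tsirelson \<and> nrm tsirelson x \<le> 1}"
  proof (rule bdd_aboveI[of _ "\<bar>K\<bar>"])
    fix r assume "r \<in> {cmod (\<phi> x) | x. x \<in> carr tsirelson \<and> nrm tsirelson x \<le> 1}"
    then obtain x where x: "r = cmod (\<phi> x)" "x \<in> carr tsirelson" "nrm tsirelson x \<le> 1" by blast
    have "0 \<le> nrm tsirelson x"
      using tsirelson_partial_le[OF x(2), of 0] tsirelson_norm_nonneg restrict_lessThan_c00 order_trans by blast
    then have "K * nrm tsirelson x \<le> \<bar>K\<bar> * 1" using x(3) by (intro mult_mono) auto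
    then show "r \<le> \<bar>K\<bar>" using K[OF x(2)] x(1) by simp
  qed
  \<comment> \<open>The phase of \<open>f j\<close> is cancelled and the modulus of
    \<open>x j\<close> kept, so that \<open>y j * f j\<close> becomes \<open>|f j| |x j|\<close>;
    where \<open>f j = 0\<close> there is no phase and the entry is set to 0.\<close>
  define y where "y j = (if j < m \<and> f j \<noteq> 0 then cnj (f j) / of_real (cmod (f j)) * of_real (cmod (x j)) else 0)" for j
  have ysupp: "\<forall>j\<ge>m. y j = 0" by (simp add: y_def)
  have yc: "y \<in> c00" by (rule c00I[OF ysupp])
  have "\<phi> y = (\<Sum>j<m. y j * f j)" by (simp add: tsirelson_functional_eval[OF \<phi> ysupp] f\<phi>)
  also have "\<dots> = of_real (\<Sum>j<m. cmod (f j) * cmod (x j))"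
    unfolding of_real_sum
  proof (rule sum.cong)
    fix j assume "j \<in> {..<m}"
    show "y j * f j = of_real (cmod (f j) * cmod (x j))"
    proof (cases "f j = 0")
      case False
      then have "cnj (f j) * f j = of_real (cmod (f j)) * of_real (cmod (f j))"
        using complex_norm_square[of "f j"] by (simp add: power2_eq_square mult.commute)
      then show ?thesis using False \<open>j \<in> {..<m}\<close> by (simp add: y_def field_simps)
    qed simp
  qed simp
  finally have \<phi>y: "cmod (\<phi> y) = (\<Sum>j<m. cmod (f j) * cmod (x j))"
    by (simp only: norm_of_real) (simp add: sum_nonneg)
  have le: "tsirelson_norm y \<le> tsirelson_norm (restrict_seq {..<m} x)"
    by (rule tsirelson_norm_mono[OF restrict_lessThan_c00]) (auto simp: y_def restrict_seq_def norm_mult norm_divide)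
  have "cmod (\<phi> y) \<le> functional_norm tsirelson \<phi> * tsirelson_norm y"
  proof (cases "tsirelson_norm y = 0")
    case True
    then show ?thesis using K[of y] c00_tsirelson[OF yc] by simp
  next
    case False
    then have pos: "0 < tsirelson_norm y" using tsirelson_norm_nonneg[OF yc] by simp
    let ?c = "complex_of_real (1 / tsirelson_norm y)"
    have "?c *\<^sub>C y \<in> c00" by (rule c00_scale[OF yc])
    moreover have "tsirelson_norm (?c *\<^sub>C y) \<le> 1"
      using tsirelson_norm_scale[OF yc, of ?c] pos by (simp add: norm_divide)
    ultimately have "cmod (\<phi> (?c *\<^sub>C y)) \<le> functional_norm tsirelson \<phi>"
      unfolding functional_norm_def using c00_tsirelson by (intro cSup_upper[OF _ bdd]) auto
    moreover have "\<phi> (?c *\<^sub>C y) = ?c * \<phi> y"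
      using \<phi> c00_tsirelson(1)[OF yc] unfolding is_functional_def linear_on_space_def
      by (auto simp: scaleC_complex_def)
    ultimately have "cmod (\<phi> y) / tsirelson_norm y \<le> functional_norm tsirelson \<phi>"
      using pos by (simp add: norm_mult norm_divide)
    then show ?thesis using pos by (simp add: pos_divide_le_eq)
  qed
  moreover have "0 \<le> functional_norm tsirelson \<phi>"
  proof -
    have "cmod (\<phi> 0) \<le> functional_norm tsirelson \<phi>"
      unfolding functional_norm_def using c00_tsirelson[OF c00_0] by (intro cSup_upper[OF _ bdd]) auto
    then show ?thesis using norm_ge_zero order_trans by blast
  qed
  ultimately show ?thesis unfolding \<phi>y nf using le by (meson mult_left_mono order_trans)
qed


section \<open>Interpolation at the centre of the strip\<close>

text \<open>Only the norm bounds on the two boundary lines are recorded, the one in the dual through the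
  pairing with truncations; continuity of the boundary values in norm plays no role.\<close>

definition interp_bounded :: "real \<Rightarrow> (complex \<Rightarrow> cseq) \<Rightarrow> bool" where
  "interp_bounded M F \<longleftrightarrow> (\<forall>j. strip_fun (\<lambda>z. F z j)) \<and>
     (\<forall>t m. tsirelson_norm (restrict_seq {..<m} (F (\<i> * of_real t))) \<le> M) \<and>
     (\<forall>t m x. (\<Sum>j<m. cmod (F (1 + \<i> * of_real t) j) * cmod (x j)) \<le> M * tsirelson_norm (restrict_seq {..<m} x))"

definition half_deriv :: "(complex \<Rightarrow> cseq) \<Rightarrow> cseq" where
  "half_deriv F = (\<lambda>j. deriv (\<lambda>z. F z j) (1/2))"

lemma interp_boundedD:
  assumes "interp_bounded M F"
  shows "strip_fun (\<lambda>z. F z j)"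
    and "tsirelson_norm (restrict_seq {..<m} (F (\<i> * of_real t))) \<le> M"
    and "(\<Sum>j<m. cmod (F (1 + \<i> * of_real t) j) * cmod (x j)) \<le> M * tsirelson_norm (restrict_seq {..<m} x)"
  using assms unfolding interp_bounded_def by blast+

lemma interp_bounded_nonneg: "interp_bounded M F \<Longrightarrow> 0 \<le> M"
  using interp_boundedD(2)[of M F 0 0] tsirelson_norm_nonneg[OF restrict_lessThan_c00] order_trans by blast

lemma interp_bounded_half: assumes F: "interp_bounded M F" shows "ell2_le M (F (1/2))"
  unfolding ell2_le_iff
proof
  fix m
  note D = interp_boundedD[OF F]
  have M: "0 \<le> M" using F by (rule interp_bounded_nonneg)
  \<comment> \<open>The reflection \<open>z \<mapsto> 1 - cnj z\<close> exchanges the two lines and keeps the height, so the boundary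
    values of \<open>h\<close> pair the space with its dual, while \<open>h (1/2)\<close> is the squared \<open>l_2\<close> norm.\<close>
  define h where "h z = (\<Sum>j<m. F z j * cnj (F (1 - cnj z) j))" for z
  have s: "strip_fun h"
    unfolding h_def by (intro strip_fun_sum strip_fun_mult strip_fun_reflect D)
  have pair: "(\<Sum>j<m. cmod (F (1 + \<i> * of_real t) j) * cmod (F (\<i> * of_real t) j)) \<le> M\<^sup>2" for t
  proof -
    have "(\<Sum>j<m. cmod (F (1 + \<i> * of_real t) j) * cmod (F (\<i> * of_real t) j))
        \<le> M * tsirelson_norm (restrict_seq {..<m} (F (\<i> * of_real t)))" by (rule D)
    also have "\<dots> \<le> M * M" by (intro mult_left_mono D M)
    finally show ?thesis by (simp add: power2_eq_square)
  qed
  have "cmod (h (1/2)) \<le> M\<^sup>2"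
  proof (rule strip_fun_half_bound[OF s])
    fix t
    have "cmod (h (\<i> * of_real t)) \<le> (\<Sum>j<m. cmod (F (1 + \<i> * of_real t) j) * cmod (F (\<i> * of_real t) j))"
      unfolding h_def by (intro order_trans[OF norm_sum] sum_mono) (simp add: norm_mult mult.commute)
    then show "cmod (h (\<i> * of_real t)) \<le> M\<^sup>2" using pair order_trans by blast
    have "cmod (h (1 + \<i> * of_real t)) \<le> (\<Sum>j<m. cmod (F (1 + \<i> * of_real t) j) * cmod (F (\<i> * of_real t) j))"
      unfolding h_def by (intro order_trans[OF norm_sum] sum_mono) (simp add: norm_mult)
    then show "cmod (h (1 + \<i> * of_real t)) \<le> M\<^sup>2" using pair order_trans by blast
  qed
  moreover have "h (1/2) = of_real (\<Sum>j<m. (cmod (F (1/2) j))\<^sup>2)"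
  proof -
    have "1 - cnj (1/2) = (1/2 :: complex)" by simp
    then show ?thesis unfolding h_def of_real_sum by (simp only: complex_norm_square)
  qed
  ultimately have "(\<Sum>j<m. (cmod (F (1/2) j))\<^sup>2) \<le> M\<^sup>2"
  by (simp only: norm_of_real)
  then show "L2_set (\<lambda>j. cmod (F (1/2) j)) {..<m} \<le> M"
    unfolding L2_set_def by (intro real_le_lsqrt M) (auto intro: sum_nonneg)
qed

lemma interp_bounded_quotient:
  assumes G: "interp_bounded M G" and z: "G (1/2) = 0"
  shows "ell2_le (2 * M) (half_deriv G)"
proof -
  \<comment> \<open>On both lines \<open>|z - 1/2| \<ge> 1/2\<close>, so the division costs a factor 2.\<close>
  define H where "H z = (if z = 1/2 then half_deriv G else (1 / (z - 1/2)) *\<^sub>C G z)" for z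
  have Hz: "(\<lambda>z. H z j) = (\<lambda>z. if z = 1/2 then deriv (\<lambda>z. G z j) (1/2) else G z j / (z - 1/2))" for j
    by (auto simp: H_def half_deriv_def fun_eq_iff)
  note D = interp_boundedD[OF G]
  have M: "0 \<le> M" using G by (rule interp_bounded_nonneg)
  have c: "cmod (1 / (z - 1/2)) \<le> 2" "z \<noteq> 1/2" if "Re z = 0 \<or> Re z = 1" for z
  proof -
    have "1/2 \<le> \<bar>Re (z - 1/2)\<bar>" using that by auto
    then have *: "1/2 \<le> cmod (z - 1/2)" using abs_Re_le_cmod order_trans by blast
    then have "1 / cmod (z - 1/2) \<le> 1 / (1/2)" by (intro frac_le) auto
    then show "cmod (1 / (z - 1/2)) \<le> 2" by (simp add: norm_divide)
    have "Re z \<noteq> Re (1/2)" using that by auto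
    then show "z \<noteq> 1/2" by metis
  qed
  have le: "cmod (H z j) \<le> 2 * cmod (G z j)" if "Re z = 0 \<or> Re z = 1" for z j
  proof -
    have "H z j = 1 / (z - 1/2) * G z j" using c(2)[OF that] by (simp add: H_def)
    then have "cmod (H z j) = cmod (1 / (z - 1/2)) * cmod (G z j)" by (simp only: norm_mult)
    then show ?thesis using mult_right_mono[OF c(1)[OF that], of "cmod (G z j)"] by (simp only: norm_ge_zero)
  qed
  have "interp_bounded (2 * M) H"
    unfolding interp_bounded_def
  proof (intro conjI allI)
    fix j show "strip_fun (\<lambda>z. H z j)"
      unfolding Hz by (rule strip_fun_quotient) (use D z in auto)
  next
    fix t m
    let ?z = "\<i> * complex_of_real t"
    have "tsirelson_norm (restrict_seq {..<m} (H ?z)) \<le> tsirelson_norm (2 *\<^sub>C restrict_seq {..<m} (G ?z))"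
      by (rule tsirelson_norm_mono[OF c00_scale[OF restrict_lessThan_c00]])
         (use le[of ?z] in \<open>auto simp: restrict_seq_def norm_mult\<close>)
    also have "\<dots> \<le> 2 * tsirelson_norm (restrict_seq {..<m} (G ?z))"
      using tsirelson_norm_scale[OF restrict_lessThan_c00, of 2] by simp
    also have "\<dots> \<le> 2 * M" using D(2) by simp
    finally show "tsirelson_norm (restrict_seq {..<m} (H ?z)) \<le> 2 * M" .
  next
    fix t m x
    let ?z = "1 + \<i> * complex_of_real t"
    have "(\<Sum>j<m. cmod (H ?z j) * cmod (x j)) \<le> (\<Sum>j<m. 2 * (cmod (G ?z j) * cmod (x j)))"
    proof (rule sum_mono)
      fix j show "cmod (H ?z j) * cmod (x j) \<le> 2 * (cmod (G ?z j) * cmod (x j))"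
        using mult_right_mono[OF le[of ?z j], of "cmod (x j)"] by (simp add: mult.assoc)
    qed
    also have "\<dots> = 2 * (\<Sum>j<m. cmod (G ?z j) * cmod (x j))" by (simp add: sum_distrib_left)
    also have "\<dots> \<le> 2 * (M * tsirelson_norm (restrict_seq {..<m} x))" using D(3) by simp
    finally show "(\<Sum>j<m. cmod (H ?z j) * cmod (x j)) \<le> 2 * M * tsirelson_norm (restrict_seq {..<m} x)"
      by simp
  qed
  then have "ell2_le (2 * M) (H (1/2))" by (rule interp_bounded_half)
  then show ?thesis by (simp add: H_def)
qed

section \<open>Operations on bounded functions, and the two basic examples\<close>

lemma interp_bounded_add:
  assumes F: "interp_bounded M F" and G: "interp_bounded M' G"
  shows "interp_bounded (M + M') (\<lambda>z. F z + G z)"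
  unfolding interp_bounded_def
proof (intro conjI allI)
  fix j show "strip_fun (\<lambda>z. (F z + G z) j)"
    using F G by (auto intro: strip_fun_add interp_boundedD)
next
  fix t m
  show "tsirelson_norm (restrict_seq {..<m} (F (\<i> * of_real t) + G (\<i> * of_real t))) \<le> M + M'"
    unfolding restrict_seq_add
    by (intro order_trans[OF tsirelson_norm_add[OF restrict_lessThan_c00 restrict_lessThan_c00]]
        add_mono interp_boundedD[OF F] interp_boundedD[OF G])
next
  fix t m x
  let ?z = "1 + \<i> * complex_of_real t"
  have "(\<Sum>j<m. cmod ((F ?z + G ?z) j) * cmod (x j))
      \<le> (\<Sum>j<m. cmod (F ?z j) * cmod (x j) + cmod (G ?z j) * cmod (x j))"
  proof (rule sum_mono)
    fix j show "cmod ((F ?z + G ?z) j) * cmod (x j) \<le> cmod (F ?z j) * cmod (x j) + cmod (G ?z j) * cmod (x j)"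
      using mult_right_mono[OF norm_triangle_ineq[of "F ?z j" "G ?z j"], of "cmod (x j)"]
      by (simp add: distrib_right)
  qed
  also have "\<dots> \<le> M * tsirelson_norm (restrict_seq {..<m} x) + M' * tsirelson_norm (restrict_seq {..<m} x)"
    unfolding sum.distrib by (intro add_mono interp_boundedD[OF F] interp_boundedD[OF G])
  finally show "(\<Sum>j<m. cmod ((F ?z + G ?z) j) * cmod (x j)) \<le> (M + M') * tsirelson_norm (restrict_seq {..<m} x)"
    by (simp add: distrib_right)
qed

lemma interp_bounded_minus:
  assumes F: "interp_bounded M F" shows "interp_bounded M (\<lambda>z. - F z)"
  unfolding interp_bounded_def
proof (intro conjI allI)
  fix j show "strip_fun (\<lambda>z. (- F z) j)"
    using strip_fun_mult[OF strip_fun_const[of "-1"] interp_boundedD(1)[OF F]] by (simp add: fun_Compl_def)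
next
  fix t m
  have "tsirelson_norm (restrict_seq {..<m} (- F (\<i> * of_real t))) \<le> tsirelson_norm (restrict_seq {..<m} (F (\<i> * of_real t)))"
    by (rule tsirelson_norm_mono[OF restrict_lessThan_c00]) (simp add: restrict_seq_def)
  then show "tsirelson_norm (restrict_seq {..<m} (- F (\<i> * of_real t))) \<le> M"
    using interp_boundedD(2)[OF F] order_trans by blast
next
  fix t m x
  show "(\<Sum>j<m. cmod ((- F (1 + \<i> * of_real t)) j) * cmod (x j)) \<le> M * tsirelson_norm (restrict_seq {..<m} x)"
    using interp_boundedD(3)[OF F] by simp
qed

lemma interp_bounded_restrict:
  assumes F: "interp_bounded M F" shows "interp_bounded M (\<lambda>z. restrict_seq A (F z))"
  unfolding interp_bounded_def
proof (intro conjI allI)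
  fix j show "strip_fun (\<lambda>z. restrict_seq A (F z) j)"
    using interp_boundedD(1)[OF F] by (cases "j \<in> A") (simp_all add: restrict_seq_def strip_fun_const)
next
  fix t m
  have "tsirelson_norm (restrict_seq {..<m} (restrict_seq A (F (\<i> * of_real t)))) \<le> tsirelson_norm (restrict_seq {..<m} (F (\<i> * of_real t)))"
    by (rule tsirelson_norm_mono[OF restrict_lessThan_c00]) (simp add: restrict_seq_def)
  then show "tsirelson_norm (restrict_seq {..<m} (restrict_seq A (F (\<i> * of_real t)))) \<le> M"
    using interp_boundedD(2)[OF F] order_trans by blast
next
  fix t m x
  have "(\<Sum>j<m. cmod (restrict_seq A (F (1 + \<i> * of_real t)) j) * cmod (x j)) \<le> (\<Sum>j<m. cmod (F (1 + \<i> * of_real t) j) * cmod (x j))"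
    by (rule sum_mono) (simp add: restrict_seq_def)
  then show "(\<Sum>j<m. cmod (restrict_seq A (F (1 + \<i> * of_real t)) j) * cmod (x j)) \<le> M * tsirelson_norm (restrict_seq {..<m} x)"
    using interp_boundedD(3)[OF F] order_trans by blast
qed

text \<open>The l_1 norm of a finitely supported \<open>x\<close> bounds both its Tsirelson norm and
  its dual norm, the latter because coordinates are functionals of norm at most 1. Constant
  functions yield the \<open>finite_support\<close> estimate for \<open>\<Omega>\<close>.\<close>

lemma interp_bounded_const:
  assumes x: "\<forall>j\<ge>m. x j = 0" shows "interp_bounded (\<Sum>j<m. cmod (x j)) (\<lambda>z. x)"
  unfolding interp_bounded_def
proof (intro conjI allI)
  fix j show "strip_fun (\<lambda>z. x j)" by (rule strip_fun_const)
next
  fix t :: real and n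
  have "tsirelson_norm (restrict_seq {..<n} x) \<le> tsirelson_norm x"
    by (rule tsirelson_norm_mono[OF c00I[OF x]]) (simp add: restrict_seq_def)
  then show "tsirelson_norm (restrict_seq {..<n} x) \<le> (\<Sum>j<m. cmod (x j))"
    using tsirelson_norm_le_l1[OF x] by linarith
next
  fix t :: real and n y
  let ?T = "tsirelson_norm (restrict_seq {..<n} y)"
  have "(\<Sum>j<n. cmod (x j) * cmod (y j)) \<le> (\<Sum>j<n. cmod (x j) * ?T)"
  proof (rule sum_mono)
    fix j assume "j \<in> {..<n}"
    then have "cmod (y j) \<le> ?T"
      using tsirelson_norm_coord[OF restrict_lessThan_c00, of n y j] by (simp add: restrict_seq_def)
    then show "cmod (x j) * cmod (y j) \<le> cmod (x j) * ?T" by (rule mult_left_mono) simp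
  qed
  also have "\<dots> = (\<Sum>j<n. cmod (x j)) * ?T" by (simp add: sum_distrib_right)
  also have "(\<Sum>j<n. cmod (x j)) \<le> (\<Sum>j<m. cmod (x j))"
  proof -
    have "(\<Sum>j<n. cmod (x j)) = (\<Sum>j\<in>{..<n} \<inter> {..<m}. cmod (x j))"
      by (rule sum.mono_neutral_right) (use x not_le in auto)
    also have "\<dots> \<le> (\<Sum>j<m. cmod (x j))" by (rule sum_mono2) auto
    finally show ?thesis .
  qed
  then have "(\<Sum>j<n. cmod (x j)) * ?T \<le> (\<Sum>j<m. cmod (x j)) * ?T"
    by (rule mult_right_mono) (rule tsirelson_norm_nonneg[OF restrict_lessThan_c00])
  finally show "(\<Sum>j<n. cmod (x j) * cmod (y j)) \<le> (\<Sum>j<m. cmod (x j)) * ?T" .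
qed

text \<open>The exponent turns the coefficient \<open>c\<close> of modulus \<open>s r\<close> into one of modulus \<open>s r\<^sup>2\<close>, as for an
  \<open>l_1\<close>-normalised sequence, on the line \<open>Re z = 0\<close> and into one of modulus \<open>s\<close> on \<open>Re z = 1\<close>.\<close>

definition interp_coeff :: "real \<Rightarrow> complex \<Rightarrow> complex \<Rightarrow> complex" where
  "interp_coeff s c z = (if c = 0 then 0 else c * exp ((1 - 2 * z) * of_real (ln (cmod c / s))))"

lemma interp_coeff_half [simp]: "interp_coeff s c (1/2) = c"
  by (simp add: interp_coeff_def)

text \<open>The factor -2 in front of the Kalton-Peck map arises here, from the exponent
  \<open>1 - 2 * z\<close>. For \<open>c = a k\<close> and \<open>s = l2norm a\<close> the
  derivative is \<open>- 2 * kalton_peck a k\<close>.\<close>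

lemma interp_coeff_deriv:
  "(interp_coeff s c has_field_derivative (if c = 0 then 0 else - 2 * c * of_real (ln (cmod c / s)))) (at (1/2))"
proof (cases "c = 0")
  case False
  have "((\<lambda>z. c * exp ((1 - 2 * z) * of_real (ln (cmod c / s)))) has_field_derivative
      - 2 * c * of_real (ln (cmod c / s))) (at (1/2))"
    by (auto intro!: derivative_eq_intros)
  then show ?thesis using False unfolding interp_coeff_def by simp
next
  case True
  then have "interp_coeff s c = (\<lambda>z. 0)" by (simp add: interp_coeff_def fun_eq_iff)
  then show ?thesis using True by simp
qed

lemma interp_coeff_norm:
  assumes "0 < s"
  shows "cmod (interp_coeff s c (\<i> * of_real t)) = (cmod c)\<^sup>2 / s"
    and "cmod (interp_coeff s c (1 + \<i> * of_real t)) \<le> s"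
  using assms by (auto simp: interp_coeff_def norm_mult exp_minus power2_eq_square divide_simps)

lemma interp_coeff_strip_fun: "strip_fun (interp_coeff s c)"
proof (cases "c = 0")
  case True
  then have "interp_coeff s c = (\<lambda>z. 0)" by (simp add: interp_coeff_def fun_eq_iff)
  then show ?thesis by (simp add: strip_fun_const)
next
  case False
  let ?l = "ln (cmod c / s)"
  have "strip_fun (\<lambda>z. c * exp ((1 - 2 * z) * of_real ?l))"
  proof (rule strip_funI)
    fix z assume "z \<in> strip"
    then have "\<bar>1 - 2 * Re z\<bar> * \<bar>?l\<bar> \<le> 1 * \<bar>?l\<bar>" by (intro mult_right_mono) (auto simp: strip_def)
    then have "(1 - 2 * Re z) * ?l \<le> \<bar>?l\<bar>" using abs_ge_self[of "(1 - 2 * Re z) * ?l"] by (simp add: abs_mult)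
    then have "exp ((1 - 2 * Re z) * ?l) \<le> exp \<bar>?l\<bar>" by simp
    then show "cmod (c * exp ((1 - 2 * z) * of_real ?l)) \<le> cmod c * exp \<bar>?l\<bar>"
      unfolding norm_mult norm_exp_eq_Re by (intro mult_left_mono) auto
  qed (auto intro!: continuous_intros holomorphic_intros)
  then show ?thesis using False by (simp add: interp_coeff_def[abs_def])
qed

text \<open>On \<open>Re z = 0\<close> the moduli of the coefficients sum to at most
  \<open>s\<close>, and the triangle inequality suffices. On \<open>Re z = 1\<close> they are at
  most \<open>s\<close> each, and duality turns the lower l_1 estimate for admissible families into
  an upper sup estimate. The factor 2 is the price of the second line.\<close>

lemma interp_bounded_blocks:
  assumes A: "admissible n I" and G: "\<And>k. k < n \<Longrightarrow> interp_bounded V (G k)"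
    and V: "0 \<le> V" and s: "0 < s" "(\<Sum>k<n. (cmod (c k))\<^sup>2) \<le> s\<^sup>2"
  shows "interp_bounded (2 * V * s) (\<lambda>z. \<Sum>k<n. interp_coeff s (c k) z *\<^sub>C restrict_seq (I k) (G k z))"
    (is "interp_bounded _ ?F")
  unfolding interp_bounded_def
proof (intro conjI allI)
  have R: "interp_bounded V (\<lambda>z. restrict_seq (I k) (G k z))" if "k < n" for k
    by (rule interp_bounded_restrict[OF G[OF that]])
  fix j show "strip_fun (\<lambda>z. ?F z j)"
    using interp_boundedD(1)[OF R]
    by (simp, intro strip_fun_sum strip_fun_mult interp_coeff_strip_fun) auto
next
  have R: "interp_bounded V (\<lambda>z. restrict_seq (I k) (G k z))" if "k < n" for k
    by (rule interp_bounded_restrict[OF G[OF that]])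
  fix t m
  let ?z = "\<i> * complex_of_real t"
  have c: "restrict_seq {..<m} (interp_coeff s (c k) ?z *\<^sub>C restrict_seq (I k) (G k ?z)) \<in> c00" for k
    by (rule restrict_lessThan_c00)
  have "tsirelson_norm (restrict_seq {..<m} (?F ?z))
      \<le> (\<Sum>k<n. tsirelson_norm (restrict_seq {..<m} (interp_coeff s (c k) ?z *\<^sub>C restrict_seq (I k) (G k ?z))))"
    unfolding restrict_seq_sum by (rule tsirelson_norm_sum[OF c])
  also have "\<dots> \<le> (\<Sum>k<n. (cmod (c k))\<^sup>2 / s * V)"
  proof (rule sum_mono)
    fix k assume k: "k \<in> {..<n}"
    have "tsirelson_norm (restrict_seq {..<m} (interp_coeff s (c k) ?z *\<^sub>C restrict_seq (I k) (G k ?z)))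
      \<le> cmod (interp_coeff s (c k) ?z) * tsirelson_norm (restrict_seq {..<m} (restrict_seq (I k) (G k ?z)))"
      unfolding restrict_seq_scale by (rule tsirelson_norm_scale[OF restrict_lessThan_c00])
    also have "\<dots> \<le> cmod (interp_coeff s (c k) ?z) * V"
      using interp_boundedD(2)[OF R] k by (intro mult_left_mono) auto
    finally show "tsirelson_norm (restrict_seq {..<m} (interp_coeff s (c k) ?z *\<^sub>C restrict_seq (I k) (G k ?z)))
      \<le> (cmod (c k))\<^sup>2 / s * V" by (simp only: interp_coeff_norm[OF s(1)])
  qed
  also have "\<dots> = (\<Sum>k<n. (cmod (c k))\<^sup>2) / s * V" by (simp add: sum_distrib_right sum_divide_distrib)
  also have "\<dots> \<le> s\<^sup>2 / s * V" using s V by (intro mult_right_mono divide_right_mono) auto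
  also have "\<dots> \<le> 2 * V * s" using s V by (simp add: power2_eq_square)
  finally show "tsirelson_norm (restrict_seq {..<m} (?F ?z)) \<le> 2 * V * s" .
next
  fix t m x
  let ?z = "1 + \<i> * complex_of_real t"
  let ?x = "restrict_seq {..<m} x"
  have "(\<Sum>j<m. cmod (?F ?z j) * cmod (x j))
      \<le> (\<Sum>j<m. \<Sum>k<n. s * (cmod (G k ?z j) * cmod (restrict_seq (I k) ?x j)))"
  proof (rule sum_mono)
    fix j assume j: "j \<in> {..<m}"
    have "cmod (?F ?z j) * cmod (x j) \<le> (\<Sum>k<n. cmod (interp_coeff s (c k) ?z * restrict_seq (I k) (G k ?z) j)) * cmod (x j)"
      by (simp, intro mult_right_mono norm_sum) auto
    also have "\<dots> = (\<Sum>k<n. cmod (interp_coeff s (c k) ?z * restrict_seq (I k) (G k ?z) j) * cmod (x j))"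
      by (simp add: sum_distrib_right)
    also have "\<dots> \<le> (\<Sum>k<n. s * (cmod (G k ?z j) * cmod (restrict_seq (I k) ?x j)))"
    proof (rule sum_mono)
      fix k
      have "cmod (interp_coeff s (c k) ?z * restrict_seq (I k) (G k ?z) j) * cmod (x j)
          = cmod (interp_coeff s (c k) ?z) * (cmod (G k ?z j) * cmod (restrict_seq (I k) ?x j))"
        using j by (simp add: norm_mult restrict_seq_def)
      also have "\<dots> \<le> s * (cmod (G k ?z j) * cmod (restrict_seq (I k) ?x j))"
        using interp_coeff_norm(2)[OF s(1)] by (intro mult_right_mono) auto
      finally show "cmod (interp_coeff s (c k) ?z * restrict_seq (I k) (G k ?z) j) * cmod (x j)
          \<le> s * (cmod (G k ?z j) * cmod (restrict_seq (I k) ?x j))" .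
    qed
    finally show "cmod (?F ?z j) * cmod (x j) \<le> (\<Sum>k<n. s * (cmod (G k ?z j) * cmod (restrict_seq (I k) ?x j)))" .
  qed
  also have "\<dots> = (\<Sum>k<n. s * (\<Sum>j<m. cmod (G k ?z j) * cmod (restrict_seq (I k) ?x j)))"
    unfolding sum_distrib_left by (rule sum.swap)
  also have "\<dots> \<le> (\<Sum>k<n. s * (V * tsirelson_norm (restrict_seq (I k) ?x)))"
  proof (rule sum_mono)
    fix k assume k: "k \<in> {..<n}"
    have "restrict_seq {..<m} (restrict_seq (I k) ?x) = restrict_seq (I k) ?x"
      by (auto simp: restrict_seq_def fun_eq_iff)
    then show "s * (\<Sum>j<m. cmod (G k ?z j) * cmod (restrict_seq (I k) ?x j))
        \<le> s * (V * tsirelson_norm (restrict_seq (I k) ?x))"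
      using interp_boundedD(3)[OF G, of k t "restrict_seq (I k) ?x" m] k s by (intro mult_left_mono) auto
  qed
  also have "\<dots> = s * V * (\<Sum>k<n. tsirelson_norm (restrict_seq (I k) ?x))"
    by (simp add: sum_distrib_left mult.assoc)
  also have "\<dots> \<le> s * V * (2 * tsirelson_norm ?x)"
    using s V by (intro mult_left_mono tsirelson_norm_admissible[OF restrict_lessThan_c00 A]) auto
  finally show "(\<Sum>j<m. cmod (?F ?z j) * cmod (x j)) \<le> 2 * V * s * tsirelson_norm ?x"
    by (simp add: mult_ac)
qed


section \<open>From the selection to quasilinear estimates for \<open>Omega\<close>\<close>

lemma selection_interp_bounded:
  assumes sel: "homogeneous_selection tsirelson B"
  obtains C where "0 \<le> C" "\<And>x. x \<in> carr ell2 \<Longrightarrow> interp_bounded (C * l2norm x) (B x)"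
proof -
  obtain C where C: "\<And>x. x \<in> carr ell2 \<Longrightarrow> interp_norm tsirelson (dual_seq tsirelson) (B x) \<le> C * l2norm x"
    using sel unfolding homogeneous_selection_def by blast
  have "interp_bounded (\<bar>C\<bar> * l2norm x) (B x)" if x: "x \<in> carr ell2" for x
  proof -
    have mem: "B x \<in> interp_carrier tsirelson (dual_seq tsirelson)"
      using sel x unfolding homogeneous_selection_def by blast
    note mem' = mem[unfolded interp_carrier_def bounded_continuous_into_def mem_Collect_eq]
    have CC: "interp_norm tsirelson (dual_seq tsirelson) (B x) \<le> \<bar>C\<bar> * l2norm x"
      using C[OF x] mult_right_mono[of C "\<bar>C\<bar>" "l2norm x"] x by simp linarith
    \<comment> \<open>A real \<open>SUP\<close> bounds its terms only if the range is bounded above;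
      the boundedness of the boundary values required in \<open>interp_carrier\<close> provides this
      on both lines.\<close>
    have b0: "bdd_above (range (\<lambda>t. nrm tsirelson (B x (\<i> * of_real t))))"
      using mem' unfolding bdd_above_def by auto
    have b1: "bdd_above (range (\<lambda>t. nrm (dual_seq tsirelson) (B x (1 + \<i> * of_real t))))"
      using mem' unfolding bdd_above_def by auto
    have n0: "nrm tsirelson (B x (\<i> * of_real t)) \<le> \<bar>C\<bar> * l2norm x" for t
      using cSUP_upper[OF UNIV_I b0, of t] CC unfolding interp_norm_def by simp
    have n1: "nrm (dual_seq tsirelson) (B x (1 + \<i> * of_real t)) \<le> \<bar>C\<bar> * l2norm x" for t
      using cSUP_upper[OF UNIV_I b1, of t] CC unfolding interp_norm_def by simp
    show ?thesis
      unfolding interp_bounded_def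
    proof (intro conjI allI)
      show "strip_fun (\<lambda>z. B x z j)" for j using mem' unfolding strip_fun_def by blast
    next
      fix t m
      have "B x (\<i> * of_real t) \<in> carr tsirelson" using mem' by blast
      then show "tsirelson_norm (restrict_seq {..<m} (B x (\<i> * of_real t))) \<le> \<bar>C\<bar> * l2norm x"
        using tsirelson_partial_le n0 order_trans by blast
    next
      fix t m y
      let ?f = "B x (1 + \<i> * of_real t)" and ?T = "tsirelson_norm (restrict_seq {..<m} y)"
      have "?f \<in> carr (dual_seq tsirelson)" using mem' by blast
      then have "(\<Sum>j<m. cmod (?f j) * cmod (y j)) \<le> nrm (dual_seq tsirelson) ?f * ?T"
        by (rule dual_tsirelson_pairing)
      also have "\<dots> \<le> \<bar>C\<bar> * l2norm x * ?T"
        by (rule mult_right_mono[OF n1 tsirelson_norm_nonneg[OF restrict_lessThan_c00]])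
      finally show "(\<Sum>j<m. cmod (?f j) * cmod (y j)) \<le> \<bar>C\<bar> * l2norm x * ?T" .
    qed
  qed
  then show ?thesis using that[of "\<bar>C\<bar>"] by simp
qed

lemma interp_bounded_weaken:
  assumes F: "interp_bounded M F" and "M \<le> M'" shows "interp_bounded M' F"
  unfolding interp_bounded_def
proof (intro conjI allI)
  fix t m x
  show "(\<Sum>j<m. cmod (F (1 + \<i> * of_real t) j) * cmod (x j)) \<le> M' * tsirelson_norm (restrict_seq {..<m} x)"
    by (rule order_trans[OF interp_boundedD(3)[OF F]])
      (intro mult_right_mono assms tsirelson_norm_nonneg restrict_lessThan_c00)
qed (use interp_boundedD[OF F] assms(2) order_trans in blast)+

text \<open>Any bounded function with the right value at the centre may compete with the selected
  one, so each property of \<open>Omega\<close> is later obtained by writing down one competitor. In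
  \<open>2 * (1 + C)\<close> the sum bounds the difference of the two functions, and 2 is the cost
  of division by \<open>z - 1/2\<close>.\<close>

lemma Omega_near_half_deriv:
  assumes sel: "homogeneous_selection tsirelson B"
  obtains C where "0 \<le> C" "\<And>M F. interp_bounded M F \<Longrightarrow> ell2_le (C * M) (half_deriv F - Omega B (F (1/2)))"
proof -
  obtain C where C: "0 \<le> C" "\<And>x. x \<in> carr ell2 \<Longrightarrow> interp_bounded (C * l2norm x) (B x)"
    using selection_interp_bounded[OF sel] by blast
  have "ell2_le (2 * (1 + C) * M) (half_deriv F - Omega B (F (1/2)))" if F: "interp_bounded M F" for M F
  proof -
    let ?y = "F (1/2)"
    have y: "ell2_le M ?y" by (rule interp_bounded_half[OF F])
    note By = C(2)[OF ell2_le_mem[OF y]]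
    define G where "G z = F z + - B ?y z" for z
    have "interp_bounded (M + C * l2norm ?y) G"
      unfolding G_def by (rule interp_bounded_add[OF F interp_bounded_minus[OF By]])
    moreover have "G (1/2) = 0"
      using sel ell2_le_mem[OF y] unfolding homogeneous_selection_def G_def by simp
    ultimately have "ell2_le (2 * (M + C * l2norm ?y)) (half_deriv G)" by (rule interp_bounded_quotient)
    moreover have "half_deriv G = half_deriv F - Omega B ?y"
    proof
      fix j
      have "((\<lambda>z. F z j - B ?y z j) has_field_derivative
          deriv (\<lambda>z. F z j) (1/2) - deriv (\<lambda>z. B ?y z j) (1/2)) (at (1/2))"
        by (intro DERIV_diff strip_fun_deriv interp_boundedD(1)[OF F] interp_boundedD(1)[OF By])
      then show "half_deriv G j = (half_deriv F - Omega B ?y) j"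
        unfolding half_deriv_def Omega_def G_def by (simp add: DERIV_imp_deriv)
    qed
    moreover have "2 * (M + C * l2norm ?y) \<le> 2 * (1 + C) * M"
      using mult_left_mono[OF ell2_le_le[OF y] C(1)] by (simp add: algebra_simps)
    ultimately show ?thesis using ell2_le_weaken by metis
  qed
  then show ?thesis using that[of "2 * (1 + C)"] C(1) by simp
qed

lemma kalton_peck_apply:
  assumes "y \<in> carr ell2"
  shows "kalton_peck y j = (if y j = 0 then 0 else y j * of_real (ln (cmod (y j) / l2norm y)))"
proof (cases "y = 0")
  case False
  then have "0 < l2norm y" using l2norm_eq_0[OF assms] l2norm_nonneg[OF assms] by linarith
  then show ?thesis
    using False by (simp add: kalton_peck_def kalton_peck_sphere_def norm_divide norm_mult)
qed (simp add: kalton_peck_def)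

text \<open>What the interpolation argument leaves behind: the later sections know
  \<open>\<Omega>\<close> through these estimates alone. In \<open>blocks\<close> the error does not
  depend on \<open>n\<close>, and the vectors are cut to the sets \<open>I k\<close> instead of
  being assumed supported there.\<close>

locale tsirelson_twist =
  fixes \<Omega> :: "cseq \<Rightarrow> cseq" and C :: real
  assumes C_nonneg: "0 \<le> C"
    and homogeneous: "y \<in> carr ell2 \<Longrightarrow> \<Omega> (c *\<^sub>C y) = c *\<^sub>C \<Omega> y"
    and quasi_additive: "x \<in> carr ell2 \<Longrightarrow> y \<in> carr ell2 \<Longrightarrow> ell2_le (C * (l2norm x + l2norm y)) (\<Omega> (x + y) - \<Omega> x - \<Omega> y)"
    and centralizer: "x \<in> carr ell2 \<Longrightarrow> ell2_le (C * l2norm x) (restrict_seq A (\<Omega> x) - \<Omega> (restrict_seq A x))"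
    and finite_support: "\<forall>j\<ge>m. x j = 0 \<Longrightarrow> ell2_le (C * (\<Sum>j<m. cmod (x j))) (\<Omega> x)"
    and blocks: "admissible n I \<Longrightarrow> (\<And>k. k < n \<Longrightarrow> v k \<in> carr ell2) \<Longrightarrow> (\<And>k. k < n \<Longrightarrow> l2norm (v k) \<le> V) \<Longrightarrow> 0 \<le> V \<Longrightarrow>
      \<forall>j\<ge>n. a j = 0 \<Longrightarrow>
      ell2_le (C * V * l2norm a) (\<Omega> (\<Sum>k<n. a k *\<^sub>C restrict_seq (I k) (v k))
        - (\<Sum>k<n. a k *\<^sub>C restrict_seq (I k) (\<Omega> (v k))) + 2 *\<^sub>C (\<Sum>k<n. kalton_peck a k *\<^sub>C restrict_seq (I k) (v k)))"

lemma tsirelson_twist_exists: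
  assumes sel: "homogeneous_selection tsirelson B"
  obtains C where "tsirelson_twist (Omega B) C"
proof -
  obtain K where K: "0 \<le> K" "\<And>x. x \<in> carr ell2 \<Longrightarrow> interp_bounded (K * l2norm x) (B x)"
    using selection_interp_bounded[OF sel] by blast
  obtain D where D: "0 \<le> D" "\<And>M F. interp_bounded M F \<Longrightarrow> ell2_le (D * M) (half_deriv F - Omega B (F (1/2)))"
    using Omega_near_half_deriv[OF sel] by blast
  \<comment> \<open>A common constant: the block competitor has bound \<open>2 * K * V * s\<close>,
    sums and restrictions of selected functions cost \<open>K\<close>, and the added 1 covers
    constant functions.\<close>
  define C where "C = D * (2 * K + 1)"
  have B2: "B x (1/2) = x" if "x \<in> carr ell2" for x
    using sel that unfolding homogeneous_selection_def by blast
  have der: "((\<lambda>z. B x z j) has_field_derivative Omega B x j) (at (1/2))" if "x \<in> carr ell2" for x j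
    using strip_fun_deriv[OF interp_boundedD(1)[OF K(2)[OF that]]] unfolding Omega_def .
  have CK: "D * (K * r) \<le> C * r" if "0 \<le> r" for r
    using mult_nonneg_nonneg[OF D(1) that] mult_nonneg_nonneg[OF mult_nonneg_nonneg[OF D(1) K(1)] that]
    unfolding C_def by (simp add: algebra_simps)
  have "tsirelson_twist (Omega B) C"
  proof
    show "0 \<le> C" using D K by (simp add: C_def)
  next
    fix y :: cseq and c assume y: "y \<in> carr ell2"
    show "Omega B (c *\<^sub>C y) = c *\<^sub>C Omega B y"
    proof
      fix j
      have "((\<lambda>z. c * B y z j) has_field_derivative c * Omega B y j) (at (1/2))"
        by (rule DERIV_cmult[OF der[OF y]])
      then have "((\<lambda>z. B (c *\<^sub>C y) z j) has_field_derivative c * Omega B y j) (at (1/2))"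
      proof (rule has_field_derivative_transform_within_open[OF _ open_interior half_in_strip(1)])
        fix z assume "z \<in> interior strip"
        then have "z \<in> strip" using interior_subset by blast
        then have "B (c *\<^sub>C y) z = c *\<^sub>C B y z"
          using sel y unfolding homogeneous_selection_def by blast
        then show "c * B y z j = B (c *\<^sub>C y) z j" by simp
      qed
      then show "Omega B (c *\<^sub>C y) j = (c *\<^sub>C Omega B y) j"
        by (simp add: Omega_def DERIV_imp_deriv)
    qed
  next
    fix x y :: cseq assume x: "x \<in> carr ell2" and y: "y \<in> carr ell2"
    have b: "interp_bounded (K * l2norm x + K * l2norm y) (\<lambda>z. B x z + B y z)"
      by (rule interp_bounded_add[OF K(2)[OF x] K(2)[OF y]])
    have "half_deriv (\<lambda>z. B x z + B y z) = Omega B x + Omega B y"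
      using DERIV_add[OF der[OF x] der[OF y]] by (auto simp: half_deriv_def fun_eq_iff intro!: DERIV_imp_deriv)
    then have "ell2_le (D * (K * l2norm x + K * l2norm y)) (Omega B x + Omega B y - Omega B (x + y))"
      using D(2)[OF b] by (simp only: B2[OF x] B2[OF y])
    then have "ell2_le (D * (K * (l2norm x + l2norm y))) (- (Omega B x + Omega B y - Omega B (x + y)))"
      unfolding distrib_left by (rule ell2_le_minus)
    moreover have "- (Omega B x + Omega B y - Omega B (x + y)) = Omega B (x + y) - Omega B x - Omega B y"
      by (simp only: minus_diff_eq diff_diff_add)
    ultimately have "ell2_le (D * (K * (l2norm x + l2norm y))) (Omega B (x + y) - Omega B x - Omega B y)"
      by (simp only:)
    then show "ell2_le (C * (l2norm x + l2norm y)) (Omega B (x + y) - Omega B x - Omega B y)"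
      by (rule ell2_le_weaken) (intro CK add_nonneg_nonneg l2norm_nonneg x y)
  next
    fix x :: cseq and A assume x: "x \<in> carr ell2"
    have b: "interp_bounded (K * l2norm x) (\<lambda>z. restrict_seq A (B x z))"
      by (rule interp_bounded_restrict[OF K(2)[OF x]])
    have "half_deriv (\<lambda>z. restrict_seq A (B x z)) = restrict_seq A (Omega B x)"
      by (auto simp: half_deriv_def fun_eq_iff restrict_seq_def Omega_def)
    then have "ell2_le (D * (K * l2norm x)) (restrict_seq A (Omega B x) - Omega B (restrict_seq A x))"
      using D(2)[OF b] by (simp only: B2[OF x])
    then show "ell2_le (C * l2norm x) (restrict_seq A (Omega B x) - Omega B (restrict_seq A x))"
      using CK[of "l2norm x"] x by (auto intro: ell2_le_weaken)
  next
    fix x :: cseq and m assume x: "\<forall>j\<ge>m. x j = 0"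
    \<comment> \<open>A constant competitor has derivative 0, so the error of the comparison is
      \<open>Omega B x\<close> itself, up to sign.\<close>
    have "half_deriv (\<lambda>z. x) = 0" by (simp add: half_deriv_def fun_eq_iff)
    then have "ell2_le (D * (\<Sum>j<m. cmod (x j))) (- Omega B x)"
      using D(2)[OF interp_bounded_const[OF x]] by simp
    then have "ell2_le (D * (\<Sum>j<m. cmod (x j))) (Omega B x)" using ell2_le_minus by fastforce
    moreover have "D * (\<Sum>j<m. cmod (x j)) \<le> C * (\<Sum>j<m. cmod (x j))"
      using D(1) K(1) by (intro mult_right_mono sum_nonneg) (auto simp: C_def algebra_simps)
    ultimately show "ell2_le (C * (\<Sum>j<m. cmod (x j))) (Omega B x)" by (rule ell2_le_weaken)
  next
    fix n I and v :: "nat \<Rightarrow> cseq" and V :: real and a :: cseq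
    assume I: "admissible n I" and v: "\<And>k. k < n \<Longrightarrow> v k \<in> carr ell2"
      and vV: "\<And>k. k < n \<Longrightarrow> l2norm (v k) \<le> V" and V: "0 \<le> V" and a: "\<forall>j\<ge>n. a j = 0"
    let ?s = "l2norm a"
    have a2: "a \<in> carr ell2" using a by (rule l2norm_finite)
    \<comment> \<open>This settles \<open>a = 0\<close>, where \<open>?s\<close> vanishes and the
      coefficients \<open>interp_coeff ?s\<close> cannot be normalised.\<close>
    have zero: "Omega B 0 = 0"
    proof -
      have "ell2_le (D * (\<Sum>j<0. cmod ((0::cseq) j))) (half_deriv (\<lambda>z. 0) - Omega B 0)"
        by (rule D(2)[OF interp_bounded_const]) simp
      then have "ell2_le 0 (half_deriv (\<lambda>z. 0) - Omega B 0)" by simp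
      then have "(half_deriv (\<lambda>z. 0) - Omega B 0) j = 0" for j using ell2_le_coord by fastforce
      then show ?thesis by (simp add: fun_eq_iff half_deriv_def)
    qed
    show "ell2_le (C * V * ?s) (Omega B (\<Sum>k<n. a k *\<^sub>C restrict_seq (I k) (v k))
        - (\<Sum>k<n. a k *\<^sub>C restrict_seq (I k) (Omega B (v k)))
        + 2 *\<^sub>C (\<Sum>k<n. kalton_peck a k *\<^sub>C restrict_seq (I k) (v k)))" (is "ell2_le _ ?d")
    proof (cases "a = 0")
      case True
      then show ?thesis by (simp add: zero kalton_peck_def ell2_le_0)
    next
      case False
      then have s: "0 < ?s" using l2norm_eq_0[OF a2] l2norm_nonneg[OF a2] by linarith
      let ?F = "\<lambda>z. \<Sum>k<n. interp_coeff ?s (a k) z *\<^sub>C restrict_seq (I k) (B (v k) z)"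
      have Bv: "interp_bounded (K * V) (B (v k))" if "k < n" for k
        using interp_bounded_weaken[OF K(2)[OF v[OF that]]] mult_left_mono[OF vV[OF that] K(1)] by blast
      have b: "interp_bounded (2 * (K * V) * ?s) ?F"
        by (rule interp_bounded_blocks[OF I Bv]) (use K V s l2norm_finite(2)[OF a] in auto)
      have F2: "?F (1/2) = (\<Sum>k<n. a k *\<^sub>C restrict_seq (I k) (v k))"
        using v by (auto intro!: sum.cong simp: B2)
      have "half_deriv ?F = (\<Sum>k<n. a k *\<^sub>C restrict_seq (I k) (Omega B (v k)))
        - 2 *\<^sub>C (\<Sum>k<n. kalton_peck a k *\<^sub>C restrict_seq (I k) (v k))"
      proof
        fix j
        let ?R = "\<lambda>k x. if j \<in> I k then x else (0::complex)"
        let ?l = "\<lambda>k. if a k = 0 then 0 else - 2 * a k * of_real (ln (cmod (a k) / ?s))"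
        have "((\<lambda>z. \<Sum>k<n. interp_coeff ?s (a k) z * ?R k (B (v k) z j)) has_field_derivative
          (\<Sum>k<n. ?l k * ?R k (B (v k) (1/2) j) + ?R k (Omega B (v k) j) * interp_coeff ?s (a k) (1/2))) (at (1/2))"
        proof (rule DERIV_sum)
          fix k assume "k \<in> {..<n}"
          then have k: "v k \<in> carr ell2" using v by simp
          have "((\<lambda>z. ?R k (B (v k) z j)) has_field_derivative ?R k (Omega B (v k) j)) (at (1/2))"
            using der[OF k] by simp
          then show "((\<lambda>z. interp_coeff ?s (a k) z * ?R k (B (v k) z j)) has_field_derivative
            ?l k * ?R k (B (v k) (1/2) j) + ?R k (Omega B (v k) j) * interp_coeff ?s (a k) (1/2)) (at (1/2))"
            by (rule DERIV_mult[OF interp_coeff_deriv])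
        qed
        then have "half_deriv ?F j =
          (\<Sum>k<n. ?l k * ?R k (B (v k) (1/2) j) + ?R k (Omega B (v k) j) * a k)"
          unfolding half_deriv_def by (simp add: restrict_seq_def DERIV_imp_deriv)
        also have "\<dots> = (\<Sum>k<n. a k * ?R k (Omega B (v k) j) - 2 * (kalton_peck a k * ?R k (v k j)))"
          by (rule sum.cong) (auto simp: B2 v kalton_peck_apply[OF a2])
        finally show "half_deriv ?F j = ((\<Sum>k<n. a k *\<^sub>C restrict_seq (I k) (Omega B (v k)))
          - 2 *\<^sub>C (\<Sum>k<n. kalton_peck a k *\<^sub>C restrict_seq (I k) (v k))) j"
          by (simp add: restrict_seq_def sum_subtractf sum_distrib_left)
      qed
      then have "ell2_le (D * (2 * (K * V) * ?s)) ((\<Sum>k<n. a k *\<^sub>C restrict_seq (I k) (Omega B (v k)))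
        - 2 *\<^sub>C (\<Sum>k<n. kalton_peck a k *\<^sub>C restrict_seq (I k) (v k))
        - Omega B (\<Sum>k<n. a k *\<^sub>C restrict_seq (I k) (v k)))"
        using D(2)[OF b] unfolding F2 by simp
      from ell2_le_minus[OF this] have "ell2_le (D * (2 * (K * V) * ?s)) ?d"
        by (simp only: minus_diff_eq diff_diff_eq2 diff_add_eq)
      moreover have "D * (2 * (K * V) * ?s) \<le> C * V * ?s"
      proof -
        have "0 \<le> D * (V * ?s)" using D(1) V s by simp
        then show ?thesis by (simp add: C_def algebra_simps)
      qed
      ultimately show ?thesis by (rule ell2_le_weaken)
    qed
  qed
  then show ?thesis using that by blast
qed


section \<open>Domains of centralizers\<close>

text \<open>The choices \<open>\<Phi> = 0\<close> and \<open>\<Phi> = kalton_peck\<close> give \<open>l_2\<close> and, up to isometry, \<open>l_M\<close>.\<close>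

definition dom_norm :: "(cseq \<Rightarrow> cseq) \<Rightarrow> cseq \<Rightarrow> real" where
  "dom_norm \<Phi> y = l2norm (\<Phi> y) + l2norm y"

definition dom_space :: "(cseq \<Rightarrow> cseq) \<Rightarrow> cseq nspace" where
  "dom_space \<Phi> = \<lparr>carr = {y. y \<in> carr ell2 \<and> \<Phi> y \<in> carr ell2}, nrm = dom_norm \<Phi>\<rparr>"

definition shift_seq :: "cseq \<Rightarrow> cseq" where
  "shift_seq y = (\<lambda>j. case j of 0 \<Rightarrow> 0 | Suc i \<Rightarrow> y i)"

definition avg_seq :: "nat \<Rightarrow> cseq" where
  "avg_seq n = (\<lambda>j. if j < n then of_real (1 / real n) else 0)"

lemma shift_seq_apply: "shift_seq y j = (case j of 0 \<Rightarrow> 0 | Suc i \<Rightarrow> y i)"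
  by (simp add: shift_seq_def)

lemma avg_seq_apply: "avg_seq n j = (if j < n then of_real (1 / real n) else 0)"
  by (simp add: avg_seq_def)

text \<open>The properties shared by the zero map and \<open>kalton_peck\<close>. Coordinatewise
  continuity gives completeness of the domain and \<open>\<Phi>_tail\<close> the density of
  \<open>c00\<close>; shift invariance and \<open>\<Phi>_avg\<close> serve the extra line that a
  nonzero limit \<open>w\<close> creates.\<close>

locale quasilinear_domain =
  fixes \<Phi> :: "cseq \<Rightarrow> cseq" and K :: real
  assumes K_nonneg: "0 \<le> K"
    and \<Phi>_scale: "y \<in> carr ell2 \<Longrightarrow> \<Phi> (c *\<^sub>C y) = c *\<^sub>C \<Phi> y"
    and \<Phi>_add: "x \<in> carr ell2 \<Longrightarrow> y \<in> carr ell2 \<Longrightarrow> ell2_le (K * (l2norm x + l2norm y)) (\<Phi> (x + y) - \<Phi> x - \<Phi> y)"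
    and \<Phi>_cont: "(\<And>n. u n \<in> carr ell2) \<Longrightarrow> y \<in> carr ell2 \<Longrightarrow> (\<lambda>n. l2norm (u n - y)) \<longlonglongrightarrow> 0 \<Longrightarrow>
      (\<lambda>n. \<Phi> (u n) j) \<longlonglongrightarrow> \<Phi> y j"
    and \<Phi>_tail: "y \<in> carr ell2 \<Longrightarrow> \<Phi> y \<in> carr ell2 \<Longrightarrow> (\<lambda>m. l2norm (\<Phi> (restrict_seq {m..} y))) \<longlonglongrightarrow> 0"
    and \<Phi>_c00: "y \<in> c00 \<Longrightarrow> \<Phi> y \<in> carr ell2"
    and \<Phi>_shift: "y \<in> carr ell2 \<Longrightarrow> \<Phi> y \<in> carr ell2 \<Longrightarrow> l2norm (\<Phi> (shift_seq y)) = l2norm (\<Phi> y)"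
    and \<Phi>_avg: "(\<lambda>n. l2norm (\<Phi> (avg_seq n))) \<longlonglongrightarrow> 0"
begin

abbreviation "W \<equiv> carr (dom_space \<Phi>)"
abbreviation "q \<equiv> dom_norm \<Phi>"

lemma W_iff: "y \<in> W \<longleftrightarrow> y \<in> carr ell2 \<and> \<Phi> y \<in> carr ell2"
  by (simp add: dom_space_def)

lemma c00_W: "y \<in> c00 \<Longrightarrow> y \<in> W"
  by (simp add: W_iff c00_ell2 \<Phi>_c00)

lemma \<Phi>_add_ell2:
  assumes "x \<in> W" "y \<in> W"
  shows "ell2_le ((K + 1) * (q x + q y)) (\<Phi> (x + y))" "x + y \<in> W"
proof -
  have xy: "x \<in> carr ell2" "y \<in> carr ell2" "\<Phi> x \<in> carr ell2" "\<Phi> y \<in> carr ell2"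
    using assms by (auto simp: W_iff)
  have "ell2_le (K * (l2norm x + l2norm y) + (l2norm (\<Phi> x) + l2norm (\<Phi> y))) ((\<Phi> (x + y) - \<Phi> x - \<Phi> y) + (\<Phi> x + \<Phi> y))"
    by (intro ell2_le_add \<Phi>_add ell2_le_refl xy)
  moreover have "(\<Phi> (x + y) - \<Phi> x - \<Phi> y) + (\<Phi> x + \<Phi> y) = \<Phi> (x + y)"
    by (simp only: algebra_simps)
  ultimately have "ell2_le (K * (l2norm x + l2norm y) + (l2norm (\<Phi> x) + l2norm (\<Phi> y))) (\<Phi> (x + y))"
    by (simp only:)
  moreover have "K * (l2norm x + l2norm y) + (l2norm (\<Phi> x) + l2norm (\<Phi> y)) \<le> (K + 1) * (q x + q y)"
  proof -
    have "0 \<le> K * (l2norm (\<Phi> x) + l2norm (\<Phi> y))" using K_nonneg xy by simp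
    moreover have "0 \<le> l2norm x + l2norm y" using xy by simp
    ultimately show ?thesis by (simp add: dom_norm_def algebra_simps)
  qed
  ultimately show *: "ell2_le ((K + 1) * (q x + q y)) (\<Phi> (x + y))" by (rule ell2_le_weaken)
  show "x + y \<in> W" using ell2_le_mem[OF *] ell2_add[OF xy(1,2)] by (simp add: W_iff del: plus_fun_apply)
qed

lemma q_nonneg: "y \<in> W \<Longrightarrow> 0 \<le> q y"
  by (simp add: W_iff dom_norm_def)

text \<open>\<open>q\<close> is a quasi-norm; the constant is \<open>K + 1\<close> for the image
  under \<open>\<Phi>\<close> plus 1 for the vector itself.\<close>

lemma q_triangle: assumes "x \<in> W" "y \<in> W" shows "q (x + y) \<le> (K + 2) * (q x + q y)"
proof -
  have "l2norm (x + y) \<le> l2norm x + l2norm y" using assms by (auto simp: W_iff intro: l2norm_triangle)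
  also have "\<dots> \<le> q x + q y" using assms by (simp add: dom_norm_def W_iff)
  finally show ?thesis using ell2_le_le[OF \<Phi>_add_ell2(1)[OF assms]] unfolding dom_norm_def[of _ "x + y"]
    by (simp add: algebra_simps)
qed

lemma W_scale: "y \<in> W \<Longrightarrow> c *\<^sub>C y \<in> W"
  by (simp add: W_iff ell2_scale \<Phi>_scale)

lemma q_scale: "y \<in> W \<Longrightarrow> q (c *\<^sub>C y) = cmod c * q y"
  by (simp add: W_iff dom_norm_def l2norm_scale \<Phi>_scale distrib_left)

lemma W_subspace: "csubspace W"
  by (rule complex_vec.subspaceI) (auto intro: \<Phi>_add_ell2 W_scale c00_W)

lemma W_diff: "x \<in> W \<Longrightarrow> y \<in> W \<Longrightarrow> x - y \<in> W"
  using complex_vec.subspace_diff[OF W_subspace] .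

lemma q_minus_commute: assumes "x \<in> W" "y \<in> W" shows "q (x - y) = q (y - x)"
proof -
  have "y - x = (- 1) *\<^sub>C (x - y)" by (simp only: scaleC_minus1 minus_diff_eq)
  then show ?thesis using q_scale[OF W_diff[OF assms], of "-1"] by simp
qed

lemma q_triangle_diff: assumes "x \<in> W" "y \<in> W" "z \<in> W"
  shows "q (x - z) \<le> (K + 2) * (q (x - y) + q (y - z))"
  using q_triangle[OF W_diff[OF assms(1,2)] W_diff[OF assms(2,3)]] by (simp only: diff_add_cancel add_diff_eq)

lemma q_0 [simp]: "q 0 = 0"
  using q_scale[OF c00_W[OF c00_0], of 0] by simp

lemma q_eq_0: assumes "y \<in> W" shows "q y = 0 \<longleftrightarrow> y = 0"
proof
  assume "q y = 0"
  moreover have "0 \<le> l2norm (\<Phi> y)" "0 \<le> l2norm y" using assms by (auto simp: W_iff)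
  ultimately have "l2norm y = 0" unfolding dom_norm_def by linarith
  then show "y = 0" using l2norm_eq_0[of y] assms by (simp add: W_iff)
qed simp

lemma q_coord: "y \<in> W \<Longrightarrow> cmod (y j) \<le> q y"
  using l2norm_coord[of y j] by (simp add: W_iff dom_norm_def add_increasing)

lemma q_truncate: assumes y: "y \<in> W" shows "(\<lambda>n. q (y - restrict_seq {..<n} y)) \<longlonglongrightarrow> 0"
proof -
  have "y - restrict_seq {..<n} y = restrict_seq {n..} y" for n
    using restrict_seq_split[of n y] by (metis add_diff_cancel_left')
  moreover have "(\<lambda>n. l2norm (\<Phi> (restrict_seq {n..} y)) + l2norm (restrict_seq {n..} y)) \<longlonglongrightarrow> 0 + 0"
    using y by (intro tendsto_add \<Phi>_tail l2norm_tail) (auto simp: W_iff)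
  ultimately show ?thesis by (simp add: dom_norm_def)
qed

text \<open>The limit is found coordinatewise. For fixed \<open>n\<close> the bounds on
  \<open>u n - u m\<close> and on its image under \<open>\<Phi>\<close> survive
  \<open>m \<rightarrow> \<infinity>\<close> by \<open>ell2_le_limit\<close>; for the image this
  requires \<open>\<Phi>_cont\<close>, since \<open>\<Phi>\<close> is not linear and
  \<open>\<Phi> (u n - y)\<close> has to be reached directly.\<close>

lemma q_complete:
  assumes u: "\<And>n. u n \<in> W" and cau: "\<And>e. 0 < e \<Longrightarrow> \<exists>M. \<forall>m\<ge>M. \<forall>n\<ge>M. q (u m - u n) < e"
  obtains y where "y \<in> W" "(\<lambda>n. q (u n - y)) \<longlonglongrightarrow> 0"
proof -
  have u2: "u n \<in> carr ell2" for n using u by (simp add: W_iff)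
  have "\<exists>l. (\<lambda>n. u n j) \<longlonglongrightarrow> l" for j
  proof -
    have "Cauchy (\<lambda>n. u n j)"
    proof (rule metric_CauchyI)
      fix e :: real assume "0 < e"
      then obtain M where M: "\<forall>m\<ge>M. \<forall>n\<ge>M. q (u m - u n) < e" using cau by blast
      have "dist (u m j) (u n j) < e" if "m \<ge> M" "n \<ge> M" for m n
      proof -
        have "cmod ((u m - u n) j) \<le> q (u m - u n)" by (rule q_coord[OF W_diff[OF u u]])
        also have "\<dots> < e" using M that by blast
        finally show ?thesis by (simp add: dist_norm)
      qed
      then show "\<exists>M. \<forall>m\<ge>M. \<forall>n\<ge>M. dist (u m j) (u n j) < e" by blast
    qed
    then show ?thesis using Cauchy_convergent unfolding convergent_def by blast
  qed
  then obtain y where y: "\<And>j. (\<lambda>n. u n j) \<longlonglongrightarrow> y j" by metis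
  have step: "\<exists>M. \<forall>n\<ge>M. ell2_le e (u n - y)" if e: "0 < e" for e
  proof -
    obtain M where M: "\<forall>m\<ge>M. \<forall>n\<ge>M. q (u m - u n) < e" using cau[OF e] by blast
    have "ell2_le e (u n - y)" if n: "n \<ge> M" for n
    proof (rule ell2_le_limit[where x = "\<lambda>m. u n - u m" and M = "\<lambda>_. e"])
      show "(\<lambda>m. (u n - u m) j) \<longlonglongrightarrow> (u n - y) j" for j using y by (auto intro!: tendsto_intros)
      show "\<forall>\<^sub>F m in sequentially. ell2_le e (u n - u m)"
        using eventually_ge_at_top[of M]
      proof eventually_elim
        case (elim m)
        have "0 \<le> l2norm (\<Phi> (u n - u m))" "u n - u m \<in> carr ell2"
          using W_diff[OF u u, of n m] by (auto simp: W_iff)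
        moreover have "q (u n - u m) < e" using M n elim by blast
        ultimately show ?case unfolding ell2_le_def dom_norm_def by auto
      qed
    qed simp
    then show ?thesis by blast
  qed
  have y2: "y \<in> carr ell2"
  proof -
    obtain n where "ell2_le 1 (u n - y)" using step[of 1] by auto
    from ell2_diff[OF u2[of n] ell2_le_mem[OF this]] show ?thesis by (simp only: diff_diff_eq2 add_diff_cancel_left')
  qed
  have l0: "(\<lambda>n. l2norm (u n - y)) \<longlonglongrightarrow> 0"
  proof (rule LIMSEQ_I)
    fix e :: real assume e: "0 < e"
    then obtain M where "\<forall>n\<ge>M. ell2_le (e/2) (u n - y)" using step[of "e/2"] by auto
    then have "\<forall>n\<ge>M. norm (l2norm (u n - y) - 0) < e"
      using e l2norm_nonneg unfolding ell2_le_def by force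
    then show "\<exists>M. \<forall>n\<ge>M. norm (l2norm (u n - y) - 0) < e" by blast
  qed
  have step\<Phi>: "\<exists>M. \<forall>n\<ge>M. ell2_le e (\<Phi> (u n - y))" if e: "0 < e" for e
  proof -
    obtain M where M: "\<forall>m\<ge>M. \<forall>n\<ge>M. q (u m - u n) < e" using cau[OF e] by blast
    have "ell2_le e (\<Phi> (u n - y))" if n: "n \<ge> M" for n
    proof (rule ell2_le_limit[where x = "\<lambda>m. \<Phi> (u n - u m)" and M = "\<lambda>_. e"])
      show "(\<lambda>m. \<Phi> (u n - u m) j) \<longlonglongrightarrow> \<Phi> (u n - y) j" for j
      proof (rule \<Phi>_cont)
        have "u n - u m - (u n - y) = - (u m - y)" for m by (simp add: fun_eq_iff)
        then show "(\<lambda>m. l2norm (u n - u m - (u n - y))) \<longlonglongrightarrow> 0" using l0 by (simp only: l2norm_minus)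
      qed (intro ell2_diff u2 y2)+
      show "\<forall>\<^sub>F m in sequentially. ell2_le e (\<Phi> (u n - u m))"
        using eventually_ge_at_top[of M]
      proof eventually_elim
        case (elim m)
        have "0 \<le> l2norm (u n - u m)" "\<Phi> (u n - u m) \<in> carr ell2"
          using W_diff[OF u u, of n m] by (auto simp: W_iff)
        moreover have "q (u n - u m) < e" using M n elim by blast
        ultimately show ?case unfolding ell2_le_def dom_norm_def by auto
      qed
    qed simp
    then show ?thesis by blast
  qed
  have yW: "y \<in> W"
  proof -
    obtain n where "ell2_le 1 (\<Phi> (u n - y))" using step\<Phi>[of 1] by auto
    then have "u n - y \<in> W" using u2 y2 ell2_diff ell2_le_mem by (simp add: W_iff del: minus_apply)
    from W_diff[OF u[of n] this] show ?thesis by (simp only: diff_diff_eq2 add_diff_cancel_left')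
  qed
  have "(\<lambda>n. l2norm (\<Phi> (u n - y))) \<longlonglongrightarrow> 0"
  proof (rule LIMSEQ_I)
    fix e :: real assume e: "0 < e"
    then obtain M where "\<forall>n\<ge>M. ell2_le (e/2) (\<Phi> (u n - y))" using step\<Phi>[of "e/2"] by auto
    then have "\<forall>n\<ge>M. norm (l2norm (\<Phi> (u n - y)) - 0) < e"
      using e l2norm_nonneg unfolding ell2_le_def by force
    then show "\<exists>M. \<forall>n\<ge>M. norm (l2norm (\<Phi> (u n - y)) - 0) < e" by blast
  qed
  then have "(\<lambda>n. q (u n - y)) \<longlonglongrightarrow> 0" unfolding dom_norm_def using l0 tendsto_add_zero by blast
  then show ?thesis using that yW by blast
qed

end

section \<open>The Kalton-Peck map as a quasilinear map on l_2\<close>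

lemma xlnx_sqrt: fixes t :: real assumes "0 < t" "t \<le> 1" shows "\<bar>t * ln t\<bar> \<le> 2 * sqrt t"
proof -
  \<comment> \<open>Using \<open>ln x \<le> x - 1\<close> at \<open>1 / sqrt t\<close> and not at
    \<open>1 / t\<close> gives decay of order \<open>sqrt t\<close>, on which continuity at 0, tails
    and averages depend.\<close>
  have "ln (1 / sqrt t) \<le> 1 / sqrt t - 1" by (rule ln_le_minus_one) (use assms in simp)
  then have "- ln t \<le> 2 * (1 / sqrt t)" using assms by (simp add: ln_div ln_sqrt)
  then have "t * (- ln t) \<le> t * (2 * (1 / sqrt t))" using assms by (intro mult_left_mono) auto
  also have "t * (2 * (1 / sqrt t)) = 2 * (t / sqrt t)" by simp
  also have "t / sqrt t = sqrt t" using assms by (intro real_div_sqrt) simp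
  finally show ?thesis using assms by (simp add: abs_mult)
qed

lemma xlnx_bound: fixes x s :: real assumes "0 \<le> x" "x \<le> s" shows "x * \<bar>ln (x / s)\<bar> \<le> 2 * s"
proof (cases "x = 0")
  case False
  then have s: "0 < s" "0 < x" using assms by auto
  then have "\<bar>x / s * ln (x / s)\<bar> \<le> 2 * sqrt (x / s)" using assms by (intro xlnx_sqrt) auto
  also have "\<dots> \<le> 2 * 1" using s assms by (intro mult_left_mono) auto
  finally show ?thesis using s by (simp add: abs_mult divide_simps)
qed (use assms in simp)

lemma kalton_peck_scale:
  assumes y: "y \<in> carr ell2" shows "kalton_peck (c *\<^sub>C y) = c *\<^sub>C kalton_peck y"
  using kalton_peck_apply[OF ell2_scale[OF y, of c]] kalton_peck_apply[OF y] l2norm_scale[OF y, of c]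
  by (auto simp: fun_eq_iff norm_mult)

text \<open>Normalising three vectors with sum \<open>0\<close> by a common constant makes the Kalton-Peck map
  local, at a cost controlled by the boundedness of \<open>t ln t\<close>.\<close>

definition kp_rel :: "real \<Rightarrow> cseq \<Rightarrow> cseq" where
  "kp_rel s y = (\<lambda>j. if y j = 0 then 0 else y j * of_real (ln (cmod (y j) / s)))"

text \<open>Replacing the normalisation \<open>l2norm y\<close> by \<open>s\<close> adds a multiple
  of \<open>y\<close> by \<open>ln (l2norm y / s)\<close>, whose norm is controlled because
  \<open>t * ln t\<close> is bounded on the unit interval.\<close>

lemma kalton_peck_rel:
  assumes y: "y \<in> carr ell2" and s: "l2norm y \<le> s"
  shows "ell2_le (2 * s) (kalton_peck y - kp_rel s y)"
proof (cases "y = 0")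
  case True
  have "kalton_peck y - kp_rel s y = 0" by (simp add: True kalton_peck_def kp_rel_def fun_eq_iff)
  then show ?thesis using s True ell2_le_0 by simp
next
  case False
  then have pos: "0 < l2norm y" using l2norm_eq_0[OF y] l2norm_nonneg[OF y] by linarith
  have "kalton_peck y - kp_rel s y = of_real (- ln (l2norm y / s)) *\<^sub>C y"
    using pos s by (auto simp: kalton_peck_apply[OF y] kp_rel_def fun_eq_iff ln_div algebra_simps)
  then have "ell2_le (cmod (of_real (- ln (l2norm y / s))) * l2norm y) (kalton_peck y - kp_rel s y)"
    using ell2_le_scale[OF ell2_le_refl[OF y]] by metis
  moreover have "cmod (of_real (- ln (l2norm y / s))) * l2norm y \<le> 2 * s"
    using xlnx_bound[of "l2norm y" s] pos s by (simp add: mult.commute)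
  ultimately show ?thesis by (rule ell2_le_weaken)
qed

text \<open>Changing the scale adds a linear term, which cancels because the three entries sum to 0.
  So \<open>s\<close> may be replaced by the largest modulus \<open>r\<close> at this coordinate,
  where each term is at most \<open>2 * r\<close>; three of them give 6.\<close>

lemma kp_rel_triple:
  assumes "x j + y j + w j = 0" "0 < s"
  shows "cmod (kp_rel s x j + kp_rel s y j + kp_rel s w j) \<le> 6 * (cmod (x j) + cmod (y j))"
proof -
  define r where "r = max (cmod (x j)) (max (cmod (y j)) (cmod (w j)))"
  have w: "cmod (w j) \<le> cmod (x j) + cmod (y j)"
    using assms(1) norm_triangle_ineq[of "x j" "y j"] by (metis add_eq_0_iff norm_minus_cancel)
  have r: "r \<le> cmod (x j) + cmod (y j)" using w norm_ge_zero[of "x j"] norm_ge_zero[of "y j"]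
    unfolding r_def by linarith
  show ?thesis
  proof (cases "r = 0")
    case True
    then have "x j = 0" "y j = 0" "w j = 0" unfolding r_def by (smt (verit) norm_ge_zero norm_eq_zero)+
    then show ?thesis by (simp add: kp_rel_def)
  next
    case False
    then have r0: "0 < r" unfolding r_def by (smt (verit) norm_ge_zero)
    have eq: "kp_rel s u j = kp_rel r u j + u j * of_real (ln (r / s))" for u
      using r0 assms(2) by (auto simp: kp_rel_def ln_div algebra_simps)
    have "kp_rel s x j + kp_rel s y j + kp_rel s w j
        = kp_rel r x j + kp_rel r y j + kp_rel r w j + (x j + y j + w j) * of_real (ln (r / s))"
      unfolding eq by (simp add: algebra_simps)
    also have "\<dots> = kp_rel r x j + kp_rel r y j + kp_rel r w j" using assms(1) by simp
    finally have e: "kp_rel s x j + kp_rel s y j + kp_rel s w j = kp_rel r x j + kp_rel r y j + kp_rel r w j" .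
    have b: "cmod (kp_rel r u j) \<le> 2 * r" if "cmod (u j) \<le> r" for u
      using xlnx_bound[of "cmod (u j)" r] that r0 by (auto simp: kp_rel_def norm_mult)
    have "cmod (kp_rel r x j + kp_rel r y j + kp_rel r w j) \<le> 2 * r + 2 * r + 2 * r"
      by (intro norm_triangle_le add_mono b) (auto simp: r_def)
    also have "2 * r + 2 * r + 2 * r \<le> 6 * (cmod (x j) + cmod (y j))" using r by simp
    finally show ?thesis unfolding e .
  qed
qed

text \<open>The third vector is \<open>- (x + y)\<close>, and \<open>kp_rel\<close> is odd. The
  constant 12 is 6 from the pointwise estimate plus 2 for each of the three changes of
  normalisation.\<close>

lemma kalton_peck_quasi_additive:
  assumes x: "x \<in> carr ell2" and y: "y \<in> carr ell2"
  shows "ell2_le (12 * (l2norm x + l2norm y)) (kalton_peck (x + y) - kalton_peck x - kalton_peck y)"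
proof (cases "x = 0 \<and> y = 0")
  case True then show ?thesis by (simp add: kalton_peck_def ell2_le_0)
next
  case False
  define s where "s = l2norm x + l2norm y"
  have s: "l2norm x \<le> s" "l2norm y \<le> s" using x y by (auto simp: s_def)
  have xy: "x + y \<in> carr ell2" by (rule ell2_add[OF x y])
  have s0: "0 < s"
  proof -
    have "0 \<le> l2norm x" "0 \<le> l2norm y" "l2norm x \<noteq> 0 \<or> l2norm y \<noteq> 0"
      using False x y l2norm_eq_0 by auto
    then show ?thesis unfolding s_def by linarith
  qed
  have "ell2_le (6 * s) (kp_rel s (x + y) - kp_rel s x - kp_rel s y)"
  proof (rule ell2_le_dominated)
    let ?m = "\<lambda>j. complex_of_real (cmod (x j))" and ?n = "\<lambda>j. complex_of_real (cmod (y j))"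
    have "ell2_le (l2norm x) ?m" "ell2_le (l2norm y) ?n"
      by (rule ell2_le_dominated[OF ell2_le_refl[OF x]], simp, rule ell2_le_dominated[OF ell2_le_refl[OF y]], simp)
    from ell2_le_scale[OF ell2_le_add[OF this], of 6] show "ell2_le (6 * s) (6 *\<^sub>C (?m + ?n))" by (simp add: s_def)
    fix j
    have neg: "kp_rel s (- u) j = - kp_rel s u j" for u by (simp add: kp_rel_def)
    have "cmod (kp_rel s x j + kp_rel s y j + kp_rel s (- (x + y)) j) \<le> 6 * (cmod (x j) + cmod (y j))"
      by (rule kp_rel_triple) (use s0 in auto)
    moreover have "kp_rel s x j + kp_rel s y j + kp_rel s (- (x + y)) j
        = - ((kp_rel s (x + y) - kp_rel s x - kp_rel s y) j)"
      unfolding neg by simp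
    moreover have "(6 *\<^sub>C (?m + ?n)) j = of_real (6 * (cmod (x j) + cmod (y j)))" by simp
    then have "cmod ((6 *\<^sub>C (?m + ?n)) j) = 6 * (cmod (x j) + cmod (y j))" by (simp only: norm_of_real) simp
    ultimately show "cmod ((kp_rel s (x + y) - kp_rel s x - kp_rel s y) j) \<le> cmod ((6 *\<^sub>C (?m + ?n)) j)"
      by (simp only: norm_minus_cancel)
  qed
  moreover have "ell2_le (2 * s + 2 * s + 2 * s) ((kalton_peck (x + y) - kp_rel s (x + y))
      - (kalton_peck x - kp_rel s x) - (kalton_peck y - kp_rel s y))"
    by (intro ell2_le_diff kalton_peck_rel x y xy s) (unfold s_def, rule l2norm_triangle[OF x y])
  ultimately have "ell2_le (6 * s + (2 * s + 2 * s + 2 * s)) ((kp_rel s (x + y) - kp_rel s x - kp_rel s y)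
    + ((kalton_peck (x + y) - kp_rel s (x + y)) - (kalton_peck x - kp_rel s x) - (kalton_peck y - kp_rel s y)))"
    by (rule ell2_le_add)
  moreover have "(kp_rel s (x + y) - kp_rel s x - kp_rel s y)
    + ((kalton_peck (x + y) - kp_rel s (x + y)) - (kalton_peck x - kp_rel s x) - (kalton_peck y - kp_rel s y))
    = kalton_peck (x + y) - kalton_peck x - kalton_peck y" by (simp only: algebra_simps)
  ultimately have "ell2_le (6 * s + (2 * s + 2 * s + 2 * s)) (kalton_peck (x + y) - kalton_peck x - kalton_peck y)"
    by (simp only:)
  then show ?thesis by (rule ell2_le_weaken) (simp add: s_def)
qed


lemma xlnx_isCont: "isCont (\<lambda>w::complex. if w = 0 then 0 else w * of_real (ln (cmod w))) w"
proof (cases "w = 0")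
  case False
  have "isCont (\<lambda>w. w * complex_of_real (ln (cmod w))) w"
    by (intro continuous_intros) (use False in auto)
  moreover have "\<forall>\<^sub>F v in nhds w. v * complex_of_real (ln (cmod v)) = (if v = 0 then 0 else v * of_real (ln (cmod v)))"
    by (rule always_eventually) auto
  ultimately show ?thesis using isCont_cong by fastforce
next
  case True
  have "((\<lambda>w::complex. if w = 0 then 0 else w * of_real (ln (cmod w))) \<longlongrightarrow> 0) (at 0)"
  proof (rule Lim_null_comparison)
    have "((\<lambda>w::complex. 2 * sqrt (cmod w)) \<longlongrightarrow> 2 * sqrt (cmod 0)) (at 0)" by (intro tendsto_intros)
    then show "((\<lambda>w::complex. 2 * sqrt (cmod w)) \<longlongrightarrow> 0) (at 0)" by simp
    have "\<forall>\<^sub>F w::complex in at 0. cmod w < 1"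
      using eventually_at_ball[of 1 "0::complex" UNIV] by (simp add: dist_norm)
    then show "\<forall>\<^sub>F w::complex in at 0. norm (if w = 0 then 0 else w * of_real (ln (cmod w))) \<le> 2 * sqrt (cmod w)"
    proof eventually_elim
      case (elim w)
      then show ?case using xlnx_sqrt[of "cmod w"] by (auto simp: norm_mult abs_mult)
    qed
  qed
  then show ?thesis using True by (simp add: isCont_def)
qed

lemma kalton_peck_coord: assumes y: "y \<in> carr ell2" shows "cmod (kalton_peck y j) \<le> 2 * l2norm y"
  using xlnx_bound[of "cmod (y j)" "l2norm y"] l2norm_coord[OF y, of j] l2norm_nonneg[OF y]
  by (auto simp: kalton_peck_apply[OF y] norm_mult)

lemma l2norm_tendsto:
  assumes u: "\<And>n. u n \<in> carr ell2" and y: "y \<in> carr ell2" and l: "(\<lambda>n. l2norm (u n - y)) \<longlonglongrightarrow> 0"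
  shows "(\<lambda>n. l2norm (u n)) \<longlonglongrightarrow> l2norm y" "(\<lambda>n. u n j) \<longlonglongrightarrow> y j"
proof -
  have *: "\<bar>l2norm (u n) - l2norm y\<bar> \<le> l2norm (u n - y)" for n
  proof -
    have "l2norm (u n - y + y) \<le> l2norm (u n - y) + l2norm y" by (intro l2norm_triangle ell2_diff u y)
    moreover have "l2norm (u n - (u n - y)) \<le> l2norm (u n) + l2norm (u n - y)"
      by (intro l2norm_triangle_diff ell2_diff u y)
    moreover have "l2norm (y - u n + u n) \<le> l2norm (y - u n) + l2norm (u n)" by (intro l2norm_triangle ell2_diff u y)
    ultimately show ?thesis
      unfolding diff_add_cancel l2norm_minus_commute[of y "u n"] by linarith
  qed
  then have "(\<lambda>n. l2norm (u n) - l2norm y) \<longlonglongrightarrow> 0" by (intro Lim_null_comparison[OF _ l]) auto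
  then show "(\<lambda>n. l2norm (u n)) \<longlonglongrightarrow> l2norm y" by (rule LIM_zero_cancel)
  have "cmod (u n j - y j) \<le> l2norm (u n - y)" for n
    using l2norm_coord[OF ell2_diff[OF u y], of n j] by simp
  then have "(\<lambda>n. u n j - y j) \<longlonglongrightarrow> 0" by (intro Lim_null_comparison[OF _ l]) auto
  then show "(\<lambda>n. u n j) \<longlonglongrightarrow> y j" by (rule LIM_zero_cancel)
qed

text \<open>For \<open>y \<noteq> 0\<close> the claim is continuity of \<open>w * ln |w|\<close> at
  a normalised coordinate. At \<open>y = 0\<close> the normalisation degenerates and the bound
  \<open>kalton_peck_coord\<close> takes over.\<close>

lemma kalton_peck_cont:
  assumes u: "\<And>n. u n \<in> carr ell2" and y: "y \<in> carr ell2" and l: "(\<lambda>n. l2norm (u n - y)) \<longlonglongrightarrow> 0"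
  shows "(\<lambda>n. kalton_peck (u n) j) \<longlonglongrightarrow> kalton_peck y j"
proof (cases "y = 0")
  case True
  then have l': "(\<lambda>n. 2 * l2norm (u n)) \<longlonglongrightarrow> 0"
    using tendsto_mult_right_zero[OF l, of 2] by simp
  from l' have "(\<lambda>n. kalton_peck (u n) j) \<longlonglongrightarrow> 0"
    by (rule Lim_null_comparison[OF always_eventually[OF allI[OF kalton_peck_coord[OF u]]]])
  then show ?thesis using True by (simp add: kalton_peck_def)
next
  case False
  let ?g = "\<lambda>w::complex. if w = 0 then 0 else w * of_real (ln (cmod w))"
  have y0: "l2norm y \<noteq> 0" using False l2norm_eq_0[OF y] by simp
  have eq: "kalton_peck v j = of_real (l2norm v) * ?g (v j / of_real (l2norm v))" if v: "v \<in> carr ell2" for v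
    using l2norm_coord[OF v, of j] by (auto simp: kalton_peck_apply[OF v] norm_divide l2norm_nonneg[OF v])
  have "(\<lambda>n. u n j / of_real (l2norm (u n))) \<longlonglongrightarrow> y j / of_real (l2norm y)"
    using y0 by (intro tendsto_divide tendsto_of_real l2norm_tendsto[OF u y l]) auto
  then have "(\<lambda>n. ?g (u n j / of_real (l2norm (u n)))) \<longlonglongrightarrow> ?g (y j / of_real (l2norm y))"
    by (rule isCont_tendsto_compose[OF xlnx_isCont])
  then have "(\<lambda>n. of_real (l2norm (u n)) * ?g (u n j / of_real (l2norm (u n))))
      \<longlonglongrightarrow> of_real (l2norm y) * ?g (y j / of_real (l2norm y))"
    by (intro tendsto_mult tendsto_of_real l2norm_tendsto[OF u y l])
  then show ?thesis unfolding eq[OF u] eq[OF y] .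
qed

text \<open>The map on a tail \<open>?Q m\<close> is the tail of \<open>kalton_peck y\<close> minus
  \<open>ln (l2norm (?Q m) / l2norm y)\<close> times \<open>?Q m\<close>. The logarithm grows, but
  \<open>xlnx_sqrt\<close> bounds the product by
  \<open>2 * sqrt (l2norm (?Q m)) * sqrt (l2norm y)\<close>.\<close>

lemma kalton_peck_tail:
  assumes y: "y \<in> carr ell2" and Ky: "kalton_peck y \<in> carr ell2"
  shows "(\<lambda>m. l2norm (kalton_peck (restrict_seq {m..} y))) \<longlonglongrightarrow> 0"
proof (rule Lim_null_comparison)
  let ?Q = "\<lambda>m. restrict_seq {m..} y"
  let ?b = "\<lambda>m. l2norm (restrict_seq {m..} (kalton_peck y)) + 2 * sqrt (l2norm (?Q m)) * sqrt (l2norm y)"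
  have "?b \<longlonglongrightarrow> 0 + 2 * sqrt 0 * sqrt (l2norm y)"
    by (intro tendsto_intros l2norm_tail y Ky)
  then show "?b \<longlonglongrightarrow> 0" by simp
  have "norm (l2norm (kalton_peck (?Q m))) \<le> ?b m" for m
  proof (cases "?Q m = 0")
    case True
    then show ?thesis using ell2_restrict[OF Ky] by (simp add: kalton_peck_def)
  next
    case False
    have Q: "?Q m \<in> carr ell2" by (rule ell2_restrict[OF y])
    have pos: "0 < l2norm (?Q m)" using False l2norm_eq_0[OF Q] l2norm_nonneg[OF Q] by linarith
    have le: "l2norm (?Q m) \<le> l2norm y" by (rule l2norm_restrict_le[OF y])
    let ?c = "ln (l2norm (?Q m) / l2norm y)"
    have "kalton_peck (?Q m) = restrict_seq {m..} (kalton_peck y) + of_real (- ?c) *\<^sub>C ?Q m"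
      using pos le by (auto simp: kalton_peck_apply[OF Q] kalton_peck_apply[OF y] fun_eq_iff
          restrict_seq_apply ln_div algebra_simps)
    then have b: "ell2_le (l2norm (restrict_seq {m..} (kalton_peck y)) + cmod (of_real (- ?c)) * l2norm (?Q m)) (kalton_peck (?Q m))"
      using ell2_le_add[OF ell2_le_refl[OF ell2_restrict[OF Ky]] ell2_le_scale[OF ell2_le_refl[OF Q]]] by metis
    have "l2norm (?Q m) / l2norm y * \<bar>?c\<bar> \<le> 2 * sqrt (l2norm (?Q m) / l2norm y)"
      using xlnx_sqrt[of "l2norm (?Q m) / l2norm y"] pos le by (simp add: abs_mult)
    then have "l2norm y * (l2norm (?Q m) / l2norm y * \<bar>?c\<bar>) \<le> l2norm y * (2 * sqrt (l2norm (?Q m) / l2norm y))"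
      using pos le by (intro mult_left_mono) auto
    also have "l2norm y * (2 * sqrt (l2norm (?Q m) / l2norm y)) = 2 * sqrt (l2norm (?Q m)) * (l2norm y / sqrt (l2norm y))"
      by (simp add: real_sqrt_divide)
    also have "l2norm y / sqrt (l2norm y) = sqrt (l2norm y)" using pos le by (intro real_div_sqrt) simp
    finally have "cmod (of_real (- ?c)) * l2norm (?Q m) \<le> 2 * sqrt (l2norm (?Q m)) * sqrt (l2norm y)"
      using pos le by (simp add: mult.commute)
    then show ?thesis using ell2_le_le[OF b] l2norm_nonneg[OF ell2_le_mem[OF b]] by simp
  qed
  then show "\<forall>\<^sub>F m in sequentially. norm (l2norm (kalton_peck (?Q m))) \<le> ?b m" by simp
qed

lemma l2norm_shift:
  shows "y \<in> carr ell2 \<Longrightarrow> shift_seq y \<in> carr ell2" "y \<in> carr ell2 \<Longrightarrow> l2norm (shift_seq y) = l2norm y"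
proof -
  assume y: "y \<in> carr ell2"
  have s: "summable (\<lambda>j. (cmod (y j))\<^sup>2)" using y by (simp add: ell2_def)
  have eq: "(\<lambda>j. (cmod (shift_seq y (Suc j)))\<^sup>2) = (\<lambda>j. (cmod (y j))\<^sup>2)" by (simp add: shift_seq_def)
  have s': "summable (\<lambda>j. (cmod (shift_seq y j))\<^sup>2)"
    using s summable_Suc_iff[of "\<lambda>j. (cmod (shift_seq y j))\<^sup>2"] unfolding eq by simp
  then show "shift_seq y \<in> carr ell2" by (simp add: ell2_def)
  show "l2norm (shift_seq y) = l2norm y"
    unfolding l2norm_def using suminf_split_head[OF s'] unfolding eq by (simp add: shift_seq_def)
qed

lemma avg_seq_norm: "avg_seq n \<in> c00" "0 < n \<Longrightarrow> l2norm (avg_seq n) = 1 / sqrt (real n)"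
proof -
  have z: "\<forall>j\<ge>n. avg_seq n j = 0" by (simp add: avg_seq_def)
  show "avg_seq n \<in> c00" by (rule c00I[OF z])
  assume n: "0 < n"
  have "(l2norm (avg_seq n))\<^sup>2 = (\<Sum>j<n. (1 / real n)\<^sup>2)"
    unfolding l2norm_finite(2)[OF z] by (rule sum.cong) (auto simp: avg_seq_def norm_divide power_divide)
  also have "\<dots> = (1 / sqrt (real n))\<^sup>2" using n by (simp add: power2_eq_square)
  finally show "l2norm (avg_seq n) = 1 / sqrt (real n)"
    using l2norm_nonneg[OF l2norm_finite(1)[OF z]] by (simp add: power2_eq_iff_nonneg)
qed

text \<open>On \<open>avg_seq n\<close> the map is multiplication by \<open>ln t\<close> with
  \<open>t = 1 / sqrt n\<close>; since \<open>t\<close> is also the norm of the average, the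
  quantity in question is \<open>|t * ln t|\<close>.\<close>

lemma kalton_peck_avg: "(\<lambda>n. l2norm (kalton_peck (avg_seq n))) \<longlonglongrightarrow> 0"
proof (rule Lim_null_comparison)
  have "(\<lambda>n. 2 * sqrt (1 / sqrt (real n))) \<longlonglongrightarrow> 2 * sqrt 0"
    by (intro tendsto_intros tendsto_divide_0[OF tendsto_const] filterlim_at_top_imp_at_infinity
        filterlim_compose[OF sqrt_at_top] filterlim_real_sequentially)
  then show "(\<lambda>n. 2 * sqrt (1 / sqrt (real n))) \<longlonglongrightarrow> 0" by simp
  have "norm (l2norm (kalton_peck (avg_seq n))) \<le> 2 * sqrt (1 / sqrt (real n))" if n: "0 < n" for n
  proof -
    have a: "avg_seq n \<in> carr ell2" by (rule c00_ell2[OF avg_seq_norm(1)])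
    let ?t = "1 / sqrt (real n)"
    have t: "0 < ?t" "?t \<le> 1" using n by auto
    have "1 / real n / ?t = ?t" using n by (simp add: real_div_sqrt field_simps)
    then have "kalton_peck (avg_seq n) = of_real (ln ?t) *\<^sub>C avg_seq n"
      using n by (auto simp: fun_eq_iff kalton_peck_apply[OF a] avg_seq_norm(2) avg_seq_apply norm_divide)
    then have "l2norm (kalton_peck (avg_seq n)) = \<bar>?t * ln ?t\<bar>"
      using l2norm_scale[OF a, of "of_real (ln ?t)"] t n by (simp add: avg_seq_norm(2) abs_mult)
    then show ?thesis using xlnx_sqrt[OF t] by simp
  qed
  then show "\<forall>\<^sub>F n in sequentially. norm (l2norm (kalton_peck (avg_seq n))) \<le> 2 * sqrt (1 / sqrt (real n))"
    using eventually_gt_at_top[of 0] by (rule eventually_mono[rotated])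
qed

lemma kalton_peck_c00: assumes "y \<in> c00" shows "kalton_peck y \<in> c00"
proof -
  obtain n where "\<forall>j\<ge>n. y j = 0" using assms c00_support by auto
  then show ?thesis by (intro c00I[of n]) (simp add: kalton_peck_apply[OF c00_ell2[OF assms]])
qed

lemma kalton_peck_shift: assumes y: "y \<in> carr ell2"
  shows "kalton_peck (shift_seq y) = shift_seq (kalton_peck y)"
  using y by (auto simp: fun_eq_iff kalton_peck_apply l2norm_shift shift_seq_apply split: nat.split)

interpretation ell2: quasilinear_domain "\<lambda>_. 0" 0
  by unfold_locales (simp_all add: ell2_le_0)

lemma dom_space_0: "dom_space (\<lambda>_. 0) = ell2"
proof -
  have "dom_norm (\<lambda>_. 0) = l2norm" by (auto simp: dom_norm_def)
  then show ?thesis by (simp add: dom_space_def ell2_def)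
qed

interpretation kp: quasilinear_domain kalton_peck 12
proof
  show "l2norm (kalton_peck (shift_seq y)) = l2norm (kalton_peck y)" if "y \<in> carr ell2" "kalton_peck y \<in> carr ell2" for y
    using that by (simp add: kalton_peck_shift l2norm_shift)
  show "ell2_le (12 * (l2norm x + l2norm y)) (kalton_peck (x + y) - kalton_peck x - kalton_peck y)"
    if "x \<in> carr ell2" "y \<in> carr ell2" for x y
    by (rule kalton_peck_quasi_additive[OF that])
qed (auto intro: kalton_peck_scale kalton_peck_quasi_additive kalton_peck_cont kalton_peck_tail
    kalton_peck_avg c00_ell2 kalton_peck_c00 simp del: plus_fun_apply minus_apply)


section \<open>Comparing abstract completions with a concrete space\<close>

lemma linear_on_space_diff:
  assumes "linear_on_space V f" "csubspace V" "v \<in> V" "w \<in> V"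
  shows "f (v - w) = f v - f w"
proof -
  have "f (v - w + w) = f (v - w) + f w"
    using assms complex_vec.subspace_diff unfolding linear_on_space_def by blast
  then show ?thesis by (simp only: diff_add_cancel add_diff_cancel_right')
qed

lemma null_imp_cauchy:
  fixes f :: "nat \<Rightarrow> real"
  assumes f: "f \<longlonglongrightarrow> 0" and d: "\<And>m n. d m n \<le> A * (f m + f n)" and A: "0 \<le> A" and e: "0 < e"
  shows "\<exists>M. \<forall>m\<ge>M. \<forall>n\<ge>M. d m n < e"
proof -
  have "0 < e / (2 * A + 1)" using A e by simp
  then obtain M where M: "\<forall>n\<ge>M. \<bar>f n\<bar> < e / (2 * A + 1)" using LIMSEQ_D[OF f] by auto
  have "d m n < e" if "m \<ge> M" "n \<ge> M" for m n
  proof -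
    have "f m + f n \<le> 2 * (e / (2 * A + 1))" using M that by (smt (verit))
    then have "A * (f m + f n) \<le> A * (2 * (e / (2 * A + 1)))" using A by (rule mult_left_mono)
    also have "\<dots> < e" using A e by (simp add: field_simps)
    finally show ?thesis using d[of m n] by simp
  qed
  then show ?thesis by blast
qed

lemma inverse_bound_null:
  fixes f :: "nat \<Rightarrow> real"
  assumes "\<And>n. 0 \<le> f n" "\<And>n. f n < inverse (real (Suc n))"
  shows "f \<longlonglongrightarrow> 0"
proof (rule Lim_null_comparison[OF always_eventually LIMSEQ_inverse_real_of_nat], rule allI)
  show "norm (f n) \<le> inverse (real (Suc n))" for n using assms[of n] by simp
qed

lemma is_norm_onD:
  assumes "is_norm_on V N"
  shows "v \<in> V \<Longrightarrow> 0 \<le> N v" "v \<in> V \<Longrightarrow> N v = 0 \<longleftrightarrow> v = 0" "v \<in> V \<Longrightarrow> N (c *\<^sub>C v) = cmod c * N v"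
    "v \<in> V \<Longrightarrow> w \<in> V \<Longrightarrow> N (v + w) \<le> N v + N w"
  using assms unfolding is_norm_on_def by blast+

lemma is_norm_on_minus_commute:
  assumes N: "is_norm_on V N" and V: "csubspace V" and "v \<in> V" "w \<in> V"
  shows "N (v - w) = N (w - v)"
proof -
  have "w - v = (-1) *\<^sub>C (v - w)" by (simp only: scaleC_minus1 minus_diff_eq)
  then show ?thesis
    using is_norm_onD(3)[OF N complex_vec.subspace_diff[OF V assms(3,4)], of "-1"] by simp
qed

lemma is_norm_on_triangle_diff:
  assumes N: "is_norm_on V N" and V: "csubspace V" and "u \<in> V" "v \<in> V" "w \<in> V"
  shows "N (u - w) \<le> N (u - v) + N (v - w)"
  using is_norm_onD(4)[OF N, of "u - v" "v - w"] complex_vec.subspace_diff[OF V] assms(3-)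
  by (simp only: diff_add_cancel add_diff_eq)

context quasilinear_domain
begin

text \<open>Completions of \<open>c00\<close> under equivalent norms are isomorphic:
  \<open>J0 a \<mapsto> J a\<close> extends by continuity in both directions. \<open>J\<close> is
  left general because the comparison may use \<open>augment a\<close> in place of \<open>a\<close>;
  the density of its image is then a separate matter.\<close>

lemma completion_isomorphic:
  fixes S :: "'v::complex_vec nspace"
  assumes comp: "is_completion \<lparr>carr = c00, nrm = L\<rparr> S"
    and Jlin: "linear_on_space c00 J" and JW: "\<And>a. a \<in> c00 \<Longrightarrow> J a \<in> W"
    and dense: "\<And>y e. y \<in> W \<Longrightarrow> 0 < e \<Longrightarrow> \<exists>a\<in>c00. q (y - J a) < e"
    and c: "0 < c" and C: "0 < C"
    and LJ: "\<And>a. a \<in> c00 \<Longrightarrow> c * q (J a) \<le> L a" "\<And>a. a \<in> c00 \<Longrightarrow> L a \<le> C * q (J a)"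
  shows "S \<simeq>\<^sub>B dom_space \<Phi>"
proof -
  let ?V = "carr S" and ?N = "nrm S"
  obtain J0 where J0lin: "linear_on_space c00 J0" and J0V: "\<And>a. a \<in> c00 \<Longrightarrow> J0 a \<in> ?V"
    and J0N: "\<And>a. a \<in> c00 \<Longrightarrow> ?N (J0 a) = L a"
    and J0dense: "\<And>w e. w \<in> ?V \<Longrightarrow> 0 < e \<Longrightarrow> \<exists>a\<in>c00. ?N (w - J0 a) < e"
  proof -
    from comp obtain J0 where "linear_on_space c00 J0" "J0 ` c00 \<subseteq> ?V" "\<forall>a\<in>c00. ?N (J0 a) = L a"
      "\<forall>w\<in>?V. \<forall>e>0. \<exists>a\<in>c00. ?N (w - J0 a) < e"
      unfolding is_completion_def by auto
    then show ?thesis by (intro that[of J0]) auto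
  qed
  have ban: "is_banach S" using comp unfolding is_completion_def by blast
  have V: "csubspace ?V" and N: "is_norm_on ?V ?N" using ban unfolding is_banach_def by blast+
  have compl: "\<exists>v. converges_in S u v" if "\<And>n. u n \<in> ?V" "cauchy_in S u" for u
    using ban that unfolding is_banach_def by blast
  note Vd = complex_vec.subspace_diff[OF V]
  \<comment> \<open>The graph of the isomorphism.\<close>
  define R where "R s w \<longleftrightarrow> s \<in> ?V \<and> w \<in> W \<and>
    (\<exists>a. (\<forall>n. a n \<in> c00) \<and> (\<lambda>n. ?N (s - J0 (a n))) \<longlonglongrightarrow> 0 \<and> (\<lambda>n. q (w - J (a n))) \<longlonglongrightarrow> 0)" for s w
  have R_mem: "s \<in> ?V" "w \<in> W" if "R s w" for s w using that unfolding R_def by blast+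
  have c00d: "a - b \<in> c00" if "a \<in> c00" "b \<in> c00" for a b
    using complex_vec.subspace_diff[OF c00_csubspace that] .
  have ex1: "\<exists>w. R s w" if s: "s \<in> ?V" for s
  proof -
    have "\<forall>n. \<exists>a\<in>c00. ?N (s - J0 a) < inverse (real (Suc n))" using J0dense[OF s] by simp
    then obtain a where a: "\<And>n. a n \<in> c00" "\<And>n. ?N (s - J0 (a n)) < inverse (real (Suc n))" by metis
    have l: "(\<lambda>n. ?N (s - J0 (a n))) \<longlonglongrightarrow> 0"
      by (rule inverse_bound_null) (intro is_norm_onD(1)[OF N] Vd s J0V a)+
    have "q (J (a m) - J (a n)) \<le> inverse c * (?N (s - J0 (a m)) + ?N (s - J0 (a n)))" for m n
    proof -
      have "c * q (J (a m) - J (a n)) = c * q (J (a m - a n))"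
        by (simp only: linear_on_space_diff[OF Jlin c00_csubspace a(1) a(1)])
      also have "\<dots> \<le> ?N (J0 (a m - a n))" using LJ(1) J0N c00d a(1) by metis
      also have "\<dots> = ?N (J0 (a m) - J0 (a n))"
        by (simp only: linear_on_space_diff[OF J0lin c00_csubspace a(1) a(1)])
      also have "\<dots> \<le> ?N (J0 (a m) - s) + ?N (s - J0 (a n))"
        by (rule is_norm_on_triangle_diff[OF N V J0V[OF a(1)] s J0V[OF a(1)]])
      finally show ?thesis
        using c is_norm_on_minus_commute[OF N V J0V[OF a(1)] s] by (simp add: field_simps)
    qed
    from null_imp_cauchy[OF l this] obtain w where w: "w \<in> W" "(\<lambda>n. q (J (a n) - w)) \<longlonglongrightarrow> 0"
      using q_complete[of "\<lambda>n. J (a n)"] JW[OF a(1)] c by (metis inverse_nonnegative_iff_nonnegative less_imp_le)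
    then have "(\<lambda>n. q (w - J (a n))) \<longlonglongrightarrow> 0" using q_minus_commute[OF w(1) JW[OF a(1)]] by simp
    then show ?thesis using s w(1) a(1) l unfolding R_def by blast
  qed
  have ex2: "\<exists>s. R s w" if w: "w \<in> W" for w
  proof -
    have "\<forall>n. \<exists>a\<in>c00. q (w - J a) < inverse (real (Suc n))" using dense[OF w] by simp
    then obtain a where a: "\<And>n. a n \<in> c00" "\<And>n. q (w - J (a n)) < inverse (real (Suc n))" by metis
    have l: "(\<lambda>n. q (w - J (a n))) \<longlonglongrightarrow> 0"
      by (rule inverse_bound_null) (intro q_nonneg W_diff w JW a)+
    have "?N (J0 (a m) - J0 (a n)) \<le> (C * (K + 2)) * (q (w - J (a m)) + q (w - J (a n)))" for m n
    proof -
      have "?N (J0 (a m) - J0 (a n)) = ?N (J0 (a m - a n))"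
        by (simp only: linear_on_space_diff[OF J0lin c00_csubspace a(1) a(1)])
      also have "\<dots> \<le> C * q (J (a m - a n))" using LJ(2) J0N c00d a(1) by metis
      also have "J (a m - a n) = J (a m) - J (a n)"
        by (rule linear_on_space_diff[OF Jlin c00_csubspace a(1) a(1)])
      also have "C * q (J (a m) - J (a n)) \<le> C * ((K + 2) * (q (J (a m) - w) + q (w - J (a n))))"
        using C by (intro mult_left_mono q_triangle_diff JW a w) auto
      finally show ?thesis using q_minus_commute[OF JW[OF a(1)] w] by (simp add: mult.assoc)
    qed
    from null_imp_cauchy[OF l this] have "cauchy_in S (\<lambda>n. J0 (a n))"
      unfolding cauchy_in_def using C K_nonneg by simp
    from compl[OF J0V[OF a(1)] this] obtain s where s: "s \<in> ?V" "(\<lambda>n. ?N (J0 (a n) - s)) \<longlonglongrightarrow> 0"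
      unfolding converges_in_def by blast
    then have "(\<lambda>n. ?N (s - J0 (a n))) \<longlonglongrightarrow> 0"
      using is_norm_on_minus_commute[OF N V s(1) J0V[OF a(1)]] by simp
    then show ?thesis using s(1) w a(1) l unfolding R_def by blast
  qed
  have R_add: "R (s + s') (w + w')" if Rs: "R s w" "R s' w'" for s s' w w'
  proof -
    obtain a where a: "\<And>n. a n \<in> c00" "(\<lambda>n. ?N (s - J0 (a n))) \<longlonglongrightarrow> 0" "(\<lambda>n. q (w - J (a n))) \<longlonglongrightarrow> 0"
      using Rs(1) unfolding R_def by blast
    obtain b where b: "\<And>n. b n \<in> c00" "(\<lambda>n. ?N (s' - J0 (b n))) \<longlonglongrightarrow> 0" "(\<lambda>n. q (w' - J (b n))) \<longlonglongrightarrow> 0"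
      using Rs(2) unfolding R_def by blast
    note m = R_mem[OF Rs(1)] R_mem[OF Rs(2)]
    have "?N (s + s' - J0 (a n + b n)) \<le> ?N (s - J0 (a n)) + ?N (s' - J0 (b n))" for n
    proof -
      have "J0 (a n + b n) = J0 (a n) + J0 (b n)" using J0lin a(1) b(1) unfolding linear_on_space_def by blast
      then have "s + s' - J0 (a n + b n) = (s - J0 (a n)) + (s' - J0 (b n))" by (simp only: add_diff_add)
      then show ?thesis
        by (simp only:) (rule is_norm_onD(4)[OF N Vd[OF m(1) J0V[OF a(1)]] Vd[OF m(3) J0V[OF b(1)]]])
    qed
    moreover have "0 \<le> ?N (s + s' - J0 (a n + b n))" for n
      by (intro is_norm_onD(1)[OF N] Vd J0V c00_add a b complex_vec.subspace_add[OF V] m)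
    ultimately have "(\<lambda>n. ?N (s + s' - J0 (a n + b n))) \<longlonglongrightarrow> 0"
      using tendsto_add_zero[OF a(2) b(2)] by (auto intro: Lim_null_comparison[rotated])
    moreover have "q (w + w' - J (a n + b n)) \<le> (K + 2) * (q (w - J (a n)) + q (w' - J (b n)))" for n
    proof -
      have "J (a n + b n) = J (a n) + J (b n)" using Jlin a(1) b(1) unfolding linear_on_space_def by blast
      then have "w + w' - J (a n + b n) = (w - J (a n)) + (w' - J (b n))" by (simp only: add_diff_add)
      then show ?thesis
        by (simp only:) (rule q_triangle[OF W_diff[OF m(2) JW[OF a(1)]] W_diff[OF m(4) JW[OF b(1)]]])
    qed
    moreover have "0 \<le> q (w + w' - J (a n + b n))" for n
      by (intro q_nonneg W_diff JW c00_add a b complex_vec.subspace_add[OF W_subspace] m)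
    ultimately have "(\<lambda>n. ?N (s + s' - J0 (a n + b n))) \<longlonglongrightarrow> 0" "(\<lambda>n. q (w + w' - J (a n + b n))) \<longlonglongrightarrow> 0"
      using tendsto_mult_right_zero[OF tendsto_add_zero[OF a(3) b(3)], of "K + 2"]
      by (auto intro: Lim_null_comparison[rotated] simp del: plus_fun_apply)
    then show ?thesis
      unfolding R_def using complex_vec.subspace_add[OF V m(1,3)] complex_vec.subspace_add[OF W_subspace m(2,4)]
      by (intro conjI exI[of _ "\<lambda>n. a n + b n"] allI c00_add a(1) b(1))
  qed
  have R_scale: "R (k *\<^sub>C s) (k *\<^sub>C w)" if Rs: "R s w" for s w k
  proof -
    obtain a where a: "\<And>n. a n \<in> c00" "(\<lambda>n. ?N (s - J0 (a n))) \<longlonglongrightarrow> 0" "(\<lambda>n. q (w - J (a n))) \<longlonglongrightarrow> 0"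
      using Rs unfolding R_def by blast
    note m = R_mem[OF Rs]
    have "?N (k *\<^sub>C s - J0 (k *\<^sub>C a n)) = cmod k * ?N (s - J0 (a n))" for n
    proof -
      have "J0 (k *\<^sub>C a n) = k *\<^sub>C J0 (a n)" using J0lin a(1) unfolding linear_on_space_def by blast
      then have "k *\<^sub>C s - J0 (k *\<^sub>C a n) = k *\<^sub>C (s - J0 (a n))" by (simp only: scaleC_diff_right)
      then show ?thesis by (simp only:) (rule is_norm_onD(3)[OF N Vd[OF m(1) J0V[OF a(1)]]])
    qed
    moreover have "q (k *\<^sub>C w - J (k *\<^sub>C a n)) = cmod k * q (w - J (a n))" for n
    proof -
      have "J (k *\<^sub>C a n) = k *\<^sub>C J (a n)" using Jlin a(1) unfolding linear_on_space_def by blast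
      then have "k *\<^sub>C w - J (k *\<^sub>C a n) = k *\<^sub>C (w - J (a n))" by (simp only: scaleC_diff_right)
      then show ?thesis by (simp only:) (rule q_scale[OF W_diff[OF m(2) JW[OF a(1)]]])
    qed
    ultimately have "(\<lambda>n. ?N (k *\<^sub>C s - J0 (k *\<^sub>C a n))) \<longlonglongrightarrow> 0" "(\<lambda>n. q (k *\<^sub>C w - J (k *\<^sub>C a n))) \<longlonglongrightarrow> 0"
      using tendsto_mult_right_zero[OF a(2)] tendsto_mult_right_zero[OF a(3)] by (simp_all only:)
    then show ?thesis
      unfolding R_def using complex_vec.subspace_scale[OF V m(1)] complex_vec.subspace_scale[OF W_subspace m(2)]
      by (intro conjI exI[of _ "\<lambda>n. k *\<^sub>C a n"] allI c00_scale a(1))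
  qed
  have bound1: "?N s \<le> C * (K + 2) * q w" if Rs: "R s w" for s w
  proof -
    obtain a where a: "\<And>n. a n \<in> c00" "(\<lambda>n. ?N (s - J0 (a n))) \<longlonglongrightarrow> 0" "(\<lambda>n. q (w - J (a n))) \<longlonglongrightarrow> 0"
      using Rs unfolding R_def by blast
    note m = R_mem[OF Rs]
    have "?N s \<le> ?N (s - J0 (a n)) + C * ((K + 2) * (q (w - J (a n)) + q w))" for n
    proof -
      have "?N (s - J0 (a n) + J0 (a n)) \<le> ?N (s - J0 (a n)) + ?N (J0 (a n))"
        by (rule is_norm_onD(4)[OF N Vd[OF m(1) J0V[OF a(1)]] J0V[OF a(1)]])
      then have 1: "?N s \<le> ?N (s - J0 (a n)) + ?N (J0 (a n))" by (simp only: diff_add_cancel)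
      have "q (J (a n) - w + w) \<le> (K + 2) * (q (J (a n) - w) + q w)"
        by (rule q_triangle[OF W_diff[OF JW[OF a(1)] m(2)] m(2)])
      then have "q (J (a n)) \<le> (K + 2) * (q (w - J (a n)) + q w)"
        using q_minus_commute[OF JW[OF a(1)] m(2)] by (simp only: diff_add_cancel)
      then have "C * q (J (a n)) \<le> C * ((K + 2) * (q (w - J (a n)) + q w))" using C by simp
      then show ?thesis using 1 LJ(2)[OF a(1), of n] J0N[OF a(1), of n] by linarith
    qed
    moreover have "(\<lambda>n. ?N (s - J0 (a n)) + C * ((K + 2) * (q (w - J (a n)) + q w))) \<longlonglongrightarrow> 0 + C * ((K + 2) * (0 + q w))"
      by (intro tendsto_intros a)
    ultimately have "?N s \<le> 0 + C * ((K + 2) * (0 + q w))" by (intro LIMSEQ_le_const) auto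
    then show ?thesis by (simp add: mult.assoc)
  qed
  have bound2: "q w \<le> (K + 2) / c * ?N s" if Rs: "R s w" for s w
  proof -
    obtain a where a: "\<And>n. a n \<in> c00" "(\<lambda>n. ?N (s - J0 (a n))) \<longlonglongrightarrow> 0" "(\<lambda>n. q (w - J (a n))) \<longlonglongrightarrow> 0"
      using Rs unfolding R_def by blast
    note m = R_mem[OF Rs]
    have "q w \<le> (K + 2) * (q (w - J (a n)) + (?N (s - J0 (a n)) + ?N s) / c)" for n
    proof -
      have "?N (J0 (a n) - s + s) \<le> ?N (J0 (a n) - s) + ?N s"
        by (rule is_norm_onD(4)[OF N Vd[OF J0V[OF a(1)] m(1)] m(1)])
      then have "L (a n) \<le> ?N (s - J0 (a n)) + ?N s"
        using is_norm_on_minus_commute[OF N V J0V[OF a(1)] m(1)] J0N[OF a(1)] by (simp only: diff_add_cancel)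
      then have "c * q (J (a n)) \<le> ?N (s - J0 (a n)) + ?N s" using LJ(1)[OF a(1), of n] by linarith
      then have "q (J (a n)) \<le> (?N (s - J0 (a n)) + ?N s) / c" using c by (simp add: pos_le_divide_eq mult.commute)
      then have "(K + 2) * (q (w - J (a n)) + q (J (a n))) \<le> (K + 2) * (q (w - J (a n)) + (?N (s - J0 (a n)) + ?N s) / c)"
        using K_nonneg by (intro mult_left_mono) auto
      moreover have "q (w - J (a n) + J (a n)) \<le> (K + 2) * (q (w - J (a n)) + q (J (a n)))"
        by (rule q_triangle[OF W_diff[OF m(2) JW[OF a(1)]] JW[OF a(1)]])
      ultimately show ?thesis by (simp only: diff_add_cancel)
    qed
    moreover have "(\<lambda>n. (K + 2) * (q (w - J (a n)) + (?N (s - J0 (a n)) + ?N s) / c)) \<longlonglongrightarrow> (K + 2) * (0 + (0 + ?N s) / c)"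
      using c by (intro tendsto_intros a) auto
    ultimately have "q w \<le> (K + 2) * (0 + (0 + ?N s) / c)" by (intro LIMSEQ_le_const) auto
    then show ?thesis by simp
  qed
  have R_diff: "R (s - s') (w - w')" if "R s w" "R s' w'" for s s' w w'
    using R_add[OF that(1) R_scale[OF that(2), of "-1"]] by (simp only: scaleC_minus1 add_uminus_conv_diff)
  have uniq1: "w = w'" if "R s w" "R s w'" for s w w'
  proof -
    have *: "R 0 (w - w')" using R_diff[OF that] by simp
    have "?N 0 = 0" using is_norm_onD(2)[OF N complex_vec.subspace_0[OF V]] by simp
    then have "q (w - w') = 0" using bound2[OF *] q_nonneg[OF R_mem(2)[OF *]] by simp
    then have "w - w' = 0" using q_eq_0[OF R_mem(2)[OF *]] by blast
    then show ?thesis by (simp only: right_minus_eq)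
  qed
  have uniq2: "s = s'" if "R s w" "R s' w" for s s' w
  proof -
    have *: "R (s - s') 0" using R_diff[OF that] by simp
    have "?N (s - s') = 0" using bound1[OF *] is_norm_onD(1)[OF N R_mem(1)[OF *]] by simp
    then show ?thesis using is_norm_onD(2)[OF N R_mem(1)[OF *]] by simp
  qed
  define g where "g s = (THE w. R s w)" for s
  have g: "R s (g s)" if s: "s \<in> ?V" for s
  proof -
    obtain w where w: "R s w" using ex1[OF s] by blast
    show ?thesis unfolding g_def by (rule theI[of "R s", OF w]) (rule uniq1[OF _ w])
  qed
  have g_eq: "g s = w" if "R s w" for s w
    using g[OF R_mem(1)[OF that]] that uniq1 by blast
  have "linear_on_space ?V g"
    unfolding linear_on_space_def
  proof (intro conjI ballI allI)
    show "g (s + s') = g s + g s'" if "s \<in> ?V" "s' \<in> ?V" for s s'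
      by (rule g_eq[OF R_add[OF g[OF that(1)] g[OF that(2)]]])
    show "g (k *\<^sub>C s) = k *\<^sub>C g s" if "s \<in> ?V" for k s
      by (rule g_eq[OF R_scale[OF g[OF that]]])
  qed
  moreover have "bij_betw g ?V W"
    unfolding bij_betw_def
  proof
    show "inj_on g ?V"
    proof (rule inj_onI)
      fix s s' assume s: "s \<in> ?V" "s' \<in> ?V" "g s = g s'"
      show "s = s'" using uniq2[OF g[OF s(1)]] g[OF s(2)] s(3) by simp
    qed
    show "g ` ?V = W"
    proof (intro subset_antisym subsetI)
      fix w assume "w \<in> g ` ?V"
      then obtain s where "s \<in> ?V" "w = g s" by blast
      then show "w \<in> W" using R_mem(2)[OF g] by blast
    next
      fix w assume "w \<in> W"
      then obtain s where s: "R s w" using ex2 by blast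
      show "w \<in> g ` ?V" using g_eq[OF s] R_mem(1)[OF s] by blast
    qed
  qed
  moreover have "equivalent_on ?V ?N (\<lambda>s. nrm (dom_space \<Phi>) (g s))"
    unfolding equivalent_on_def
  proof (intro exI conjI ballI)
    show "0 < inverse (C * (K + 2))" "0 < (K + 2) / c" using C c K_nonneg by auto
    fix s assume s: "s \<in> ?V"
    have nq: "nrm (dom_space \<Phi>) = q" by (simp add: dom_space_def)
    show "inverse (C * (K + 2)) * ?N s \<le> nrm (dom_space \<Phi>) (g s)"
    proof -
      have "0 < C * (K + 2)" using C K_nonneg by simp
      then show ?thesis using bound1[OF g[OF s]] unfolding nq by (simp add: field_simps)
    qed
    show "nrm (dom_space \<Phi>) (g s) \<le> (K + 2) / c * ?N s" using bound2[OF g[OF s]] unfolding nq .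
  qed
  ultimately show ?thesis unfolding isomorphic_def by blast
qed

end


context quasilinear_domain
begin

text \<open>A concrete carrier is provided by \<open>W\<close> itself, with the limit of
  \<open>L\<close> along truncations as norm. Truncations converge in \<open>W\<close>, so this norm
  extends \<open>L\<close> and stays equivalent to \<open>q\<close>, from which completeness is
  inherited.\<close>

lemma completion_exists:
  assumes L: "is_norm_on c00 L" and c: "0 < c" and C: "0 < C"
    and Lq: "\<And>a. a \<in> c00 \<Longrightarrow> c * q a \<le> L a" "\<And>a. a \<in> c00 \<Longrightarrow> L a \<le> C * q a"
  shows "\<exists>S :: cseq nspace. is_completion \<lparr>carr = c00, nrm = L\<rparr> S"
proof -
  let ?P = "\<lambda>n. restrict_seq {..<n}"
  have P: "?P n w \<in> c00" for n w by (rule restrict_lessThan_c00)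
  have PW: "?P n w \<in> W" for n w by (rule c00_W[OF P])
  define N where "N w = lim (\<lambda>n. L (?P n w))" for w
  have lim: "(\<lambda>n. L (?P n w)) \<longlonglongrightarrow> N w" if w: "w \<in> W" for w
  proof -
    have "\<bar>L (?P m w) - L (?P n w)\<bar> \<le> C * (K + 2) * (q (w - ?P m w) + q (w - ?P n w))" for m n
    proof -
      have "\<bar>L (?P m w) - L (?P n w)\<bar> \<le> L (?P m w - ?P n w)"
      proof -
        have "L a \<le> L (a - b) + L b" if "a \<in> c00" "b \<in> c00" for a b
          using is_norm_onD(4)[OF L complex_vec.subspace_diff[OF c00_csubspace that] that(2)]
          by (simp only: diff_add_cancel)
        from this[OF P P, of m w n w] this[OF P P, of n w m w] show ?thesis
          using is_norm_on_minus_commute[OF L c00_csubspace P P, of m w n w] by linarith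
      qed
      also have "\<dots> \<le> C * q (?P m w - ?P n w)"
        by (rule Lq(2)[OF complex_vec.subspace_diff[OF c00_csubspace P P]])
      also have "\<dots> \<le> C * ((K + 2) * (q (?P m w - w) + q (w - ?P n w)))"
        using C by (intro mult_left_mono q_triangle_diff PW w) auto
      finally show ?thesis using q_minus_commute[OF PW w] by (simp only: mult.assoc)
    qed
    from null_imp_cauchy[OF q_truncate[OF w] this] have "Cauchy (\<lambda>n. L (?P n w))"
      using C K_nonneg by (intro metric_CauchyI) (simp add: dist_real_def)
    then show ?thesis unfolding N_def by (simp add: Cauchy_convergent convergent_LIMSEQ_iff[symmetric])
  qed
  have N_c00: "N a = L a" if a: "a \<in> c00" for a
  proof -
    obtain m where m: "\<forall>j\<ge>m. a j = 0" using a c00_support by auto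
    have "?P n a = a" if "n \<ge> m" for n by (rule restrict_seq_id) (use that m in auto)
    then have "(\<lambda>n. L (?P n a)) \<longlonglongrightarrow> L a"
      by (intro tendsto_eventually) (auto simp: eventually_sequentially intro!: exI[of _ m])
    then show ?thesis using lim[OF c00_W[OF a]] LIMSEQ_unique by blast
  qed
  have N_le: "N w \<le> C * (K + 2) * q w" if w: "w \<in> W" for w
  proof -
    have "L (?P n w) \<le> C * ((K + 2) * (q (w - ?P n w) + q w))" for n
    proof -
      have "L (?P n w) \<le> C * q (?P n w - w + w)" using Lq(2)[OF P] by (simp only: diff_add_cancel)
      also have "\<dots> \<le> C * ((K + 2) * (q (?P n w - w) + q w))"
        using C by (intro mult_left_mono q_triangle W_diff PW w) auto
      finally show ?thesis using q_minus_commute[OF PW w] by (simp only:)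
    qed
    moreover have "(\<lambda>n. C * ((K + 2) * (q (w - ?P n w) + q w))) \<longlonglongrightarrow> C * ((K + 2) * (0 + q w))"
      by (intro tendsto_intros q_truncate w)
    ultimately have "N w \<le> C * ((K + 2) * (0 + q w))" by (intro LIMSEQ_le[OF lim[OF w]]) auto
    then show ?thesis by (simp add: mult.assoc)
  qed
  have N_ge: "q w \<le> (K + 2) / c * N w" if w: "w \<in> W" for w
  proof -
    have "q w \<le> (K + 2) * (q (w - ?P n w) + L (?P n w) / c)" for n
    proof -
      have "q (w - ?P n w + ?P n w) \<le> (K + 2) * (q (w - ?P n w) + q (?P n w))"
        by (rule q_triangle[OF W_diff[OF w PW] PW])
      moreover have "q (?P n w) \<le> L (?P n w) / c"
        using Lq(1)[OF P] c by (simp add: pos_le_divide_eq mult.commute)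
      then have "(K + 2) * (q (w - ?P n w) + q (?P n w)) \<le> (K + 2) * (q (w - ?P n w) + L (?P n w) / c)"
        using K_nonneg by (intro mult_left_mono) auto
      ultimately show ?thesis by (simp only: diff_add_cancel)
    qed
    moreover have "(\<lambda>n. (K + 2) * (q (w - ?P n w) + L (?P n w) / c)) \<longlonglongrightarrow> (K + 2) * (0 + N w / c)"
      using c by (intro tendsto_intros q_truncate lim w) auto
    ultimately have "q w \<le> (K + 2) * (0 + N w / c)" by (intro LIMSEQ_le_const) auto
    then show ?thesis by simp
  qed
  have N_nonneg: "0 \<le> N w" if "w \<in> W" for w
    by (rule LIMSEQ_le_const[OF lim[OF that]]) (use is_norm_onD(1)[OF L P] in blast)
  have Nnorm: "is_norm_on W N"
    unfolding is_norm_on_def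
  proof (intro conjI ballI allI)
    fix w assume w: "w \<in> W"
    show "0 \<le> N w" by (rule N_nonneg[OF w])
    show "N w = 0 \<longleftrightarrow> w = 0"
    proof
      assume "N w = 0"
      then show "w = 0" using N_ge[OF w] q_nonneg[OF w] q_eq_0[OF w] by simp
    next
      assume "w = 0"
      then show "N w = 0" using N_le[OF w] N_nonneg[OF w] by simp
    qed
  next
    fix k w assume w: "w \<in> W"
    have "(\<lambda>n. L (?P n (k *\<^sub>C w))) \<longlonglongrightarrow> cmod k * N w"
      unfolding restrict_seq_scale is_norm_onD(3)[OF L P] by (intro tendsto_intros lim w)
    then show "N (k *\<^sub>C w) = cmod k * N w" using lim[OF W_scale[OF w]] LIMSEQ_unique by blast
  next
    fix v w assume v: "v \<in> W" and w: "w \<in> W"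
    have "L (?P n (v + w)) \<le> L (?P n v) + L (?P n w)" for n
      unfolding restrict_seq_add by (rule is_norm_onD(4)[OF L P P])
    then show "N (v + w) \<le> N v + N w"
      by (intro LIMSEQ_le[OF lim[OF complex_vec.subspace_add[OF W_subspace v w]] tendsto_add[OF lim[OF v] lim[OF w]]]) auto
  qed
  let ?S = "\<lparr>carr = W, nrm = N\<rparr>"
  have "is_banach ?S"
    unfolding is_banach_def
  proof (intro conjI allI impI)
    show "csubspace (carr ?S)" by (simp add: W_subspace)
    show "is_norm_on (carr ?S) (nrm ?S)" by (simp add: Nnorm)
    fix u assume u0: "\<forall>n. u n \<in> carr ?S" and cau: "cauchy_in ?S u"
    have u: "u n \<in> W" for n using u0 by simp
    have cauq: "\<exists>M. \<forall>m\<ge>M. \<forall>n\<ge>M. q (u m - u n) < e" if e: "0 < e" for e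
    proof -
      have e': "0 < e * (c / (K + 2))" using e c K_nonneg by simp
      obtain M where M: "\<forall>m\<ge>M. \<forall>n\<ge>M. N (u m - u n) < e * (c / (K + 2))"
        using cau e' unfolding cauchy_in_def by auto
      have "q (u m - u n) < e" if "m \<ge> M" "n \<ge> M" for m n
      proof -
        have "q (u m - u n) \<le> (K + 2) / c * N (u m - u n)" by (rule N_ge[OF W_diff[OF u u]])
        also have "\<dots> < (K + 2) / c * (e * (c / (K + 2)))"
          using M that c K_nonneg by (intro mult_strict_left_mono) auto
        also have "\<dots> = e" using c K_nonneg by simp
        finally show ?thesis .
      qed
      then show ?thesis by blast
    qed
    obtain y where y: "y \<in> W" "(\<lambda>n. q (u n - y)) \<longlonglongrightarrow> 0"
      using q_complete[where u = u, OF u cauq] by blast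
    have "(\<lambda>n. C * (K + 2) * q (u n - y)) \<longlonglongrightarrow> 0" using tendsto_mult_right_zero[OF y(2)] by simp
    then have "(\<lambda>n. N (u n - y)) \<longlonglongrightarrow> 0"
      by (rule tendsto_sandwich[OF always_eventually always_eventually tendsto_const, rotated 2])
        (use N_nonneg[OF W_diff[OF u y(1)]] N_le[OF W_diff[OF u y(1)]] in blast)+
    then show "\<exists>v. converges_in ?S u v" unfolding converges_in_def using y(1) by auto
  qed
  moreover have "\<exists>v\<in>c00. N (w - v) < e" if w: "w \<in> W" and e: "0 < e" for w e
  proof -
    have "(\<lambda>n. C * (K + 2) * q (w - ?P n w)) \<longlonglongrightarrow> 0" using tendsto_mult_right_zero[OF q_truncate[OF w]] by simp
    then have "\<forall>\<^sub>F n in sequentially. C * (K + 2) * q (w - ?P n w) < e" using e by (rule order_tendstoD)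
    then obtain n where "C * (K + 2) * q (w - ?P n w) < e" by (auto simp: eventually_sequentially)
    then show ?thesis using N_le[OF W_diff[OF w PW]] P by (meson le_less_trans)
  qed
  ultimately have "is_completion \<lparr>carr = c00, nrm = L\<rparr> ?S"
    unfolding is_completion_def using c00_csubspace L N_c00 c00_W
    by (auto intro!: exI[of _ "\<lambda>x. x"] simp: linear_on_space_def simp del: minus_apply)
  then show ?thesis by blast
qed

lemma c00_dense: "y \<in> W \<Longrightarrow> 0 < e \<Longrightarrow> \<exists>a\<in>c00. q (y - a) < e"
  using order_tendstoD(2)[OF q_truncate, of y e] restrict_lessThan_c00
  by (fastforce simp: eventually_sequentially)

end

section \<open>Adjoining the sum of the coefficients\<close>

definition seq_total :: "cseq \<Rightarrow> complex" where
  "seq_total a = (\<Sum>j | a j \<noteq> 0. a j)"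

lemma seq_total_eq: "\<forall>j\<ge>n. a j = 0 \<Longrightarrow> seq_total a = (\<Sum>j<n. a j)"
  unfolding seq_total_def by (intro sum.mono_neutral_left) (auto simp: not_le[symmetric])

lemma seq_total_add: assumes "a \<in> c00" "b \<in> c00" shows "seq_total (a + b) = seq_total a + seq_total b"
proof -
  obtain m n where m: "\<forall>j\<ge>m. a j = 0" and n: "\<forall>j\<ge>n. b j = 0" using assms c00_support by metis
  have a: "\<forall>j\<ge>max m n. a j = 0" and b: "\<forall>j\<ge>max m n. b j = 0" and ab: "\<forall>j\<ge>max m n. (a + b) j = 0"
    using m n by auto
  show ?thesis unfolding seq_total_eq[OF a] seq_total_eq[OF b] seq_total_eq[OF ab] by (simp add: sum.distrib)
qed

lemma seq_total_scale: assumes "a \<in> c00" shows "seq_total (c *\<^sub>C a) = c * seq_total a"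
proof -
  obtain m where a: "\<forall>j\<ge>m. a j = 0" using assms c00_support by metis
  then have ca: "\<forall>j\<ge>m. (c *\<^sub>C a) j = 0" by simp
  show ?thesis unfolding seq_total_eq[OF a] seq_total_eq[OF ca] by (simp add: sum_distrib_left)
qed

text \<open>Adding a fixed vector \<open>w \<noteq> 0\<close> to the terms of a sequence adds \<open>|seq_total a|\<close> to its spreading
  limit; \<open>augment\<close> realises the resulting norm inside the original space, using its shift.\<close>

definition augment :: "cseq \<Rightarrow> cseq" where
  "augment a = seq_total a *\<^sub>C unit_seq 0 + shift_seq a"

lemma shift_seq_add: "shift_seq (a + b) = shift_seq a + shift_seq b"
  by (auto simp: fun_eq_iff shift_seq_apply split: nat.split)

lemma shift_seq_scale: "shift_seq (c *\<^sub>C a) = c *\<^sub>C shift_seq a"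
  by (auto simp: fun_eq_iff shift_seq_apply split: nat.split)

lemma augment_linear: "linear_on_space c00 augment"
  unfolding linear_on_space_def augment_def
  by (simp add: seq_total_add seq_total_scale shift_seq_add shift_seq_scale scaleC_add_left
      scaleC_add_right scaleC_scaleC ac_simps del: plus_fun_apply)

lemma shift_c00: "a \<in> c00 \<Longrightarrow> shift_seq a \<in> c00"
  unfolding c00_support shift_seq_def
  by (metis (no_types, lifting) Suc_le_D Suc_le_mono nat.case(2))

lemma augment_c00: "a \<in> c00 \<Longrightarrow> augment a \<in> c00"
  unfolding augment_def by (intro c00_add c00_scale shift_c00 c00_unit_seq)

context quasilinear_domain
begin

lemma q_shift: "a \<in> W \<Longrightarrow> q (shift_seq a) = q a"
  by (simp add: dom_norm_def W_iff \<Phi>_shift l2norm_shift)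

text \<open>Entry 0 of \<open>augment a\<close> is the total, which coordinate evaluation recovers;
  subtracting it leaves the shift of \<open>a\<close>, with the same quasi-norm as
  \<open>a\<close>.\<close>

lemma augment_equiv:
  obtains c C where "0 < c" "0 < C"
    "\<And>a. a \<in> c00 \<Longrightarrow> c * (cmod (seq_total a) + q a) \<le> q (augment a)"
    "\<And>a. a \<in> c00 \<Longrightarrow> q (augment a) \<le> C * (cmod (seq_total a) + q a)"
proof -
  let ?e = "unit_seq 0"
  let ?u = "q ?e"
  have u: "0 \<le> ?u" by (rule q_nonneg[OF c00_W]) simp
  have eW: "t *\<^sub>C ?e \<in> W" for t by (rule W_scale[OF c00_W]) simp
  have qe: "q (t *\<^sub>C ?e) = cmod t * ?u" for t by (rule q_scale[OF c00_W]) simp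
  have up: "q (augment a) \<le> (K + 2) * (?u + 1) * (cmod (seq_total a) + q a)" if a: "a \<in> c00" for a
  proof -
    have sW: "shift_seq a \<in> W" by (rule c00_W[OF shift_c00[OF a]])
    have "q (augment a) \<le> (K + 2) * (cmod (seq_total a) * ?u + q a)"
      using q_triangle[OF eW sW, of "seq_total a"] unfolding augment_def qe q_shift[OF c00_W[OF a]] .
    also have "cmod (seq_total a) * ?u + q a \<le> (?u + 1) * (cmod (seq_total a) + q a)"
      using u q_nonneg[OF c00_W[OF a]] by (simp add: algebra_simps)
    then have "(K + 2) * (cmod (seq_total a) * ?u + q a) \<le> (K + 2) * ((?u + 1) * (cmod (seq_total a) + q a))"
      using K_nonneg by (intro mult_left_mono) auto
    finally show ?thesis by (simp add: mult.assoc)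
  qed
  have low: "cmod (seq_total a) + q a \<le> ((K + 2) * (?u + 1) + 1) * q (augment a)" if a: "a \<in> c00" for a
  proof -
    have aW: "augment a \<in> W" by (rule c00_W[OF augment_c00[OF a]])
    have "cmod (augment a 0) \<le> q (augment a)" by (rule q_coord[OF aW])
    then have t: "cmod (seq_total a) \<le> q (augment a)"
      by (simp add: augment_def unit_seq_def shift_seq_def)
    have "q a = q (augment a - seq_total a *\<^sub>C ?e)"
      unfolding augment_def q_shift[OF c00_W[OF a], symmetric] by (simp only: add_diff_cancel_left')
    also have "augment a - seq_total a *\<^sub>C ?e = augment a + (- seq_total a) *\<^sub>C ?e"
      by (simp add: fun_eq_iff)
    also have "q (augment a + (- seq_total a) *\<^sub>C ?e) \<le> (K + 2) * (q (augment a) + cmod (seq_total a) * ?u)"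
      using q_triangle[OF aW eW, of "- seq_total a"] unfolding qe by simp
    also have "\<dots> \<le> (K + 2) * (q (augment a) + q (augment a) * ?u)"
      using K_nonneg t u by (intro mult_left_mono add_left_mono mult_right_mono) auto
    finally show ?thesis using t by (simp add: algebra_simps)
  qed
  show ?thesis
  proof (rule that)
    have p: "0 < (K + 2) * (?u + 1) + 1" using K_nonneg u by (intro add_nonneg_pos mult_nonneg_nonneg) auto
    show "0 < inverse ((K + 2) * (?u + 1) + 1)" using p by simp
    show "0 < (K + 2) * (?u + 1)" using K_nonneg u by (intro mult_pos_pos) auto
    fix a assume a: "a \<in> c00"
    show "inverse ((K + 2) * (?u + 1) + 1) * (cmod (seq_total a) + q a) \<le> q (augment a)"
    proof -
      have "(cmod (seq_total a) + q a) / ((K + 2) * (?u + 1) + 1) \<le> q (augment a)"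
        using low[OF a] p by (simp only: pos_divide_le_eq mult.commute)
      then show ?thesis by (simp only: divide_inverse_commute)
    qed
    show "q (augment a) \<le> (K + 2) * (?u + 1) * (cmod (seq_total a) + q a)" by (rule up[OF a])
  qed
qed

lemma avg_null: "(\<lambda>n. q (avg_seq n)) \<longlonglongrightarrow> 0"
proof -
  have "(\<lambda>n. 1 / sqrt (real n)) \<longlonglongrightarrow> 0"
    by (intro tendsto_divide_0[OF tendsto_const] filterlim_at_top_imp_at_infinity
        filterlim_compose[OF sqrt_at_top] filterlim_real_sequentially)
  then have "(\<lambda>n. l2norm (avg_seq n)) \<longlonglongrightarrow> 0"
    by (rule Lim_transform_eventually)
      (rule eventually_mono[OF eventually_gt_at_top[of 0]], simp add: avg_seq_norm(2))
  then show ?thesis unfolding dom_norm_def by (rule tendsto_add_zero[OF \<Phi>_avg])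
qed

text \<open>Averages of unit vectors have total \<open>1\<close> and tend to \<open>0\<close>, so the total of a given sequence can
  be corrected at no cost.\<close>

lemma augment_dense:
  assumes y: "y \<in> W" and e: "0 < e"
  shows "\<exists>a\<in>c00. q (y - augment a) < e"
proof -
  define d where "d = e / (2 * (K + 2))"
  have d: "0 < d" using e K_nonneg by (simp add: d_def)
  obtain z where z: "z \<in> c00" "q (y - z) < d" using c00_dense[OF y d] by blast
  define z' where "z' = (\<lambda>j. z (Suc j))"
  have z': "z' \<in> c00" using z(1) unfolding z'_def c00_support by (meson le_SucI)
  \<comment> \<open>\<open>z'\<close> is \<open>z\<close> without its entry 0, and \<open>k\<close>
    is the amount by which its total misses that entry; a multiple of a long average supplies the
    difference.\<close>
  define k where "k = z 0 - seq_total z'"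
  have "(\<lambda>n. cmod k * q (avg_seq n)) \<longlonglongrightarrow> 0" using tendsto_mult_right_zero[OF avg_null] by simp
  then have "\<forall>\<^sub>F n in sequentially. cmod k * q (avg_seq n) < d \<and> 0 < n"
    using d by (intro eventually_conj order_tendstoD eventually_gt_at_top)
  then obtain n where n: "cmod k * q (avg_seq n) < d" "0 < n" by (auto simp: eventually_sequentially)
  define a where "a = z' + k *\<^sub>C avg_seq n"
  have a: "a \<in> c00" unfolding a_def by (intro c00_add c00_scale z' avg_seq_norm)
  have "seq_total (avg_seq n) = (\<Sum>j<n. avg_seq n j)" by (rule seq_total_eq) (simp add: avg_seq_apply)
  also have "\<dots> = 1" using n(2) by (simp add: avg_seq_apply)
  finally have "seq_total a = z 0"
    unfolding a_def using z' avg_seq_norm(1)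
    by (simp add: seq_total_add seq_total_scale c00_scale k_def del: plus_fun_apply)
  then have "augment a = z + k *\<^sub>C shift_seq (avg_seq n)"
    by (auto simp: augment_def fun_eq_iff unit_seq_def shift_seq_apply a_def z'_def split: nat.split)
  then have eq: "y - augment a = (y - z) + (- k) *\<^sub>C shift_seq (avg_seq n)" by (simp add: fun_eq_iff)
  have "q ((y - z) + (- k) *\<^sub>C shift_seq (avg_seq n)) \<le> (K + 2) * (q (y - z) + cmod k * q (avg_seq n))"
  proof -
    have s: "shift_seq (avg_seq n) \<in> W" by (intro c00_W shift_c00 avg_seq_norm)
    show ?thesis
      using q_triangle[OF W_diff[OF y c00_W[OF z(1)]] W_scale[OF s, of "- k"]]
      unfolding q_scale[OF s] q_shift[OF c00_W[OF avg_seq_norm(1)]] by simp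
  qed
  moreover have "(K + 2) * (q (y - z) + cmod k * q (avg_seq n)) < (K + 2) * (2 * d)"
    using z n K_nonneg by (intro mult_strict_left_mono) auto
  moreover have "(K + 2) * (2 * d) = e"
  proof -
    have "K + 2 \<noteq> 0" using K_nonneg by simp
    then show ?thesis unfolding d_def by (simp add: divide_simps)
  qed
  ultimately have "q (y - augment a) < e" unfolding eq by linarith
  then show ?thesis using a by blast
qed

end


section \<open>Existence of spreading limits\<close>

lemma is_norm_on_sum:
  assumes N: "is_norm_on V N" and V: "csubspace V" and v: "\<And>j. j \<in> A \<Longrightarrow> v j \<in> V"
  shows "N (\<Sum>j\<in>A. c j *\<^sub>C v j) \<le> (\<Sum>j\<in>A. cmod (c j) * N (v j))"
  using v
proof (induction A rule: infinite_finite_induct)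
  case (insert a A)
  have "N (c a *\<^sub>C v a + (\<Sum>j\<in>A. c j *\<^sub>C v j)) \<le> N (c a *\<^sub>C v a) + N (\<Sum>j\<in>A. c j *\<^sub>C v j)"
    by (intro is_norm_onD(4)[OF N] complex_vec.subspace_scale[OF V] complex_vec.subspace_sum[OF V] insert.prems) auto
  moreover have "N (c a *\<^sub>C v a) = cmod (c a) * N (v a)" by (rule is_norm_onD(3)[OF N]) (simp add: insert.prems)
  moreover have "N (\<Sum>j\<in>A. c j *\<^sub>C v j) \<le> (\<Sum>j\<in>A. cmod (c j) * N (v j))" using insert by blast
  ultimately show ?case unfolding sum.insert[OF insert(1,2)] by linarith
qed (use is_norm_onD(2)[OF N complex_vec.subspace_0[OF V]] in auto)

lemma sorted_list_of_strict_mono_image: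
  fixes h :: "nat \<Rightarrow> nat"
  assumes "strict_mono_on {..<n} h" shows "sorted_list_of_set (h ` {..<n}) = map h [0..<n]"
proof -
  have "sorted (map h [0..<n])"
    unfolding sorted_map by (rule sorted_wrt_mono_rel[OF _ sorted_wrt_upt])
      (use assms in \<open>auto simp: strict_mono_on_def intro: less_imp_le\<close>)
  moreover have "distinct (map h [0..<n])"
    using strict_mono_on_imp_inj_on[OF assms] by (simp add: distinct_map lessThan_atLeast0)
  ultimately have "sorted_list_of_set (set (map h [0..<n])) = map h [0..<n]"
    by (rule sorted_list_of_set.idem_if_sorted_distinct)
  then show ?thesis by (simp add: lessThan_atLeast0)
qed

text \<open>Tuples are coloured by the integer part of \<open>g / e\<close>, which takes finitely
  many values; on a homogeneous set the values of \<open>g\<close> differ by at most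
  \<open>e\<close>. Ramsey's theorem colours sets, so a set stands for its increasing
  enumeration.\<close>

lemma ramsey_oscillation:
  fixes g :: "nat list \<Rightarrow> real"
  assumes bound: "\<And>l. 0 \<le> g l" "\<And>l. g l \<le> T" and e: "0 < e"
  obtains r :: "nat \<Rightarrow> nat" where "strict_mono r"
    "\<And>k k'. strict_mono_on {..<n} k \<Longrightarrow> strict_mono_on {..<n} k' \<Longrightarrow>
      \<bar>g (map (r \<circ> k) [0..<n]) - g (map (r \<circ> k') [0..<n])\<bar> \<le> e"
proof -
  define f where "f X = nat \<lfloor>g (sorted_list_of_set X) / e\<rfloor>" for X
  have "f X < Suc (nat \<lfloor>T / e\<rfloor>)" for X
    unfolding f_def using bound e by (intro le_imp_less_Suc nat_mono floor_mono divide_right_mono) auto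
  then have "\<exists>Y t. Y \<subseteq> UNIV \<and> infinite Y \<and> t < Suc (nat \<lfloor>T / e\<rfloor>) \<and>
      (\<forall>X. X \<subseteq> Y \<and> finite X \<and> card X = n \<longrightarrow> f X = t)"
    by (intro Ramsey) auto
  then obtain Y t where Y: "infinite Y" and Yt: "\<forall>X. X \<subseteq> Y \<and> finite X \<and> card X = n \<longrightarrow> f X = t"
    by (elim exE conjE) (rule that)
  have t: "f X = t" if "X \<subseteq> Y" "finite X" "card X = n" for X
    using Yt[rule_format, of X] that by simp
  let ?r = "enumerate Y"
  have r: "strict_mono ?r" by (rule strict_mono_enumerate[OF Y])
  have ft: "nat \<lfloor>g (map (?r \<circ> k) [0..<n]) / e\<rfloor> = t" if k: "strict_mono_on {..<n} k" for k
  proof -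
    have rk: "strict_mono_on {..<n} (?r \<circ> k)"
      using k r by (auto simp: strict_mono_on_def strict_mono_def)
    have "f ((?r \<circ> k) ` {..<n}) = t"
    proof (rule t)
      show "(?r \<circ> k) ` {..<n} \<subseteq> Y" using enumerate_in_set[OF Y] by auto
      show "card ((?r \<circ> k) ` {..<n}) = n"
        using card_image[OF strict_mono_on_imp_inj_on[OF rk]] by simp
    qed simp
    then show ?thesis unfolding f_def sorted_list_of_strict_mono_image[OF rk] .
  qed
  have "\<bar>g (map (?r \<circ> k) [0..<n]) - g (map (?r \<circ> k') [0..<n])\<bar> \<le> e"
    if "strict_mono_on {..<n} k" "strict_mono_on {..<n} k'" for k k'
  proof -
    have b: "t \<le> g (map (?r \<circ> k) [0..<n]) / e \<and> g (map (?r \<circ> k) [0..<n]) / e \<le> t + 1"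
      if "strict_mono_on {..<n} k" for k
    proof -
      have "0 \<le> g (map (?r \<circ> k) [0..<n]) / e" using bound(1) e by simp
      then show ?thesis using ft[OF that] by linarith
    qed
    have "\<bar>g (map (?r \<circ> k) [0..<n]) / e - g (map (?r \<circ> k') [0..<n]) / e\<bar> \<le> 1"
      using b[OF that(1)] b[OF that(2)] by linarith
    then have "\<bar>g (map (?r \<circ> k) [0..<n]) - g (map (?r \<circ> k') [0..<n])\<bar> / e \<le> 1"
      using e by (simp only: diff_divide_distrib[symmetric] abs_divide abs_of_pos)
    then show ?thesis using e by simp
  qed
  then show ?thesis using that[OF r] by blast
qed

text \<open>A countable dense family of coefficient tuples; the list also records the length of the
  tuple, zeros at the end included.\<close>

definition rat_seq :: "(rat \<times> rat) list \<Rightarrow> cseq" where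
  "rat_seq l = (\<lambda>j. if j < length l then Complex (of_rat (fst (l ! j))) (of_rat (snd (l ! j))) else 0)"

lemma rat_complex_dense: fixes c :: complex assumes "0 < d"
  obtains p :: "rat \<times> rat" where "cmod (c - Complex (of_rat (fst p)) (of_rat (snd p))) < d"
proof -
  obtain u where u: "Re c - d/2 < of_rat u" "of_rat u < Re c + d/2"
    using of_rat_dense[of "Re c - d/2" "Re c + d/2"] assms by auto
  obtain v where v: "Im c - d/2 < of_rat v" "of_rat v < Im c + d/2"
    using of_rat_dense[of "Im c - d/2" "Im c + d/2"] assms by auto
  have "cmod (c - Complex (of_rat u) (of_rat v)) \<le> \<bar>Re c - of_rat u\<bar> + \<bar>Im c - of_rat v\<bar>"
    using cmod_le[of "c - Complex (of_rat u) (of_rat v)"] by simp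
  also have "\<dots> < d" using u v by (simp add: abs_if split: if_splits) 
  finally show ?thesis using that[of "(u, v)"] by simp
qed

lemma rat_seq_dense:
  assumes "0 < d" obtains l where "length l = n" "\<And>j. j < n \<Longrightarrow> cmod (a j - rat_seq l j) < d"
proof -
  have "\<forall>j. \<exists>p :: rat \<times> rat. cmod (a j - Complex (of_rat (fst p)) (of_rat (snd p))) < d"
    using rat_complex_dense[OF assms] by metis
  then obtain p :: "nat \<Rightarrow> rat \<times> rat" where "\<And>j. cmod (a j - Complex (of_rat (fst (p j))) (of_rat (snd (p j)))) < d"
    by metis
  then show ?thesis by (intro that[of "map p [0..<n]"]) (auto simp: rat_seq_def)
qed

text \<open>For one rational tuple and one precision, Ramsey's theorem gives a subsequence along
  which all norms nearly agree. A diagonal sequence meets these countably many demands at once, and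
  density of the rational tuples extends the conclusion to all coefficients.\<close>

lemma brunel_sucheston:
  fixes x :: "nat \<Rightarrow> 'v::complex_vec" and Y :: "'v nspace"
  assumes N: "is_norm_on (carr Y) (nrm Y)" and V: "csubspace (carr Y)"
    and x: "\<And>j. x j \<in> carr Y" and M: "\<And>j. nrm Y (x j) \<le> M"
  obtains r :: "nat \<Rightarrow> nat" and L where "strict_mono r" "spreading_limit Y (x \<circ> r) L"
proof -
  let ?N = "nrm Y"
  have M0: "0 \<le> M" using is_norm_onD(1)[OF N x] M order_trans by blast
  define S where "S s a n k = ?N (\<Sum>j<n. a j *\<^sub>C x (s (k j)))" for s :: "nat \<Rightarrow> nat" and a :: cseq and n and k :: "nat \<Rightarrow> nat"
  \<comment> \<open>The demands are numbered by \<open>from_nat\<close>: a precision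
    \<open>inverse (Suc m)\<close> and a rational tuple, whose length fixes the number of
    vectors.\<close>
  define P where "P i s \<longleftrightarrow> (case from_nat i of (m :: nat, l) \<Rightarrow>
      \<forall>k k'. strict_mono_on {..<length l} k \<longrightarrow> strict_mono_on {..<length l} k' \<longrightarrow>
        \<bar>S s (rat_seq l) (length l) k - S s (rat_seq l) (length l) k'\<bar> \<le> inverse (Suc m))" for i s
  have Smem: "(\<Sum>j<n. a j *\<^sub>C x (s (k j))) \<in> carr Y" for s a n and k :: "nat \<Rightarrow> nat"
    by (intro complex_vec.subspace_sum[OF V] complex_vec.subspace_scale[OF V] x)
  interpret subseqs P
  proof
    fix i and s :: "nat \<Rightarrow> nat" assume s: "strict_mono s"
    obtain m :: nat and l where ml: "(from_nat i :: nat \<times> (rat \<times> rat) list) = (m, l)" by (cases "from_nat i :: nat \<times> (rat \<times> rat) list")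
    let ?n = "length l"
    define g where "g ks = (if length ks = ?n then ?N (\<Sum>j<?n. rat_seq l j *\<^sub>C x (s (ks ! j))) else 0)" for ks
    have g0: "0 \<le> g ks" for ks
      unfolding g_def
      using is_norm_onD(1)[OF N Smem[where a = "rat_seq l" and n = ?n and s = s and k = "\<lambda>j. ks ! j"]] by simp
    have gT: "g ks \<le> (\<Sum>j<?n. cmod (rat_seq l j) * M)" for ks
    proof -
      have "?N (\<Sum>j<?n. rat_seq l j *\<^sub>C x (s (ks ! j))) \<le> (\<Sum>j<?n. cmod (rat_seq l j) * ?N (x (s (ks ! j))))"
        by (rule is_norm_on_sum[OF N V x])
      also have "\<dots> \<le> (\<Sum>j<?n. cmod (rat_seq l j) * M)" by (intro sum_mono mult_left_mono M) auto
      finally show ?thesis unfolding g_def using M0 by (simp add: sum_nonneg)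
    qed
    have "0 < inverse (real (Suc m))" by simp
    then obtain r :: "nat \<Rightarrow> nat" where r: "strict_mono r"
      "\<And>k k'. strict_mono_on {..<?n} k \<Longrightarrow> strict_mono_on {..<?n} k' \<Longrightarrow>
        \<bar>g (map (r \<circ> k) [0..<?n]) - g (map (r \<circ> k') [0..<?n])\<bar> \<le> inverse (Suc m)"
      by (rule ramsey_oscillation[OF g0 gT]) (rule that)
    have "g (map (r \<circ> k) [0..<?n]) = S (s \<circ> r) (rat_seq l) ?n k" for k
      unfolding g_def S_def by simp
    then show "\<exists>r'. strict_mono r' \<and> P i (s \<circ> r')" using r unfolding P_def ml by auto
  qed
  define D where "D = diagseq"
  have D: "strict_mono D" unfolding D_def by (rule subseq_diagseq)
  have stable: "P i (s \<circ> r)" if "strict_mono r" "P i s" for r s i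
  proof -
    obtain m :: nat and l where ml: "(from_nat i :: nat \<times> (rat \<times> rat) list) = (m, l)" by (cases "from_nat i :: nat \<times> (rat \<times> rat) list")
    have "strict_mono_on {..<length l} (r \<circ> k)" if "strict_mono_on {..<length l} k" for k
      using that \<open>strict_mono r\<close> by (auto simp: strict_mono_on_def strict_mono_def)
    moreover have "S (s \<circ> r) a n k = S s a n (r \<circ> k)" for a n k unfolding S_def by simp
    ultimately show ?thesis using that(2) unfolding P_def ml by auto
  qed
  have osc: "\<exists>\<nu>. \<forall>k k'. strict_mono_on {..<n} k \<and> (\<forall>j<n. \<nu> \<le> k j) \<and> strict_mono_on {..<n} k' \<and> (\<forall>j<n. \<nu> \<le> k' j)
      \<longrightarrow> \<bar>S D a n k - S D a n k'\<bar> < e" if e: "0 < e" for a n e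
  proof -
    \<comment> \<open>Replacing \<open>a\<close> by a rational tuple within \<open>d\<close> changes
      the norm by at most \<open>d * (n * M)\<close>, hence by at most \<open>e / 3\<close>; the
      added 1 keeps the denominator positive when \<open>n\<close> or \<open>M\<close> is 0.\<close>
    define d where "d = e / (3 * (real n * M + 1))"
    have nM: "0 < real n * M + 1" using M0 by (intro add_nonneg_pos) auto
    have d: "0 < d" unfolding d_def using e nM by simp
    obtain l where l: "length l = n" "\<And>j. j < n \<Longrightarrow> cmod (a j - rat_seq l j) < d" using rat_seq_dense[OF d] by blast
    obtain m where m: "inverse (real (Suc m)) < e / 3" using reals_Archimedean[of "e/3"] e by auto
    define i where "i = to_nat (m, l)"
    \<comment> \<open>Past its first \<open>Suc i\<close> terms the diagonal sequence is a
      subsequence of the one that meets demand \<open>i\<close>. This is where the threshold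
      \<open>Suc i\<close> on the indices comes from.\<close>
    have "P i (diagseq \<circ> (+) (Suc i))" by (rule diagseq_holds[OF stable])
    then have Pi: "\<bar>S (D \<circ> (+) (Suc i)) (rat_seq l) n k - S (D \<circ> (+) (Suc i)) (rat_seq l) n k'\<bar> \<le> inverse (Suc m)"
      if "strict_mono_on {..<n} k" "strict_mono_on {..<n} k'" for k k'
      using that unfolding P_def i_def D_def by (simp add: l(1))
    have close: "\<bar>S D a n k - S D (rat_seq l) n k\<bar> \<le> e / 3" for k
    proof -
      have "S D a n k \<le> S D b n k + (\<Sum>j<n. cmod (a j - b j) * M)" for a b :: cseq
      proof -
        have "S D a n k = ?N ((\<Sum>j<n. b j *\<^sub>C x (D (k j))) + (\<Sum>j<n. (a j - b j) *\<^sub>C x (D (k j))))"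
          unfolding S_def by (simp add: sum.distrib[symmetric] scaleC_add_left[symmetric])
        also have "\<dots> \<le> S D b n k + ?N (\<Sum>j<n. (a j - b j) *\<^sub>C x (D (k j)))"
          unfolding S_def by (rule is_norm_onD(4)[OF N Smem Smem])
        also have "?N (\<Sum>j<n. (a j - b j) *\<^sub>C x (D (k j))) \<le> (\<Sum>j<n. cmod (a j - b j) * ?N (x (D (k j))))"
          by (rule is_norm_on_sum[OF N V x])
        also have "\<dots> \<le> (\<Sum>j<n. cmod (a j - b j) * M)" by (intro sum_mono mult_left_mono M) auto
        finally show ?thesis by simp
      qed
      from this[of a "rat_seq l"] this[of "rat_seq l" a]
      have "\<bar>S D a n k - S D (rat_seq l) n k\<bar> \<le> (\<Sum>j<n. cmod (a j - rat_seq l j) * M)"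
        by (simp add: norm_minus_commute abs_le_iff)
      also have "\<dots> \<le> (\<Sum>j<n. d * M)" using l(2) M0 by (intro sum_mono mult_right_mono) (auto intro: less_imp_le)
      also have "\<dots> = d * (real n * M)" by simp
      also have "\<dots> \<le> d * (real n * M + 1)" using d by simp
      also have "\<dots> = e / 3" unfolding d_def using nM by (simp add: divide_simps)
      finally show ?thesis .
    qed
    have "\<bar>S D a n k - S D a n k'\<bar> < e" if k: "strict_mono_on {..<n} k" "\<forall>j<n. Suc i \<le> k j"
      "strict_mono_on {..<n} k'" "\<forall>j<n. Suc i \<le> k' j" for k k'
    proof -
      let ?k = "\<lambda>j. k j - Suc i" and ?k' = "\<lambda>j. k' j - Suc i"
      have "S D (rat_seq l) n k = S (D \<circ> (+) (Suc i)) (rat_seq l) n ?k"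
        unfolding S_def using k by (auto intro!: arg_cong[where f = ?N] sum.cong)
      moreover have "S D (rat_seq l) n k' = S (D \<circ> (+) (Suc i)) (rat_seq l) n ?k'"
        unfolding S_def using k by (auto intro!: arg_cong[where f = ?N] sum.cong)
      moreover have "strict_mono_on {..<n} ?k" "strict_mono_on {..<n} ?k'"
        using k by (auto simp: strict_mono_on_def intro!: diff_less_mono)
      ultimately have "\<bar>S D (rat_seq l) n k - S D (rat_seq l) n k'\<bar> \<le> inverse (Suc m)" using Pi by simp
      then show ?thesis using close[of k] close[of k'] m by linarith
    qed
    then show ?thesis by blast
  qed
  \<comment> \<open>\<open>L\<close> must depend on \<open>a\<close> alone, whereas a spreading
    limit is tested with every length that covers the support. The least such length is used; longer
    tuples only add zero coefficients.\<close>
  define n0 where "n0 a = (LEAST n. \<forall>j\<ge>n. a j = 0)" for a :: cseq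
  define L where "L a = lim (\<lambda>i. S D a (n0 a) (\<lambda>j. i + j))" for a
  have "spreading_limit Y (x \<circ> D) L"
    unfolding spreading_limit_def
  proof (intro allI impI)
    fix n and a :: cseq and e :: real assume a: "\<forall>j\<ge>n. a j = 0" and e: "0 < e"
    let ?n = "n0 a"
    have n0: "\<forall>j\<ge>?n. a j = 0" unfolding n0_def by (rule LeastI[of _ n]) (use a in blast)
    have le: "?n \<le> n" unfolding n0_def by (rule Least_le) (use a in blast)
    let ?s = "\<lambda>i. S D a ?n (\<lambda>j. i + j)"
    have sm: "strict_mono_on {..<?n} (\<lambda>j. i + j)" for i :: nat by (auto simp: strict_mono_on_def)
    have "Cauchy ?s"
    proof (rule metric_CauchyI)
      fix e :: real assume "0 < e"
      from osc[OF this, of ?n a] obtain \<nu> where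
        \<nu>: "\<forall>k k'. strict_mono_on {..<?n} k \<and> (\<forall>j<?n. \<nu> \<le> k j) \<and> strict_mono_on {..<?n} k' \<and> (\<forall>j<?n. \<nu> \<le> k' j)
          \<longrightarrow> \<bar>S D a ?n k - S D a ?n k'\<bar> < e" ..
      have "dist (?s i) (?s i') < e" if "i \<ge> \<nu>" "i' \<ge> \<nu>" for i i'
      proof -
        have "\<forall>j<?n. \<nu> \<le> i + j" "\<forall>j<?n. \<nu> \<le> i' + j" using that by (simp_all add: trans_le_add1)
        then show ?thesis
          unfolding dist_real_def using \<nu>[rule_format, of "\<lambda>j. i + j" "\<lambda>j. i' + j"] sm by simp
      qed
      then show "\<exists>M. \<forall>m\<ge>M. \<forall>n\<ge>M. dist (?s m) (?s n) < e" by (intro exI[of _ \<nu>]) simp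
    qed
    then have lim: "?s \<longlonglongrightarrow> L a" unfolding L_def by (simp add: Cauchy_convergent convergent_LIMSEQ_iff[symmetric])
    from osc[OF half_gt_zero[OF e], of ?n a] obtain \<nu> where
      \<nu>: "\<forall>k k'. strict_mono_on {..<?n} k \<and> (\<forall>j<?n. \<nu> \<le> k j) \<and> strict_mono_on {..<?n} k' \<and> (\<forall>j<?n. \<nu> \<le> k' j)
        \<longrightarrow> \<bar>S D a ?n k - S D a ?n k'\<bar> < e / 2" ..
    have "\<bar>nrm Y (\<Sum>j<n. a j *\<^sub>C (x \<circ> D) (k j)) - L a\<bar> < e" if k: "strict_mono_on {..<n} k" "\<forall>j<n. \<nu> \<le> k j" for k
    proof -
      have eq: "nrm Y (\<Sum>j<n. a j *\<^sub>C (x \<circ> D) (k j)) = S D a ?n k"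
        unfolding S_def o_def using le n0
        by (intro arg_cong[where f = ?N] sum.mono_neutral_right) (auto simp: not_less)
      have kn: "strict_mono_on {..<?n} k" "\<forall>j<?n. \<nu> \<le> k j"
        using k le by (auto simp: strict_mono_on_def)
      have "(\<lambda>i. \<bar>S D a ?n k - ?s i\<bar>) \<longlonglongrightarrow> \<bar>S D a ?n k - L a\<bar>" by (intro tendsto_intros lim)
      moreover have "\<forall>i\<ge>\<nu>. \<bar>S D a ?n k - ?s i\<bar> \<le> e / 2"
      proof (intro allI impI)
        fix i assume "\<nu> \<le> i"
        then have "\<forall>j<?n. \<nu> \<le> i + j" by (simp add: trans_le_add1)
        then show "\<bar>S D a ?n k - ?s i\<bar> \<le> e / 2"
          using \<nu>[rule_format, of k "\<lambda>j. i + j"] kn sm by (simp add: less_imp_le)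
      qed
      ultimately have "\<bar>S D a ?n k - L a\<bar> \<le> e / 2" by (intro LIMSEQ_le_const2) blast+
      then show ?thesis unfolding eq using e by simp
    qed
    then show "\<exists>\<nu>. \<forall>k. strict_mono_on {..<n} k \<and> (\<forall>j<n. \<nu> \<le> k j) \<longrightarrow>
        \<bar>nrm Y (\<Sum>j<n. a j *\<^sub>C (x \<circ> D) (k j)) - L a\<bar> < e" by blast
  qed
  then show ?thesis using that D by blast
qed


section \<open>Isomorphisms and spreading limits\<close>

lemma isomorphic_trans:
  assumes YW: "Y \<simeq>\<^sub>B W" and WX: "W \<simeq>\<^sub>B X" shows "Y \<simeq>\<^sub>B X"
proof -
  obtain f where f: "linear_on_space (carr Y) f" "bij_betw f (carr Y) (carr W)"
      "equivalent_on (carr Y) (nrm Y) (\<lambda>v. nrm W (f v))"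
    using YW unfolding isomorphic_def by blast
  obtain g where g: "linear_on_space (carr W) g" "bij_betw g (carr W) (carr X)"
      "equivalent_on (carr W) (nrm W) (\<lambda>v. nrm X (g v))"
    using WX unfolding isomorphic_def by blast
  have fW: "f v \<in> carr W" if "v \<in> carr Y" for v using f(2) that by (rule bij_betw_apply)
  have "linear_on_space (carr Y) (g \<circ> f)"
    using f(1) g(1) fW unfolding linear_on_space_def by simp
  moreover have "bij_betw (g \<circ> f) (carr Y) (carr X)" using f(2) g(2) by (rule bij_betw_trans)
  moreover have "equivalent_on (carr Y) (nrm Y) (\<lambda>v. nrm X ((g \<circ> f) v))"
  proof -
    obtain c C where c: "0 < c" "0 < C" "\<forall>v\<in>carr Y. c * nrm Y v \<le> nrm W (f v) \<and> nrm W (f v) \<le> C * nrm Y v"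
      using f(3) unfolding equivalent_on_def by blast
    obtain d D where d: "0 < d" "0 < D" "\<forall>w\<in>carr W. d * nrm W w \<le> nrm X (g w) \<and> nrm X (g w) \<le> D * nrm W w"
      using g(3) unfolding equivalent_on_def by blast
    have "d * c * nrm Y v \<le> nrm X (g (f v)) \<and> nrm X (g (f v)) \<le> D * C * nrm Y v" if v: "v \<in> carr Y" for v
    proof -
      have 1: "c * nrm Y v \<le> nrm W (f v)" "nrm W (f v) \<le> C * nrm Y v" using c v by blast+
      have 2: "d * nrm W (f v) \<le> nrm X (g (f v))" "nrm X (g (f v)) \<le> D * nrm W (f v)" using d fW[OF v] by blast+
      show ?thesis
        using mult_left_mono[OF 1(1) less_imp_le[OF d(1)]] mult_left_mono[OF 1(2) less_imp_le[OF d(2)]] 2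
        unfolding mult.assoc by linarith
    qed
    then show ?thesis unfolding equivalent_on_def
      using c d by (intro exI[of _ "d * c"] exI[of _ "D * C"] conjI) (auto intro: mult_pos_pos)
  qed
  ultimately show ?thesis unfolding isomorphic_def by blast
qed

section \<open>Identification of \<open>ell_M\<close> with the domain of the Kalton-Peck map\<close>

lemma fst_scaleC [simp]: "fst (c *\<^sub>C p) = c *\<^sub>C fst p"
  by (simp add: scaleC_prod_def)

lemma snd_scaleC [simp]: "snd (c *\<^sub>C p) = c *\<^sub>C snd p"
  by (simp add: scaleC_prod_def)

lemma cspan_pairs:
  "cspan (range (\<lambda>j. (0 :: cseq, unit_seq j))) = {(0, b) | b. b \<in> c00}"
proof
  show "cspan (range (\<lambda>j. (0 :: cseq, unit_seq j))) \<subseteq> {(0, b) | b. b \<in> c00}"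
  proof (rule complex_vec.span_minimal)
    show "csubspace {(0 :: cseq, b) | b. b \<in> c00}"
    proof (rule complex_vec.subspaceI)
      show "0 \<in> {(0 :: cseq, b) | b. b \<in> c00}" by (simp add: zero_prod_def)
      show "x + y \<in> {(0, b) | b. b \<in> c00}" if "x \<in> {(0 :: cseq, b) | b. b \<in> c00}" "y \<in> {(0, b) | b. b \<in> c00}" for x y
        using that by (auto intro: c00_add simp del: plus_fun_apply)
      show "c *\<^sub>C x \<in> {(0, b) | b. b \<in> c00}" if "x \<in> {(0 :: cseq, b) | b. b \<in> c00}" for c x
        using that by (auto intro: c00_scale simp: scaleC_prod_def)
    qed
  qed auto
  show "{(0, b) | b. b \<in> c00} \<subseteq> cspan (range (\<lambda>j. (0 :: cseq, unit_seq j)))"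
  proof
    fix p :: "cseq \<times> cseq" assume "p \<in> {(0, b) | b. b \<in> c00}"
    then obtain b where p: "p = (0, b)" "b \<in> c00" by blast
    then obtain n where n: "\<forall>j\<ge>n. b j = 0" using c00_support by auto
    have "p = (\<Sum>j<n. b j *\<^sub>C (0 :: cseq, unit_seq j))"
    proof (rule prod_eqI)
      show "fst p = fst (\<Sum>j<n. b j *\<^sub>C (0 :: cseq, unit_seq j))"
        unfolding p(1) fst_sum fst_scaleC fst_conv by simp
      show "snd p = snd (\<Sum>j<n. b j *\<^sub>C (0 :: cseq, unit_seq j))"
        unfolding p(1) snd_sum snd_scaleC snd_conv by (rule unit_seq_expansion[OF n])
    qed
    also have "\<dots> \<in> cspan (range (\<lambda>j. (0 :: cseq, unit_seq j)))"
      by (intro complex_vec.span_sum complex_vec.span_scale complex_vec.span_base) auto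
    finally show "p \<in> cspan (range (\<lambda>j. (0 :: cseq, unit_seq j)))" .
  qed
qed

text \<open>The span consists of pairs with first entry 0, and so does its closure, because
  coordinates of the first entry are continuous on \<open>Z2\<close>. For the converse, such a pair
  is approximated by truncating its second entry.\<close>

lemma ell_M_carr: "carr ell_M = {(0, y) | y. y \<in> carr (dom_space kalton_peck)}"
proof
  have nz: "nrm Z2 p = l2norm (fst p - kalton_peck (snd p)) + l2norm (snd p)" for p
    by (simp add: Z2_def twisted_ell2_def split: prod.split)
  have Z2: "p \<in> carr Z2 \<longleftrightarrow> snd p \<in> carr ell2 \<and> fst p - kalton_peck (snd p) \<in> carr ell2" for p
    by (simp add: Z2_def twisted_ell2_def split: prod.split)
  show "carr ell_M \<subseteq> {(0, y) | y. y \<in> carr (dom_space kalton_peck)}"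
  proof
    fix p assume p: "p \<in> carr ell_M"
    obtain x y where xy: "p = (x, y)" by (cases p)
    have mem: "y \<in> carr ell2" "x - kalton_peck y \<in> carr ell2"
      and approx: "\<And>e. 0 < e \<Longrightarrow> \<exists>b\<in>c00. nrm Z2 (p - (0, b)) < e"
      using p unfolding ell_M_def closed_span_def cspan_pairs by (auto simp: Z2 xy)
    have "x j = 0" for j
    proof (rule ccontr)
      assume "x j \<noteq> 0"
      \<comment> \<open>A quarter suffices because \<open>|x j|\<close> is at most
        \<open>l2norm (x - kalton_peck (y - b)) + 2 * l2norm (y - b)\<close>, twice the quasi-norm
        of the difference.\<close>
      then have "0 < cmod (x j) / 4" by simp
      then obtain b where b: "b \<in> c00" "nrm Z2 (p - (0, b)) < cmod (x j) / 4" using approx by blast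
      have yb: "y - b \<in> carr ell2" using mem b c00_ell2 ell2_diff by blast
      have xk: "x - kalton_peck (y - b) \<in> carr ell2"
      proof -
        have b': "- b \<in> carr ell2" using b(1) c00_ell2 ell2_minus by blast
        have Kb: "kalton_peck (- b) \<in> carr ell2"
          using kalton_peck_c00[OF c00_scale[OF b(1), of "-1"]] c00_ell2 by (simp add: scaleC_minus1)
        have "x - kalton_peck (y - b) = (x - kalton_peck y) - kalton_peck (- b)
          - (kalton_peck (y + - b) - kalton_peck y - kalton_peck (- b))" by (simp add: fun_eq_iff)
        also have "\<dots> \<in> carr ell2"
          by (intro ell2_diff[OF ell2_diff[OF mem(2) Kb] ell2_le_mem[OF kalton_peck_quasi_additive[OF mem(1) b']]])
        finally show ?thesis .
      qed
      have n: "l2norm (x - kalton_peck (y - b)) + l2norm (y - b) < cmod (x j) / 4"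
        using b(2) unfolding nz xy by simp
      have "cmod (x j - kalton_peck (y - b) j) \<le> l2norm (x - kalton_peck (y - b))"
        using l2norm_coord[OF xk, of j] by simp
      moreover have "cmod (kalton_peck (y - b) j) \<le> 2 * l2norm (y - b)" by (rule kalton_peck_coord[OF yb])
      moreover have "cmod (x j) \<le> cmod (x j - kalton_peck (y - b) j) + cmod (kalton_peck (y - b) j)"
        using norm_triangle_ineq[of "x j - kalton_peck (y - b) j" "kalton_peck (y - b) j"] by simp
      moreover have "0 \<le> l2norm (x - kalton_peck (y - b))" using xk by simp
      ultimately show False using n \<open>0 < cmod (x j) / 4\<close> by linarith
    qed
    then have "x = 0" by (simp add: fun_eq_iff)
    moreover have "kalton_peck y \<in> carr ell2" using ell2_minus[OF mem(2)] \<open>x = 0\<close> by simp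
    ultimately show "p \<in> {(0, y) | y. y \<in> carr (dom_space kalton_peck)}"
      using xy mem(1) kp.W_iff by auto
  qed
  show "{(0, y) | y. y \<in> carr (dom_space kalton_peck)} \<subseteq> carr ell_M"
  proof
    fix p :: "cseq \<times> cseq" assume "p \<in> {(0, y) | y. y \<in> carr (dom_space kalton_peck)}"
    then obtain y where y: "p = (0, y)" "y \<in> carr (dom_space kalton_peck)" by blast
    have "p \<in> carr Z2" using y ell2_minus by (auto simp: Z2 kp.W_iff)
    moreover have "\<exists>u\<in>cspan (range (\<lambda>j. (0 :: cseq, unit_seq j))). nrm Z2 (p - u) < e" if e: "0 < e" for e
    proof -
      obtain b where b: "b \<in> c00" "dom_norm kalton_peck (y - b) < e" using kp.c00_dense[OF y(2) e] by blast
      have "nrm Z2 (p - (0, b)) = dom_norm kalton_peck (y - b)"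
        unfolding nz y(1) dom_norm_def by (simp add: l2norm_minus)
      then show ?thesis unfolding cspan_pairs using b by auto
    qed
    ultimately show "p \<in> carr ell_M" unfolding ell_M_def closed_span_def by simp
  qed
qed

lemma dom_space_kalton_peck_isomorphic: "dom_space kalton_peck \<simeq>\<^sub>B ell_M"
  unfolding isomorphic_def
proof (intro exI conjI)
  show "linear_on_space (carr (dom_space kalton_peck)) (\<lambda>y. (0 :: cseq, y))"
    by (simp add: linear_on_space_def scaleC_prod_def)
  show "bij_betw (\<lambda>y. (0 :: cseq, y)) (carr (dom_space kalton_peck)) (carr ell_M)"
    unfolding ell_M_carr bij_betw_def by (auto intro: inj_onI)
  have "nrm ell_M (0, y) = nrm (dom_space kalton_peck) y" for y
    by (simp add: ell_M_def closed_span_def Z2_def twisted_ell2_def dom_space_def dom_norm_def l2norm_minus)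
  then show "equivalent_on (carr (dom_space kalton_peck)) (nrm (dom_space kalton_peck)) (\<lambda>y. nrm ell_M (0, y))"
    unfolding equivalent_on_def by (intro exI[of _ "1::real"] conjI ballI) simp_all
qed

text \<open>All late tuples are tested, so \<open>L\<close> can be computed along consecutive terms
  of any subsequence \<open>\<rho>\<close>. Later passages to subsequences therefore leave
  \<open>L\<close> unchanged.\<close>

lemma spreading_limit_tendsto:
  assumes L: "spreading_limit Y x L" and a: "\<forall>j\<ge>n. a j = 0" and \<rho>: "strict_mono \<rho>"
  shows "(\<lambda>i. nrm Y (\<Sum>j<n. a j *\<^sub>C x (\<rho> (i + j)))) \<longlonglongrightarrow> L a"
proof (rule LIMSEQ_I)
  fix e :: real assume "0 < e"
  from L[unfolded spreading_limit_def, THEN spec, THEN spec, THEN mp, OF a, THEN spec, THEN mp, OF this]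
  obtain \<nu> where \<nu>: "\<forall>k. strict_mono_on {..<n} k \<and> (\<forall>j<n. \<nu> \<le> k j) \<longrightarrow>
      \<bar>nrm Y (\<Sum>j<n. a j *\<^sub>C x (k j)) - L a\<bar> < e" ..
  have "norm (nrm Y (\<Sum>j<n. a j *\<^sub>C x (\<rho> (i + j))) - L a) < e" if i: "i \<ge> \<nu>" for i
  proof -
    have "strict_mono_on {..<n} (\<lambda>j. \<rho> (i + j))" using \<rho> by (auto simp: strict_mono_on_def strict_mono_def)
    moreover have "\<forall>j<n. \<nu> \<le> \<rho> (i + j)"
      using i seq_suble[OF \<rho>] by (meson le_add1 order_trans)
    ultimately show ?thesis using \<nu>[rule_format, of "\<lambda>j. \<rho> (i + j)"] by simp
  qed
  then show "\<exists>no. \<forall>i\<ge>no. norm (nrm Y (\<Sum>j<n. a j *\<^sub>C x (\<rho> (i + j))) - L a) < e" by blast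
qed

text \<open>A limit of seminorms is a seminorm; definiteness is the property that can be lost, and
  in the application a lower estimate supplies it.\<close>

lemma spreading_limit_norm:
  assumes N: "is_norm_on (carr Y) (nrm Y)" and V: "csubspace (carr Y)" and x: "\<And>j. x j \<in> carr Y"
    and L: "spreading_limit Y x L" and pos: "\<And>a. a \<in> c00 \<Longrightarrow> L a = 0 \<Longrightarrow> a = 0"
  shows "is_norm_on c00 L"
proof -
  have sm: "strict_mono (\<lambda>i::nat. i)" by (simp add: strict_mono_def)
  note lim = spreading_limit_tendsto[OF L _ sm]
  have mem: "(\<Sum>j<n. a j *\<^sub>C x (i + j)) \<in> carr Y" for a :: cseq and i n
    by (intro complex_vec.subspace_sum[OF V] complex_vec.subspace_scale[OF V] x)
  have nonneg: "0 \<le> L a" if "a \<in> c00" for a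
  proof -
    obtain n where n: "\<forall>j\<ge>n. a j = 0" using \<open>a \<in> c00\<close> c00_support by auto
    show ?thesis by (rule LIMSEQ_le_const[OF lim[OF n]]) (use is_norm_onD(1)[OF N mem] in blast)
  qed
  have scale: "L (c *\<^sub>C a) = cmod c * L a" if "a \<in> c00" for a c
  proof -
    obtain n where n: "\<forall>j\<ge>n. a j = 0" using \<open>a \<in> c00\<close> c00_support by auto
    have cn: "\<forall>j\<ge>n. (c *\<^sub>C a) j = 0" using n by simp
    have "nrm Y (\<Sum>j<n. (c *\<^sub>C a) j *\<^sub>C x (i + j)) = cmod c * nrm Y (\<Sum>j<n. a j *\<^sub>C x (i + j))" for i
    proof -
      have "(\<Sum>j<n. (c *\<^sub>C a) j *\<^sub>C x (i + j)) = c *\<^sub>C (\<Sum>j<n. a j *\<^sub>C x (i + j))"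
        by (simp add: scaleC_sum_right scaleC_scaleC)
      then show ?thesis using is_norm_onD(3)[OF N mem] by simp
    qed
    then have "(\<lambda>i. nrm Y (\<Sum>j<n. (c *\<^sub>C a) j *\<^sub>C x (i + j))) \<longlonglongrightarrow> cmod c * L a"
      using tendsto_mult_left[OF lim[OF n], of "cmod c"] by simp
    then show ?thesis using lim[OF cn] LIMSEQ_unique by blast
  qed
  have add: "L (a + b) \<le> L a + L b" if "a \<in> c00" "b \<in> c00" for a b
  proof -
    obtain m m' where m: "\<forall>j\<ge>m. a j = 0" "\<forall>j\<ge>m'. b j = 0" using \<open>a \<in> c00\<close> \<open>b \<in> c00\<close> c00_support by metis
    let ?n = "max m m'"
    have n: "\<forall>j\<ge>?n. a j = 0" "\<forall>j\<ge>?n. b j = 0" "\<forall>j\<ge>?n. (a + b) j = 0" using m by auto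
    have "nrm Y (\<Sum>j<?n. (a + b) j *\<^sub>C x (i + j)) \<le> nrm Y (\<Sum>j<?n. a j *\<^sub>C x (i + j)) + nrm Y (\<Sum>j<?n. b j *\<^sub>C x (i + j))" for i
    proof -
      have "(\<Sum>j<?n. (a + b) j *\<^sub>C x (i + j)) = (\<Sum>j<?n. a j *\<^sub>C x (i + j)) + (\<Sum>j<?n. b j *\<^sub>C x (i + j))"
        by (simp add: scaleC_add_left sum.distrib)
      then show ?thesis using is_norm_onD(4)[OF N mem mem] by simp
    qed
    then show ?thesis by (intro LIMSEQ_le[OF lim[OF n(3)] tendsto_add[OF lim[OF n(1)] lim[OF n(2)]]]) auto
  qed
  have "L 0 = 0" using scale[OF c00_0, of 0] by simp
  then show ?thesis unfolding is_norm_on_def using nonneg scale add pos by auto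
qed


section \<open>Renormings of the twisted sum\<close>

lemma l2norm_le_l1:
  assumes x: "\<forall>j\<ge>m. x j = 0" shows "l2norm x \<le> (\<Sum>j<m. cmod (x j))"
proof -
  have "(l2norm x)\<^sup>2 = (L2_set (\<lambda>j. cmod (x j)) {..<m})\<^sup>2"
    unfolding l2norm_finite(2)[OF x] L2_set_def by (simp add: sum_nonneg)
  then have "l2norm x = L2_set (\<lambda>j. cmod (x j)) {..<m}"
    using l2norm_nonneg[OF l2norm_finite(1)[OF x]] by (simp add: power2_eq_iff_nonneg)
  also have "\<dots> \<le> (\<Sum>j<m. cmod (x j))" by (rule L2_set_le_sum) simp
  finally show ?thesis .
qed

definition restrict_pair :: "nat set \<Rightarrow> cseq \<times> cseq \<Rightarrow> cseq \<times> cseq" where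
  "restrict_pair A p = (restrict_seq A (fst p), restrict_seq A (snd p))"

lemma fst_restrict_pair [simp]: "fst (restrict_pair A p) = restrict_seq A (fst p)"
  and snd_restrict_pair [simp]: "snd (restrict_pair A p) = restrict_seq A (snd p)"
  by (simp_all add: restrict_pair_def)

text \<open>Successive finite supports. The condition that \<open>I i\<close> lies in
  \<open>{i..}\<close> ties the index of a block to its position, so that \<open>n\<close> blocks
  with indices at least \<open>n\<close> form an admissible family.\<close>

definition block_sets :: "(nat \<Rightarrow> nat set) \<Rightarrow> bool" where
  "block_sets I \<longleftrightarrow> (\<forall>i. finite (I i) \<and> I i \<noteq> {} \<and> (\<forall>a\<in>I i. i \<le> a)) \<and>
     (\<forall>i j a b. i < j \<longrightarrow> a \<in> I i \<longrightarrow> b \<in> I j \<longrightarrow> a < b)"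

lemma block_sets_disjoint: "block_sets I \<Longrightarrow> i \<noteq> j \<Longrightarrow> I i \<inter> I j = {}"
  unfolding block_sets_def by (metis disjoint_iff linorder_neqE_nat less_irrefl)

lemma block_sets_subseq: assumes I: "block_sets I" and \<sigma>: "strict_mono \<sigma>" shows "block_sets (\<lambda>i. I (\<sigma> i))"
proof -
  have "i \<le> a" if "a \<in> I (\<sigma> i)" for i a
    using I that seq_suble[OF \<sigma>, of i] unfolding block_sets_def by (meson order_trans)
  then show ?thesis using I strict_monoD[OF \<sigma>] unfolding block_sets_def by blast
qed

lemma block_sets_admissible:
  assumes I: "block_sets I" and k: "strict_mono_on {..<n} k" and n: "0 < n" "n \<le> k 0"
  shows "admissible n (\<lambda>i. I (k i))"
  unfolding admissible_def
proof (intro conjI allI impI)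
  have fin: "finite (I i)" "I i \<noteq> {}" for i using I unfolding block_sets_def by blast+
  show "1 \<le> n" using n by simp
  show "finite (I (k i))" "I (k i) \<noteq> {}" for i by (rule fin)+
  show "Max (I (k i)) < Min (I (k (Suc i)))" if "Suc i < n" for i
  proof -
    have "k i < k (Suc i)" using k that unfolding strict_mono_on_def by simp
    then show ?thesis using I Max_in[OF fin] Min_in[OF fin] unfolding block_sets_def by blast
  qed
  have "k 0 \<le> Min (I (k 0))" using I Min_in[OF fin] unfolding block_sets_def by blast
  then show "n \<le> Suc (Min (I (k 0)))" using n by simp
qed

text \<open>The twisted sum comes with a quasi-norm, while spreading models are taken with respect
  to a norm; \<open>N\<close> is any norm equivalent to the quasi-norm.\<close>

locale twisted_renorming = tsirelson_twist +
  fixes N :: "cseq \<times> cseq \<Rightarrow> real" and c1 C1 :: real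
  assumes N: "is_norm_on (carr (twisted_ell2 \<Omega>)) N" and c1: "0 < c1" and C1: "0 < C1"
    and N_ge: "p \<in> carr (twisted_ell2 \<Omega>) \<Longrightarrow> c1 * nrm (twisted_ell2 \<Omega>) p \<le> N p"
    and N_le: "p \<in> carr (twisted_ell2 \<Omega>) \<Longrightarrow> N p \<le> C1 * nrm (twisted_ell2 \<Omega>) p"
begin

abbreviation "Z \<equiv> carr (twisted_ell2 \<Omega>)"
abbreviation "zn \<equiv> nrm (twisted_ell2 \<Omega>)"

lemma Z_iff: "p \<in> Z \<longleftrightarrow> snd p \<in> carr ell2 \<and> fst p - \<Omega> (snd p) \<in> carr ell2"
  by (simp add: twisted_ell2_def split: prod.split)

lemma zn_eq: "zn p = l2norm (fst p - \<Omega> (snd p)) + l2norm (snd p)"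
  by (simp add: twisted_ell2_def split: prod.split)

lemma \<Omega>_zero [simp]: "\<Omega> 0 = 0"
  using homogeneous[OF ell2_0, of 0] by simp

lemma Z_subspace: "csubspace Z"
proof (rule complex_vec.subspaceI)
  show "0 \<in> Z" by (simp add: Z_iff)
next
  fix p p' assume p: "p \<in> Z" "p' \<in> Z"
  have "fst (p + p') - \<Omega> (snd (p + p')) = (fst p - \<Omega> (snd p)) + (fst p' - \<Omega> (snd p'))
    - (\<Omega> (snd p + snd p') - \<Omega> (snd p) - \<Omega> (snd p'))"
    unfolding fst_add snd_add by (simp only: algebra_simps)
  also have "\<dots> \<in> carr ell2"
  proof -
    have m: "snd p \<in> carr ell2" "fst p - \<Omega> (snd p) \<in> carr ell2" "snd p' \<in> carr ell2" "fst p' - \<Omega> (snd p') \<in> carr ell2"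
      using p by (auto simp: Z_iff)
    show ?thesis by (rule ell2_diff[OF ell2_add[OF m(2,4)] ell2_le_mem[OF quasi_additive[OF m(1,3)]]])
  qed
  finally show "p + p' \<in> Z" using p ell2_add by (auto simp: Z_iff simp del: plus_fun_apply)
next
  fix c p assume p: "p \<in> Z"
  have "fst (c *\<^sub>C p) - \<Omega> (snd (c *\<^sub>C p)) = c *\<^sub>C (fst p - \<Omega> (snd p))"
    using p by (simp add: homogeneous Z_iff scaleC_diff_right)
  then show "c *\<^sub>C p \<in> Z" using p by (simp add: Z_iff ell2_scale)
qed

lemmas Z_diff = complex_vec.subspace_diff[OF Z_subspace]
lemmas Z_add = complex_vec.subspace_add[OF Z_subspace]
lemmas Z_scale = complex_vec.subspace_scale[OF Z_subspace]
lemmas Z_sum = complex_vec.subspace_sum[OF Z_subspace]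
lemmas N_nonneg = is_norm_onD(1)[OF N]
lemmas N_triangle = is_norm_onD(4)[OF N]

lemma zn_nonneg: "p \<in> Z \<Longrightarrow> 0 \<le> zn p"
  by (simp add: Z_iff zn_eq)

text \<open>Restricting to the single coordinate \<open>j\<close> costs \<open>C * l2norm y\<close>
  by the centralizer estimate, and on a multiple of a unit vector \<open>finite_support\<close>
  costs the same again.\<close>

lemma \<Omega>_coord: assumes y: "y \<in> carr ell2" shows "cmod (\<Omega> y j) \<le> 2 * C * l2norm y"
proof -
  let ?y = "restrict_seq {j} y"
  have z: "\<forall>i\<ge>Suc j. ?y i = 0" by (simp add: restrict_seq_def)
  have "cmod ((restrict_seq {j} (\<Omega> y) - \<Omega> ?y) j) \<le> C * l2norm y" by (rule ell2_le_coord[OF centralizer[OF y]])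
  then have 1: "cmod (\<Omega> y j - \<Omega> ?y j) \<le> C * l2norm y" by (simp add: restrict_seq_def)
  have "cmod (\<Omega> ?y j) \<le> C * (\<Sum>i<Suc j. cmod (?y i))" by (rule ell2_le_coord[OF finite_support[OF z]])
  also have "(\<Sum>i<Suc j. cmod (?y i)) = (\<Sum>i\<in>{j}. cmod (?y i))"
    by (rule sum.mono_neutral_right) (auto simp: restrict_seq_def)
  also have "C * (\<Sum>i\<in>{j}. cmod (?y i)) \<le> C * l2norm y"
    using l2norm_coord[OF y, of j] C_nonneg by (intro mult_left_mono) (auto simp: restrict_seq_def)
  finally show ?thesis using 1 norm_triangle_ineq[of "\<Omega> y j - \<Omega> ?y j" "\<Omega> ?y j"] by simp
qed

lemma coord_bound:
  assumes p: "p \<in> Z"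
  shows "cmod (snd p j) \<le> zn p" "cmod (fst p j) \<le> (2 * C + 1) * zn p"
proof -
  have y: "snd p \<in> carr ell2" and x: "fst p - \<Omega> (snd p) \<in> carr ell2" using p by (auto simp: Z_iff)
  show "cmod (snd p j) \<le> zn p" unfolding zn_eq using l2norm_coord[OF y, of j] l2norm_nonneg[OF x] by linarith
  have "cmod (fst p j - \<Omega> (snd p) j) \<le> l2norm (fst p - \<Omega> (snd p))" using l2norm_coord[OF x, of j] by simp
  moreover have "cmod (\<Omega> (snd p) j) \<le> 2 * C * l2norm (snd p)" by (rule \<Omega>_coord[OF y])
  moreover have "cmod (fst p j) \<le> cmod (fst p j - \<Omega> (snd p) j) + cmod (\<Omega> (snd p) j)"
    using norm_triangle_ineq[of "fst p j - \<Omega> (snd p) j" "\<Omega> (snd p) j"] by simp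
  moreover have "0 \<le> C * l2norm (fst p - \<Omega> (snd p))" using C_nonneg x by simp
  ultimately show "cmod (fst p j) \<le> (2 * C + 1) * zn p"
    unfolding zn_eq using l2norm_nonneg[OF y] by (simp add: algebra_simps)
qed

text \<open>Balls are closed under coordinatewise limits in the sense needed to place the limit in
  the space. On a finite window \<open>\<Omega> y\<close> is compared with
  \<open>\<Omega> (snd (p n))\<close>; the error is bounded independently of the window, so
  \<open>ell2_le_iff\<close> applies to \<open>x - \<Omega> y\<close>.\<close>

lemma Z_closed:
  assumes p: "\<And>n. p n \<in> Z" and R: "\<And>n. zn (p n) \<le> R"
    and x: "\<And>j. (\<lambda>n. fst (p n) j) \<longlonglongrightarrow> x j" and y: "\<And>j. (\<lambda>n. snd (p n) j) \<longlonglongrightarrow> y j"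
  shows "(x, y) \<in> Z"
proof -
  have pn: "snd (p n) \<in> carr ell2" "fst (p n) - \<Omega> (snd (p n)) \<in> carr ell2" for n using p by (auto simp: Z_iff)
  have "l2norm (snd (p n)) \<le> R" "l2norm (fst (p n) - \<Omega> (snd (p n))) \<le> R" for n
    using R[of n] l2norm_nonneg[OF pn(1)[of n]] l2norm_nonneg[OF pn(2)[of n]]
    unfolding zn_eq by linarith+
  then have bnd: "ell2_le R (snd (p n))" "ell2_le R (fst (p n) - \<Omega> (snd (p n)))" for n
    using pn unfolding ell2_le_def by blast+
  have yR: "ell2_le R y"
    by (rule ell2_le_limit[OF y always_eventually[OF allI[OF bnd(1)]] tendsto_const])
  have y2: "y \<in> carr ell2" by (rule ell2_le_mem[OF yR])
  have main: "ell2_le (R + 5 * C * R) (restrict_seq {..<m} (x - \<Omega> y))" for m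
  proof (rule ell2_le_limit)
    let ?P = "restrict_seq {..<m}"
    let ?v = "\<lambda>n. snd (p n) - y"
    \<comment> \<open>The term \<open>3 * C * R\<close> is quasi-additivity for \<open>?v n\<close>
      and \<open>y\<close>, of norms at most \<open>2 * R\<close> and \<open>R\<close>;
      \<open>2 * C * R\<close> is the centralizer error on \<open>?v n\<close>; the last term is
      \<open>finite_support\<close> on the window and tends to 0.\<close>
    let ?M = "\<lambda>n. R + (3 * C * R + (2 * C * R + C * (\<Sum>j<m. cmod (snd (p n) j - y j))))"
    show "(\<lambda>n. ?P (fst (p n) - \<Omega> y) j) \<longlonglongrightarrow> ?P (x - \<Omega> y) j" for j
      using x[of j] by (auto simp: restrict_seq_def intro!: tendsto_intros)
    have "(\<lambda>n. \<Sum>j<m. cmod (snd (p n) j - y j)) \<longlonglongrightarrow> (\<Sum>j<m. cmod (y j - y j))"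
      by (intro tendsto_sum tendsto_norm tendsto_diff tendsto_const) (rule y)
    then have "?M \<longlonglongrightarrow> R + (3 * C * R + (2 * C * R + C * (\<Sum>j<m. cmod (y j - y j))))"
      by (intro tendsto_add tendsto_mult_left tendsto_const)
    then show "?M \<longlonglongrightarrow> R + 5 * C * R" by (simp add: algebra_simps)
    have "ell2_le (?M n) (?P (fst (p n) - \<Omega> y))" for n
    proof -
      have v: "?v n \<in> carr ell2" by (rule ell2_diff[OF pn(1) y2])
      have vR: "l2norm (?v n) \<le> 2 * R" using ell2_le_le[OF ell2_le_diff[OF bnd(1) yR]] by simp
      have "ell2_le (C * (l2norm (?v n) + l2norm y)) (\<Omega> (?v n + y) - \<Omega> (?v n) - \<Omega> y)"
        by (rule quasi_additive[OF v y2])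
      then have "ell2_le (3 * C * R) (\<Omega> (snd (p n)) - \<Omega> (?v n) - \<Omega> y)"
        unfolding diff_add_cancel
        by (rule ell2_le_weaken) (use mult_left_mono[OF add_mono[OF vR ell2_le_le[OF yR]] C_nonneg] in simp)
      then have 1: "ell2_le (3 * C * R) (?P (\<Omega> (snd (p n)) - \<Omega> (?v n) - \<Omega> y))" by (rule ell2_le_restrict)
      have 2: "ell2_le (2 * C * R) (?P (\<Omega> (?v n)) - \<Omega> (?P (?v n)))"
        by (rule ell2_le_weaken[OF centralizer[OF v]]) (use mult_left_mono[OF vR C_nonneg] in simp)
      have "ell2_le (C * (\<Sum>j<m. cmod (?P (?v n) j))) (\<Omega> (?P (?v n)))"
        by (rule finite_support) (simp add: restrict_seq_def)
      moreover have "(\<Sum>j<m. cmod (?P (?v n) j)) = (\<Sum>j<m. cmod (snd (p n) j - y j))"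
        by (rule sum.cong) (auto simp: restrict_seq_def)
      ultimately have 3: "ell2_le (C * (\<Sum>j<m. cmod (snd (p n) j - y j))) (\<Omega> (?P (?v n)))" by simp
      have 0: "ell2_le R (?P (fst (p n) - \<Omega> (snd (p n))))" by (rule ell2_le_restrict[OF bnd(2)])
      have "?P (fst (p n) - \<Omega> y) = ?P (fst (p n) - \<Omega> (snd (p n))) + (?P (\<Omega> (snd (p n)) - \<Omega> (?v n) - \<Omega> y)
        + ((?P (\<Omega> (?v n)) - \<Omega> (?P (?v n))) + \<Omega> (?P (?v n))))"
        by (auto simp: restrict_seq_def fun_eq_iff)
      then show ?thesis using ell2_le_add[OF 0 ell2_le_add[OF 1 ell2_le_add[OF 2 3]]] by (simp only:)
    qed
    then show "\<forall>\<^sub>F n in sequentially. ell2_le (?M n) (?P (fst (p n) - \<Omega> y))" by (rule always_eventually[OF allI])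
  qed
  have "ell2_le (R + 5 * C * R) (x - \<Omega> y)"
    unfolding ell2_le_iff
  proof
    fix m
    have "L2_set (\<lambda>j. cmod ((x - \<Omega> y) j)) {..<m} = L2_set (\<lambda>j. cmod (restrict_seq {..<m} (x - \<Omega> y) j)) {..<m}"
      by (rule L2_set_cong) (auto simp: restrict_seq_def)
    also have "\<dots> \<le> R + 5 * C * R" using main[of m] unfolding ell2_le_iff by blast
    finally show "L2_set (\<lambda>j. cmod ((x - \<Omega> y) j)) {..<m} \<le> R + 5 * C * R" .
  qed
  then show ?thesis using y2 ell2_le_mem by (simp add: Z_iff)
qed

section \<open>Truncations of pairs and the gliding hump\<close>

lemma c00_pair: assumes "x \<in> c00" "y \<in> c00" shows "(x, y) \<in> Z"
proof -
  obtain m where "\<forall>j\<ge>m. y j = 0" using assms(2) c00_support by auto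
  from ell2_le_mem[OF finite_support[OF this]] show ?thesis
    using assms c00_ell2 ell2_diff by (simp add: Z_iff)
qed

text \<open>The centralizer estimate says that coordinate projections, acting on both entries, are
  bounded on the twisted sum, uniformly in the set \<open>A\<close>.\<close>

lemma restrict_pair_Z: assumes p: "p \<in> Z" shows "restrict_pair A p \<in> Z"
    "zn (restrict_pair A p) \<le> (C + 1) * zn p"
proof -
  have y: "snd p \<in> carr ell2" and x: "fst p - \<Omega> (snd p) \<in> carr ell2" using p by (auto simp: Z_iff)
  have "ell2_le (l2norm (fst p - \<Omega> (snd p)) + C * l2norm (snd p))
     (restrict_seq A (fst p - \<Omega> (snd p)) + (restrict_seq A (\<Omega> (snd p)) - \<Omega> (restrict_seq A (snd p))))"
    by (intro ell2_le_add ell2_le_restrict ell2_le_refl x centralizer y)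
  moreover have "restrict_seq A (fst p - \<Omega> (snd p)) + (restrict_seq A (\<Omega> (snd p)) - \<Omega> (restrict_seq A (snd p)))
     = restrict_seq A (fst p) - \<Omega> (restrict_seq A (snd p))"
    by (simp add: restrict_seq_diff)
  ultimately have b: "ell2_le (l2norm (fst p - \<Omega> (snd p)) + C * l2norm (snd p)) (restrict_seq A (fst p) - \<Omega> (restrict_seq A (snd p)))"
    by (simp only:)
  show "restrict_pair A p \<in> Z" using ell2_le_mem[OF b] ell2_restrict[OF y] by (simp add: Z_iff)
  have "0 \<le> C * l2norm (fst p - \<Omega> (snd p))" using C_nonneg x by simp
  then show "zn (restrict_pair A p) \<le> (C + 1) * zn p"
    unfolding zn_eq fst_restrict_pair snd_restrict_pair
    using ell2_le_le[OF b] l2norm_restrict_le[OF y, of A] by (simp add: algebra_simps)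
qed

lemma head_null:
  assumes g: "\<And>k. g k \<in> Z" and x: "\<And>j. (\<lambda>k. fst (g k) j) \<longlonglongrightarrow> 0" and y: "\<And>j. (\<lambda>k. snd (g k) j) \<longlonglongrightarrow> 0"
  shows "(\<lambda>k. N (restrict_pair {..<m} (g k))) \<longlonglongrightarrow> 0"
proof (rule tendsto_sandwich[OF always_eventually always_eventually tendsto_const])
  let ?b = "\<lambda>k. C1 * ((\<Sum>j<m. cmod (fst (g k) j)) + (C + 1) * (\<Sum>j<m. cmod (snd (g k) j)))"
  show "\<forall>k. 0 \<le> N (restrict_pair {..<m} (g k))" using N_nonneg restrict_pair_Z(1)[OF g] by blast
  have "?b \<longlonglongrightarrow> C1 * ((\<Sum>j<m. cmod 0) + (C + 1) * (\<Sum>j<m. cmod 0))"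
    by (intro tendsto_intros x y)
  then show "?b \<longlonglongrightarrow> 0" by simp
  show "\<forall>k. N (restrict_pair {..<m} (g k)) \<le> ?b k"
  proof
    fix k
    let ?x = "restrict_seq {..<m} (fst (g k))" and ?y = "restrict_seq {..<m} (snd (g k))"
    have z: "\<forall>j\<ge>m. ?x j = 0" "\<forall>j\<ge>m. ?y j = 0" by (auto simp: restrict_seq_def)
    have s: "(\<Sum>j<m. cmod (?x j)) = (\<Sum>j<m. cmod (fst (g k) j))" "(\<Sum>j<m. cmod (?y j)) = (\<Sum>j<m. cmod (snd (g k) j))"
      by (auto intro!: sum.cong simp: restrict_seq_def)
    have "l2norm (?x - \<Omega> ?y) \<le> (\<Sum>j<m. cmod (fst (g k) j)) + C * (\<Sum>j<m. cmod (snd (g k) j))"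
      using l2norm_triangle_diff[OF l2norm_finite(1)[OF z(1)] ell2_le_mem[OF finite_support[OF z(2)]]]
        l2norm_le_l1[OF z(1)] ell2_le_le[OF finite_support[OF z(2)]] unfolding s by linarith
    then have "zn (restrict_pair {..<m} (g k)) \<le> (\<Sum>j<m. cmod (fst (g k) j)) + (C + 1) * (\<Sum>j<m. cmod (snd (g k) j))"
      unfolding zn_eq fst_restrict_pair snd_restrict_pair using l2norm_le_l1[OF z(2)] unfolding s
      by (simp add: algebra_simps)
    then have "C1 * zn (restrict_pair {..<m} (g k)) \<le> ?b k" using C1 by simp
    then show "N (restrict_pair {..<m} (g k)) \<le> ?b k" using N_le[OF restrict_pair_Z(1)[OF g], of "{..<m}" k] by linarith
  qed
qed

lemma tail_null:
  assumes p: "p \<in> Z" shows "(\<lambda>m. N (p - restrict_pair {..<m} p)) \<longlonglongrightarrow> 0"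
proof (rule LIMSEQ_I)
  fix e :: real assume e: "0 < e"
  have y: "snd p \<in> carr ell2" and x: "fst p - \<Omega> (snd p) \<in> carr ell2" using p by (auto simp: Z_iff)
  let ?Q = "\<lambda>m. restrict_seq {m..}"
  define d where "d = e / (2 * C1)"
  have d: "0 < d" using e C1 by (simp add: d_def)
  have "(\<lambda>m. C * l2norm (?Q m (snd p))) \<longlonglongrightarrow> 0" using tendsto_mult_right_zero[OF l2norm_tail[OF y]] by simp
  then have "\<forall>\<^sub>F m in sequentially. C * l2norm (?Q m (snd p)) < d" using d by (rule order_tendstoD)
  then obtain m0 where m0: "C * l2norm (?Q m0 (snd p)) < d" by (auto simp: eventually_sequentially)
  let ?y0 = "?Q m0 (snd p)" and ?h = "restrict_seq {..<m0} (snd p)"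
  have y0: "?y0 \<in> carr ell2" "?h \<in> carr ell2" by (intro ell2_restrict y)+
  \<comment> \<open>The centralizer estimate on \<open>?Q m\<close> is applied to \<open>?y0\<close>, whose norm is small, and not to \<open>snd p\<close>.\<close>
  define E where "E = \<Omega> (snd p) - \<Omega> ?y0"
  have E: "E \<in> carr ell2"
  proof -
    have h: "\<Omega> ?h \<in> carr ell2"
      by (rule ell2_le_mem[OF finite_support[of m0]]) (simp add: restrict_seq_def)
    have "\<Omega> (?h + ?y0) - \<Omega> ?h - \<Omega> ?y0 + \<Omega> ?h \<in> carr ell2"
      by (rule ell2_add[OF ell2_le_mem[OF quasi_additive[OF y0(2,1)]] h])
    moreover have "\<Omega> (?h + ?y0) - \<Omega> ?h - \<Omega> ?y0 + \<Omega> ?h = E"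
      unfolding restrict_seq_split E_def by (simp add: fun_eq_iff)
    ultimately show ?thesis by (simp only:)
  qed
  have bound: "zn (p - restrict_pair {..<m} p) \<le> l2norm (?Q m (fst p - \<Omega> (snd p))) + l2norm (?Q m E) + d + l2norm (?Q m (snd p))"
    if m: "m \<ge> m0" for m
  proof -
    have QQ: "?Q m ?y0 = ?Q m (snd p)" using m by (auto simp: restrict_seq_def fun_eq_iff)
    have eq: "p - restrict_pair {..<m} p = restrict_pair {m..} p"
      by (auto simp: prod_eq_iff restrict_seq_def fun_eq_iff)
    have "ell2_le (l2norm (?Q m (fst p - \<Omega> (snd p))) + (l2norm (?Q m E) + C * l2norm ?y0))
      (?Q m (fst p - \<Omega> (snd p)) + (?Q m E + (?Q m (\<Omega> ?y0) - \<Omega> (?Q m ?y0))))"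
      by (intro ell2_le_add ell2_le_refl centralizer ell2_restrict x E y0)
    moreover have "?Q m (fst p - \<Omega> (snd p)) + (?Q m E + (?Q m (\<Omega> ?y0) - \<Omega> (?Q m ?y0))) = ?Q m (fst p) - \<Omega> (?Q m (snd p))"
      unfolding QQ E_def by (simp add: restrict_seq_diff)
    ultimately have "l2norm (?Q m (fst p) - \<Omega> (?Q m (snd p))) \<le>
       l2norm (?Q m (fst p - \<Omega> (snd p))) + (l2norm (?Q m E) + C * l2norm ?y0)"
      using ell2_le_le by (metis (no_types, lifting))
    then show ?thesis unfolding eq zn_eq fst_restrict_pair snd_restrict_pair using m0 by linarith
  qed
  have "(\<lambda>m. l2norm (?Q m (fst p - \<Omega> (snd p))) + l2norm (?Q m E) + d + l2norm (?Q m (snd p))) \<longlonglongrightarrow> 0 + 0 + d + 0"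
    by (intro tendsto_add tendsto_const l2norm_tail x E y)
  moreover have "0 + 0 + d + 0 < 2 * d" using d by simp
  ultimately have "\<forall>\<^sub>F m in sequentially. l2norm (?Q m (fst p - \<Omega> (snd p))) + l2norm (?Q m E) + d + l2norm (?Q m (snd p)) < 2 * d"
    by (rule order_tendstoD)
  then obtain m1 where m1: "\<And>m. m \<ge> m1 \<Longrightarrow> l2norm (?Q m (fst p - \<Omega> (snd p))) + l2norm (?Q m E) + d + l2norm (?Q m (snd p)) < 2 * d"
    by (auto simp: eventually_sequentially)
  have "norm (N (p - restrict_pair {..<m} p) - 0) < e" if m: "m \<ge> max m0 m1" for m
  proof -
    have mem: "p - restrict_pair {..<m} p \<in> Z" by (rule Z_diff[OF p restrict_pair_Z(1)[OF p]])
    have "zn (p - restrict_pair {..<m} p) < 2 * d" using bound[of m] m1[of m] m by simp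
    then have "C1 * zn (p - restrict_pair {..<m} p) < C1 * (2 * d)" using C1 by simp
    also have "C1 * (2 * d) = e" using C1 by (simp add: d_def)
    finally show ?thesis using N_le[OF mem] N_nonneg[OF mem] by simp
  qed
  then show "\<exists>no. \<forall>m\<ge>no. norm (N (p - restrict_pair {..<m} p) - 0) < e" by blast
qed

text \<open>The index is chosen late enough to make the part before \<open>lo\<close> small, then
  the right end far enough to make the tail small; the next block begins where this one
  ends.\<close>

lemma gliding_hump:
  assumes g: "\<And>k. g k \<in> Z" and x: "\<And>j. (\<lambda>k. fst (g k) j) \<longlonglongrightarrow> 0" and y: "\<And>j. (\<lambda>k. snd (g k) j) \<longlonglongrightarrow> 0"
  obtains \<kappa> I where "strict_mono \<kappa>" "block_sets I"
    "\<And>i. N (g (\<kappa> i) - restrict_pair (I i) (g (\<kappa> i))) < inverse (real (Suc i))"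
proof -
  \<comment> \<open>A state is an index with a half-open interval. The clause
    \<open>i \<le> lo\<close> carries the position condition of \<open>block_sets\<close> through
    the dependent choice.\<close>
  define good where "good i s \<longleftrightarrow> (case s of (k, lo, hi) \<Rightarrow> lo < hi \<and> i \<le> lo \<and>
     N (g k - restrict_pair {lo..<hi} (g k)) < inverse (real (Suc i)))" for i :: nat and s :: "nat \<times> nat \<times> nat"
  have step: "\<exists>k hi. k > k0 \<and> good i (k, lo, hi)" if lo: "i \<le> lo" for i k0 lo
  proof -
    have e: "0 < inverse (real (Suc i)) / 2" by simp
    have "\<forall>\<^sub>F k in sequentially. N (restrict_pair {..<lo} (g k)) < inverse (real (Suc i)) / 2 \<and> k > k0"
      by (intro eventually_conj order_tendstoD(2)[OF head_null[OF g x y] e] eventually_gt_at_top)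
    then obtain k where k: "N (restrict_pair {..<lo} (g k)) < inverse (real (Suc i)) / 2" "k > k0"
      by (auto simp: eventually_sequentially)
    have "\<forall>\<^sub>F h in sequentially. N (g k - restrict_pair {..<h} (g k)) < inverse (real (Suc i)) / 2 \<and> h > lo"
      by (intro eventually_conj order_tendstoD(2)[OF tail_null[OF g] e] eventually_gt_at_top)
    then obtain h where h: "N (g k - restrict_pair {..<h} (g k)) < inverse (real (Suc i)) / 2" "h > lo"
      by (auto simp: eventually_sequentially)
    have "g k - restrict_pair {lo..<h} (g k) = (g k - restrict_pair {..<h} (g k)) + restrict_pair {..<lo} (g k)"
      using h(2) by (auto simp: prod_eq_iff restrict_seq_def fun_eq_iff)
    then have "N (g k - restrict_pair {lo..<h} (g k)) \<le> N (g k - restrict_pair {..<h} (g k)) + N (restrict_pair {..<lo} (g k))"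
      by (simp only:) (intro N_triangle Z_diff restrict_pair_Z g)
    then show ?thesis using k h lo unfolding good_def by (intro exI[of _ k] exI[of _ h]) auto
  qed
  have "\<exists>f. \<forall>n. good n (f n) \<and> (fst (f n) < fst (f (Suc n)) \<and> snd (snd (f n)) = fst (snd (f (Suc n))))"
  proof (rule dependent_nat_choice)
    show "\<exists>s. good 0 s" using step[of 0 0 0] by blast
    fix s n assume s: "good n s"
    obtain k lo hi where klh: "s = (k, lo, hi)" by (cases s)
    have "Suc n \<le> hi" using s unfolding klh good_def by auto
    from step[OF this, of k] obtain k' hi' where "k' > k" "good (Suc n) (k', hi, hi')" by blast
    then show "\<exists>s'. good (Suc n) s' \<and> fst s < fst s' \<and> snd (snd s) = fst (snd s')"
      unfolding klh by (intro exI[of _ "(k', hi, hi')"]) simp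
  qed
  then obtain f where f: "\<And>n. good n (f n)" "\<And>n. fst (f n) < fst (f (Suc n))"
    "\<And>n. snd (snd (f n)) = fst (snd (f (Suc n)))" by blast
  define \<kappa> where "\<kappa> n = fst (f n)" for n
  define lo where "lo n = fst (snd (f n))" for n
  have hi: "snd (snd (f n)) = lo (Suc n)" for n using f(3) by (simp add: lo_def)
  have fn: "f n = (\<kappa> n, lo n, lo (Suc n))" for n using hi[of n] by (simp add: \<kappa>_def lo_def prod_eq_iff)
  have G: "lo n < lo (Suc n)" "n \<le> lo n" "N (g (\<kappa> n) - restrict_pair {lo n..<lo (Suc n)} (g (\<kappa> n))) < inverse (real (Suc n))" for n
    using f(1)[of n] unfolding fn good_def by auto
  have lo: "strict_mono lo" using G(1) by (simp add: strict_mono_Suc_iff)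
  have "strict_mono \<kappa>" using f(2) by (simp add: strict_mono_Suc_iff \<kappa>_def)
  moreover have "block_sets (\<lambda>i. {lo i..<lo (Suc i)})"
    unfolding block_sets_def
  proof (intro conjI allI impI)
    fix i show "finite {lo i..<lo (Suc i)}" "{lo i..<lo (Suc i)} \<noteq> {}" "\<forall>a\<in>{lo i..<lo (Suc i)}. i \<le> a"
      using G(1,2)[of i] by auto
  next
    fix i j a b assume "i < j" "a \<in> {lo i..<lo (Suc i)}" "b \<in> {lo j..<lo (Suc j)}"
    moreover have "lo (Suc i) \<le> lo j" using lo \<open>i < j\<close> by (simp add: strict_mono_less_eq)
    ultimately show "a < b" by simp
  qed
  ultimately show ?thesis using G(3) that by blast
qed

end


section \<open>Norm estimates for sums of blocks\<close>

lemma restrict_seq_eqD: "restrict_seq A x = x \<Longrightarrow> j \<notin> A \<Longrightarrow> x j = 0"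
  by (metis restrict_seq_apply)

lemma block_sum_bounds:
  assumes I: "block_sets I" and k: "strict_mono_on {..<n} k"
    and supp: "\<And>i j. j \<notin> I i \<Longrightarrow> w i j = 0" and w: "\<And>i. w i \<in> carr ell2" and a: "\<forall>j\<ge>n. a j = 0"
  shows "(\<And>i. l2norm (w i) \<le> R) \<Longrightarrow> 0 \<le> R \<Longrightarrow> l2norm (\<Sum>j<n. a j *\<^sub>C w (k j)) \<le> R * l2norm a"
    and "(\<And>i. d \<le> l2norm (w i)) \<Longrightarrow> 0 \<le> d \<Longrightarrow> d * l2norm a \<le> l2norm (\<Sum>j<n. a j *\<^sub>C w (k j))"
proof -
  have disj: "I (k i) \<inter> I (k j) = {}" if "i < n" "j < n" "i \<noteq> j" for i j
    using block_sets_disjoint[OF I] strict_mono_on_imp_inj_on[OF k] that by (meson inj_onD lessThan_iff)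
  show "l2norm (\<Sum>j<n. a j *\<^sub>C w (k j)) \<le> R * l2norm a" if "\<And>i. l2norm (w i) \<le> R" "0 \<le> R"
    by (rule l2norm_disjoint_bounds(1)[where I = "\<lambda>j. I (k j)"]) (simp_all add: disj supp w a that)
  show "d * l2norm a \<le> l2norm (\<Sum>j<n. a j *\<^sub>C w (k j))" if "\<And>i. d \<le> l2norm (w i)" "0 \<le> d"
    by (rule l2norm_disjoint_bounds(2)[where I = "\<lambda>j. I (k j)"]) (simp_all add: disj supp w a that)
qed

context twisted_renorming
begin

text \<open>Since \<open>\<Omega> 0 = 0\<close>, the quasi-norm on pairs with second entry 0 is the
  l_2 norm of the first, and the estimate is that for disjoint vectors in l_2.\<close>

lemma first_coordinate_estimate:
  assumes I: "block_sets I" and h: "\<And>i. h i \<in> carr ell2" and supp: "\<And>i j. j \<notin> I i \<Longrightarrow> h i j = 0"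
    and R: "\<And>i. l2norm (h i) \<le> R" and d: "\<And>i. d \<le> l2norm (h i)" "0 < d"
    and k: "strict_mono_on {..<n} k" and a: "\<forall>j\<ge>n. a j = 0"
  shows "c1 * d * l2norm a \<le> N (\<Sum>j<n. a j *\<^sub>C (h (k j), 0))"
    and "N (\<Sum>j<n. a j *\<^sub>C (h (k j), 0)) \<le> C1 * R * l2norm a"
proof -
  let ?p = "\<Sum>j<n. a j *\<^sub>C (h (k j), 0 :: cseq)" and ?h = "\<Sum>j<n. a j *\<^sub>C h (k j)"
  have p: "fst ?p = ?h" "snd ?p = 0" unfolding fst_sum snd_sum by simp_all
  have h2: "?h \<in> carr ell2" by (intro ell2_sum ell2_scale h)
  have mem: "?p \<in> Z" unfolding Z_iff p using h2 by simp
  have zp: "zn ?p = l2norm ?h" unfolding zn_eq p by simp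
  have R0: "0 \<le> R" using R[of 0] d(1)[of 0] d(2) by linarith
  have "l2norm ?h \<le> R * l2norm a"
    by (rule block_sum_bounds(1)[OF I k supp h a R R0])
  then have "C1 * zn ?p \<le> C1 * (R * l2norm a)" unfolding zp using C1 by simp
  then show "N ?p \<le> C1 * R * l2norm a" using N_le[OF mem] by (simp add: mult.assoc)
  have "d * l2norm a \<le> l2norm ?h"
    by (rule block_sum_bounds(2)[OF I k supp h a d(1) less_imp_le[OF d(2)]])
  then have "c1 * (d * l2norm a) \<le> c1 * zn ?p" unfolding zp using c1 by simp
  then show "c1 * d * l2norm a \<le> N ?p" using N_ge[OF mem] by (simp add: mult.assoc)
qed

text \<open>The second entry of the sum has norm comparable to \<open>l2norm a\<close>. By the block
  formula, the deviation of the first entry from \<open>\<Omega>\<close> of the second is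
  \<open>2 * kalton_peck a\<close> spread along the blocks, up to errors of order
  \<open>l2norm a\<close>. Together the two parts give the domain norm of
  \<open>kalton_peck\<close>, from both sides.\<close>

lemma block_estimate:
  assumes I: "block_sets I" and \<beta>: "\<And>i. \<beta> i \<in> Z" and supp: "\<And>i. restrict_pair (I i) (\<beta> i) = \<beta> i"
    and R: "\<And>i. zn (\<beta> i) \<le> R" and d: "\<And>i. d \<le> l2norm (snd (\<beta> i))" "0 < d"
  obtains c c' where "0 < c" "0 < c'"
    "\<And>n a k. strict_mono_on {..<n} k \<Longrightarrow> \<forall>j<n. n \<le> k j \<Longrightarrow> \<forall>j\<ge>n. a j = 0 \<Longrightarrow>
      c * dom_norm kalton_peck a \<le> N (\<Sum>j<n. a j *\<^sub>C \<beta> (k j)) \<and>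
      N (\<Sum>j<n. a j *\<^sub>C \<beta> (k j)) \<le> c' * dom_norm kalton_peck a"
proof -
  let ?q = "dom_norm kalton_peck"
  let ?u = "\<lambda>i. fst (\<beta> i)" and ?v = "\<lambda>i. snd (\<beta> i)"
  have v: "?v i \<in> carr ell2" and u: "?u i - \<Omega> (?v i) \<in> carr ell2" for i using \<beta>[of i] by (auto simp: Z_iff)
  have ru: "restrict_seq (I i) (?u i) = ?u i" and rv: "restrict_seq (I i) (?v i) = ?v i" for i
    using supp[of i] by (auto simp: restrict_pair_def prod_eq_iff)
  have nR: "l2norm (?v i) \<le> R" "l2norm (?u i - \<Omega> (?v i)) \<le> R" for i
    using R[of i] l2norm_nonneg[OF v[of i]] l2norm_nonneg[OF u[of i]] unfolding zn_eq by linarith+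
  have R0: "0 < R" using nR(1)[of 0] d(1)[of 0] d(2) by linarith
  \<comment> \<open>The deviation of \<open>?u i\<close> from \<open>\<Omega> (?v i)\<close>, cut to
    the block: \<open>\<Omega> (?v i)\<close> may spread beyond \<open>I i\<close>, and the sums of
    the \<open>h i\<close> have to be disjoint.\<close>
  define h where "h i = restrict_seq (I i) (?u i - \<Omega> (?v i))" for i
  have h2: "h i \<in> carr ell2" for i unfolding h_def by (rule ell2_restrict[OF u])
  have hR: "l2norm (h i) \<le> R" for i
    unfolding h_def using l2norm_restrict_le[OF u, of "I i" i] nR(2)[of i] by linarith
  have h_eq: "h i = ?u i - restrict_seq (I i) (\<Omega> (?v i))" for i
    unfolding h_def restrict_seq_diff ru ..
  have est: "zn (\<Sum>j<n. a j *\<^sub>C \<beta> (k j)) \<le> (2 + C) * R * ?q a"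
      "?q a \<le> ((1 + (1 + C) * R / d) / (2 * d) + 1 / d) * zn (\<Sum>j<n. a j *\<^sub>C \<beta> (k j))"
      "(\<Sum>j<n. a j *\<^sub>C \<beta> (k j)) \<in> Z"
    if k: "strict_mono_on {..<n} k" and nk: "\<forall>j<n. n \<le> k j" and a: "\<forall>j\<ge>n. a j = 0" for n a k
  proof -
    let ?p = "\<Sum>j<n. a j *\<^sub>C \<beta> (k j)"
    let ?U = "\<Sum>j<n. a j *\<^sub>C ?u (k j)" and ?V = "\<Sum>j<n. a j *\<^sub>C ?v (k j)"
    let ?H = "\<Sum>j<n. a j *\<^sub>C h (k j)" and ?T = "\<Sum>j<n. kalton_peck a j *\<^sub>C ?v (k j)"
    let ?W = "\<Sum>j<n. a j *\<^sub>C restrict_seq (I (k j)) (\<Omega> (?v (k j)))"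
    have p: "fst ?p = ?U" "snd ?p = ?V" unfolding fst_sum snd_sum by simp_all
    show mem: "?p \<in> Z" by (intro Z_sum Z_scale \<beta>)
    have a2: "a \<in> carr ell2" by (rule l2norm_finite(1)[OF a])
    have Ka: "\<forall>j\<ge>n. kalton_peck a j = 0" using a by (simp add: kalton_peck_apply[OF a2])
    have Ka2: "kalton_peck a \<in> carr ell2" by (rule l2norm_finite(1)[OF Ka])
    \<comment> \<open>An admissible family has at least one member, so \<open>n = 0\<close> is
      treated apart; otherwise \<open>n \<le> k 0\<close> makes the blocks admissible.\<close>
    have err: "ell2_le (C * R * l2norm a) (\<Omega> ?V - ?W + 2 *\<^sub>C ?T)"
    proof (cases "n = 0")
      case True
      then show ?thesis using a2 C_nonneg R0 by (simp add: ell2_le_0)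
    next
      case False
      have "admissible n (\<lambda>j. I (k j))" using block_sets_admissible[OF I k] False nk by simp
      from blocks[where v = "\<lambda>j. ?v (k j)", OF this v nR(1) less_imp_le[OF R0] a] show ?thesis unfolding rv .
    qed
    have sv: "?v i j = 0" if "j \<notin> I i" for i j using restrict_seq_eqD[OF rv that] .
    have sh: "h i j = 0" if "j \<notin> I i" for i j using that by (simp add: h_def restrict_seq_def)
    note bounds = block_sum_bounds[OF I k]
    have H: "l2norm ?H \<le> R * l2norm a" by (rule bounds(1)[OF sh h2 a hR less_imp_le[OF R0]])
    have V: "l2norm ?V \<le> R * l2norm a" by (rule bounds(1)[OF sv v a nR(1) less_imp_le[OF R0]])
    have V': "d * l2norm a \<le> l2norm ?V" by (rule bounds(2)[OF sv v a d(1) less_imp_le[OF d(2)]])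
    have T: "l2norm ?T \<le> R * l2norm (kalton_peck a)" by (rule bounds(1)[OF sv v Ka nR(1) less_imp_le[OF R0]])
    have T': "d * l2norm (kalton_peck a) \<le> l2norm ?T" by (rule bounds(2)[OF sv v Ka d(1) less_imp_le[OF d(2)]])
    have H2: "?H \<in> carr ell2" and T2: "?T \<in> carr ell2" and V2: "?V \<in> carr ell2"
      by (intro ell2_sum ell2_scale h2 v)+
    have HUW: "?H = ?U - ?W" unfolding h_eq by (simp only: scaleC_diff_right sum_subtractf)
    \<comment> \<open>As \<open>?H = ?U - ?W\<close>, the deviation \<open>?U - \<Omega> ?V\<close>
      is \<open>?H\<close> minus the block error plus twice \<open>?T\<close>, which carries the
      Kalton-Peck term.\<close>
    have 1: "ell2_le (R * l2norm a + C * R * l2norm a + 2 * (R * l2norm (kalton_peck a))) (?U - \<Omega> ?V)"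
    proof -
      have "ell2_le (2 * (R * l2norm (kalton_peck a))) (2 *\<^sub>C ?T)"
        using ell2_le_scale[OF ell2_le_weaken[OF ell2_le_refl[OF T2] T], of 2] by simp
      from ell2_le_add[OF ell2_le_diff[OF ell2_le_weaken[OF ell2_le_refl[OF H2] H] err] this]
      have "ell2_le (R * l2norm a + C * R * l2norm a + 2 * (R * l2norm (kalton_peck a)))
        (?H - (\<Omega> ?V - ?W + 2 *\<^sub>C ?T) + 2 *\<^sub>C ?T)" .
      moreover have "?H - (\<Omega> ?V - ?W + 2 *\<^sub>C ?T) + 2 *\<^sub>C ?T = ?U - \<Omega> ?V"
        unfolding HUW by (simp only: algebra_simps)
      ultimately show ?thesis by (simp only:)
    qed
    have zp: "zn ?p = l2norm (?U - \<Omega> ?V) + l2norm ?V" unfolding zn_eq p ..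
    have K0: "0 \<le> l2norm (kalton_peck a)" "0 \<le> l2norm a" using a2 Ka2 by auto
    have "0 \<le> C * (R * l2norm (kalton_peck a))" using C_nonneg R0 K0 by simp
    then show "zn ?p \<le> (2 + C) * R * ?q a"
      unfolding zp dom_norm_def using ell2_le_le[OF 1] V by (simp add: algebra_simps)
    have u0: "0 \<le> l2norm (?U - \<Omega> ?V)" using ell2_le_mem[OF 1] by simp
    have A: "l2norm a \<le> 1 / d * zn ?p"
      using V' u0 d(2) unfolding zp by (simp add: field_simps)
    \<comment> \<open>The same identity solved for \<open>2 *\<^sub>C ?T\<close>: the Kalton-Peck
      term is recovered from the deviation at the cost of multiples of \<open>l2norm a\<close>,
      which \<open>A\<close> bounds by the quasi-norm.\<close>
    have "ell2_le (l2norm (?U - \<Omega> ?V) + R * l2norm a + C * R * l2norm a) (2 *\<^sub>C ?T)"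
    proof -
      from ell2_le_add[OF ell2_le_diff[OF ell2_le_refl[OF ell2_le_mem[OF 1]] ell2_le_weaken[OF ell2_le_refl[OF H2] H]] err]
      have "ell2_le (l2norm (?U - \<Omega> ?V) + R * l2norm a + C * R * l2norm a)
        (?U - \<Omega> ?V - ?H + (\<Omega> ?V - ?W + 2 *\<^sub>C ?T))" .
      moreover have "?U - \<Omega> ?V - ?H + (\<Omega> ?V - ?W + 2 *\<^sub>C ?T) = 2 *\<^sub>C ?T"
        unfolding HUW by (simp only: algebra_simps)
      ultimately show ?thesis by (simp only:)
    qed
    then have "2 * l2norm ?T \<le> l2norm (?U - \<Omega> ?V) + R * l2norm a + C * R * l2norm a"
      using ell2_le_le l2norm_scale[OF T2, of 2] by fastforce
    then have "2 * (d * l2norm (kalton_peck a)) \<le> zn ?p + (1 + C) * R * l2norm a"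
      using T' l2norm_nonneg[OF V2] unfolding zp by (simp add: algebra_simps)
    also have "\<dots> \<le> zn ?p + (1 + C) * R * (1 / d * zn ?p)"
      using A C_nonneg R0 by (intro add_left_mono mult_left_mono) auto
    also have "\<dots> = (1 + (1 + C) * R / d) * zn ?p" by (simp add: algebra_simps)
    finally have "l2norm (kalton_peck a) \<le> (1 + (1 + C) * R / d) * zn ?p / (2 * d)"
      using d(2) by (simp add: pos_le_divide_eq mult.commute mult.left_commute)
    then show "?q a \<le> ((1 + (1 + C) * R / d) / (2 * d) + 1 / d) * zn ?p"
      unfolding dom_norm_def using A by (simp add: distrib_right)
  qed
  define D where "D = (1 + (1 + C) * R / d) / (2 * d) + 1 / d"
  have D: "0 < D" unfolding D_def using C_nonneg R0 d(2) by (intro add_nonneg_pos divide_nonneg_pos) auto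
  show ?thesis
  proof (rule that[of "c1 / D" "C1 * ((2 + C) * R)"])
    show "0 < c1 / D" "0 < C1 * ((2 + C) * R)" using c1 C1 D C_nonneg R0 by auto
    fix n :: nat and a :: cseq and k :: "nat \<Rightarrow> nat"
    assume k: "strict_mono_on {..<n} k" "\<forall>j<n. n \<le> k j" "\<forall>j\<ge>n. a j = 0"
    note e = est[OF k]
    have "c1 / D * ?q a \<le> c1 / D * (D * zn (\<Sum>j<n. a j *\<^sub>C \<beta> (k j)))"
      using e(2) c1 D unfolding D_def by (intro mult_left_mono) auto
    also have "\<dots> = c1 * zn (\<Sum>j<n. a j *\<^sub>C \<beta> (k j))" using D by simp
    also have "\<dots> \<le> N (\<Sum>j<n. a j *\<^sub>C \<beta> (k j))" by (rule N_ge[OF e(3)])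
    finally have low: "c1 / D * ?q a \<le> N (\<Sum>j<n. a j *\<^sub>C \<beta> (k j))" .
    have "N (\<Sum>j<n. a j *\<^sub>C \<beta> (k j)) \<le> C1 * zn (\<Sum>j<n. a j *\<^sub>C \<beta> (k j))" by (rule N_le[OF e(3)])
    also have "\<dots> \<le> C1 * ((2 + C) * R * ?q a)" using e(1) C1 by (intro mult_left_mono) auto
    finally show "c1 / D * ?q a \<le> N (\<Sum>j<n. a j *\<^sub>C \<beta> (k j)) \<and>
        N (\<Sum>j<n. a j *\<^sub>C \<beta> (k j)) \<le> C1 * ((2 + C) * R) * ?q a"
      using low by (simp add: mult.assoc)
  qed
qed

text \<open>A coordinate that does not vanish at \<open>w\<close> but vanishes on all late blocks recovers \<open>\<Sum> a\<^sub>j\<close> from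
  \<open>\<Sum> a\<^sub>j (w + \<beta>\<^sub>j)\<close>.\<close>

lemma spreading_limit_transfer:
  assumes \<Phi>: "quasilinear_domain \<Phi> K" and x: "\<And>i. x i \<in> Z" and w: "w \<in> Z" and \<rho>: "strict_mono \<rho>"
    and L: "spreading_limit \<lparr>carr = Z, nrm = N\<rparr> x L"
    and \<beta>: "\<And>i. \<beta> i \<in> Z" and I: "block_sets I" and supp: "\<And>i. restrict_pair (I i) (\<beta> i) = \<beta> i"
    and near: "(\<lambda>i. N (x (\<rho> i) - w - \<beta> i)) \<longlonglongrightarrow> 0"
    and c: "0 < c" "0 < c'"
    and est: "\<And>n a k. strict_mono_on {..<n} k \<Longrightarrow> \<forall>j<n. n \<le> k j \<Longrightarrow> \<forall>j\<ge>n. a j = 0 \<Longrightarrow>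
      c * dom_norm \<Phi> a \<le> N (\<Sum>j<n. a j *\<^sub>C \<beta> (k j)) \<and> N (\<Sum>j<n. a j *\<^sub>C \<beta> (k j)) \<le> c' * dom_norm \<Phi> a"
  shows "\<exists>e>0. \<exists>e'>0. \<forall>a\<in>c00. e * dom_norm \<Phi> (if w = 0 then a else augment a) \<le> L a \<and>
    L a \<le> e' * dom_norm \<Phi> (if w = 0 then a else augment a)"
proof -
  interpret \<Phi>: quasilinear_domain \<Phi> K by (rule \<Phi>)
  \<comment> \<open>Along \<open>\<rho>\<close> the vectors are \<open>w + \<beta> i\<close> up to
    null errors, and the copies of \<open>w\<close> add up to
    \<open>seq_total a *\<^sub>C w\<close>. A combination of \<open>n\<close> null errors does not
    affect the limit.\<close>
  have lim: "(\<lambda>i. N (seq_total a *\<^sub>C w + (\<Sum>j<n. a j *\<^sub>C \<beta> (i + j)))) \<longlonglongrightarrow> L a" if a: "\<forall>j\<ge>n. a j = 0" for a n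
  proof -
    let ?f = "\<lambda>i. N (\<Sum>j<n. a j *\<^sub>C x (\<rho> (i + j)))"
    let ?g = "\<lambda>i. N (seq_total a *\<^sub>C w + (\<Sum>j<n. a j *\<^sub>C \<beta> (i + j)))"
    have f: "?f \<longlonglongrightarrow> L a" using spreading_limit_tendsto[OF L a \<rho>] by simp
    have mf: "(\<Sum>j<n. a j *\<^sub>C x (\<rho> (i + j))) \<in> Z" and mg: "seq_total a *\<^sub>C w + (\<Sum>j<n. a j *\<^sub>C \<beta> (i + j)) \<in> Z" for i
      by (intro Z_add Z_sum Z_scale x w \<beta>)+
    have r: "x (\<rho> i) - w - \<beta> i \<in> Z" for i by (intro Z_diff x w \<beta>)
    have le: "\<bar>?g i - ?f i\<bar> \<le> (\<Sum>j<n. cmod (a j) * N (x (\<rho> (i + j)) - w - \<beta> (i + j)))" for i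
    proof -
      have "(\<Sum>j<n. a j *\<^sub>C x (\<rho> (i + j))) - (seq_total a *\<^sub>C w + (\<Sum>j<n. a j *\<^sub>C \<beta> (i + j)))
          = (\<Sum>j<n. a j *\<^sub>C (x (\<rho> (i + j)) - w - \<beta> (i + j)))"
        by (simp add: seq_total_eq[OF a] complex_vec.scale_sum_left scaleC_diff_right sum_subtractf)
      then have "N ((\<Sum>j<n. a j *\<^sub>C x (\<rho> (i + j))) - (seq_total a *\<^sub>C w + (\<Sum>j<n. a j *\<^sub>C \<beta> (i + j))))
        \<le> (\<Sum>j<n. cmod (a j) * N (x (\<rho> (i + j)) - w - \<beta> (i + j)))"
        using is_norm_on_sum[where A = "{..<n}" and c = a and v = "\<lambda>j. x (\<rho> (i + j)) - w - \<beta> (i + j)",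
            OF N Z_subspace r] by simp
      moreover have "\<bar>?g i - ?f i\<bar> \<le> N ((\<Sum>j<n. a j *\<^sub>C x (\<rho> (i + j))) - (seq_total a *\<^sub>C w + (\<Sum>j<n. a j *\<^sub>C \<beta> (i + j))))"
      proof -
        have t: "N p \<le> N (p - p') + N p'" if "p \<in> Z" "p' \<in> Z" for p p'
          using N_triangle[OF Z_diff[OF that] that(2)] by simp
        show ?thesis
          using t[OF mf mg, of i i] t[OF mg mf, of i i] is_norm_on_minus_commute[OF N Z_subspace mf mg, of i i]
          by linarith
      qed
      ultimately show ?thesis by linarith
    qed
    have "(\<lambda>i. \<Sum>j<n. cmod (a j) * N (x (\<rho> (i + j)) - w - \<beta> (i + j))) \<longlonglongrightarrow> (\<Sum>j<n. cmod (a j) * 0)"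
      by (intro tendsto_sum tendsto_mult_left LIMSEQ_ignore_initial_segment[OF near])
    then have "(\<lambda>i. \<Sum>j<n. cmod (a j) * N (x (\<rho> (i + j)) - w - \<beta> (i + j))) \<longlonglongrightarrow> 0"
      by (simp only: mult_zero_right sum.neutral_const)
    then have "(\<lambda>i. ?g i - ?f i) \<longlonglongrightarrow> 0"
      by (rule Lim_null_comparison[OF always_eventually[OF allI[OF le[folded real_norm_def]]]])
    from tendsto_add[OF this f] show ?thesis by simp
  qed
  have tail: "c * dom_norm \<Phi> a \<le> N (\<Sum>j<n. a j *\<^sub>C \<beta> (i + j)) \<and> N (\<Sum>j<n. a j *\<^sub>C \<beta> (i + j)) \<le> c' * dom_norm \<Phi> a"
    if a: "\<forall>j\<ge>n. a j = 0" and i: "n \<le> i" for a n i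
    using est[of n "\<lambda>j. i + j" a] a i by (simp add: strict_mono_on_def trans_le_add1)
  show ?thesis
  proof (cases "w = 0")
    case True
    have "c * dom_norm \<Phi> a \<le> L a \<and> L a \<le> c' * dom_norm \<Phi> a" if aa: "a \<in> c00" for a
    proof -
      obtain n where n: "\<forall>j\<ge>n. a j = 0" using aa c00_support by auto
      have l: "(\<lambda>i. N (\<Sum>j<n. a j *\<^sub>C \<beta> (i + j))) \<longlonglongrightarrow> L a" using lim[OF n] True by simp
      show ?thesis
        by (intro conjI LIMSEQ_le_const[OF l] LIMSEQ_le_const2[OF l] exI[of _ n]) (use tail[OF n] in blast)+
    qed
    then show ?thesis using c True by auto
  next
    case False
    \<comment> \<open>\<open>pr\<close> is whichever entry of the pair shows that \<open>w\<close>
      is nonzero, so that both cases run as one.\<close>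
    then obtain j0 and pr :: "cseq \<times> cseq \<Rightarrow> cseq" where pr: "pr = fst \<or> pr = snd" and w0: "pr w j0 \<noteq> 0"
      by (metis ext prod_eqI zero_fun_apply fst_zero snd_zero)
    have prb: "cmod (pr p j0) \<le> (2 * C + 1) / c1 * N p" if p: "p \<in> Z" for p
    proof -
      have "cmod (pr p j0) \<le> (2 * C + 1) * zn p"
      proof -
        have "zn p \<le> (2 * C + 1) * zn p"
          using mult_nonneg_nonneg[OF C_nonneg zn_nonneg[OF p]] by (simp add: distrib_right)
        then show ?thesis using coord_bound[OF p, of j0] pr by auto
      qed
      also have "\<dots> \<le> (2 * C + 1) * (N p / c1)"
        using N_ge[OF p] c1 C_nonneg by (intro mult_left_mono) (auto simp: pos_le_divide_eq mult.commute)
      finally show ?thesis by simp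
    qed
    have prv: "pr (\<beta> i) j0 = 0" if "i > j0" for i
    proof -
      have "j0 \<notin> I i" using I that unfolding block_sets_def by (meson not_le)
      then have "fst (\<beta> i) j0 = 0" "snd (\<beta> i) j0 = 0"
        using supp[of i] restrict_seq_eqD unfolding restrict_pair_def by (metis fst_conv, metis snd_conv)
      then show ?thesis using pr by auto
    qed
    define \<gamma> where "\<gamma> = (2 * C + 1) / c1 / cmod (pr w j0)"
    have \<gamma>: "0 < \<gamma>" unfolding \<gamma>_def using w0 c1 C_nonneg by simp
    have Nw: "0 \<le> N w" by (rule N_nonneg[OF w])
    have prsum: "pr (s *\<^sub>C w + (\<Sum>j<n. a j *\<^sub>C \<beta> (i + j))) j0 = s * pr w j0 + (\<Sum>j<n. a j * pr (\<beta> (i + j)) j0)" for s a n i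
      using pr by (auto simp: fst_sum snd_sum)
    \<comment> \<open>Once the total is bounded by \<open>\<gamma>\<close> times the norm,
      subtracting the multiple of \<open>w\<close> costs a further \<open>\<gamma> * N w\<close>;
      the lower estimate \<open>c\<close> for the block sum then gives
      \<open>(1 + \<gamma> * N w) / c\<close>.\<close>
    have up: "N (seq_total a *\<^sub>C w + (\<Sum>j<n. a j *\<^sub>C \<beta> (i + j))) \<le> (N w + c') * (cmod (seq_total a) + dom_norm \<Phi> a)"
      and low: "cmod (seq_total a) + dom_norm \<Phi> a \<le> (\<gamma> + (1 + \<gamma> * N w) / c) * N (seq_total a *\<^sub>C w + (\<Sum>j<n. a j *\<^sub>C \<beta> (i + j)))"
      if a: "\<forall>j\<ge>n. a j = 0" and i: "i \<ge> n" "i > j0" for a n i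
    proof -
      let ?s = "seq_total a" and ?B = "\<Sum>j<n. a j *\<^sub>C \<beta> (i + j)"
      let ?X = "?s *\<^sub>C w + ?B"
      have mB: "?B \<in> Z" by (intro Z_sum Z_scale \<beta>)
      have msw: "?s *\<^sub>C w \<in> Z" by (rule Z_scale[OF w])
      have mX: "?X \<in> Z" by (rule Z_add[OF msw mB])
      have q0: "0 \<le> dom_norm \<Phi> a" by (rule \<Phi>.q_nonneg[OF \<Phi>.c00_W[OF c00I[OF a]]])
      have nsw: "N (?s *\<^sub>C w) = cmod ?s * N w" by (rule is_norm_onD(3)[OF N w])
      note t = tail[OF a i(1)]
      have "N ?X \<le> cmod ?s * N w + c' * dom_norm \<Phi> a"
        using N_triangle[OF msw mB] t nsw by linarith
      moreover have "0 \<le> cmod ?s * c'" "0 \<le> N w * dom_norm \<Phi> a" using c q0 Nw by auto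
      ultimately show "N ?X \<le> (N w + c') * (cmod ?s + dom_norm \<Phi> a)" by (simp add: algebra_simps)
      have "pr ?X j0 = ?s * pr w j0" unfolding prsum using prv i(2) by simp
      then have "cmod ?s * cmod (pr w j0) \<le> (2 * C + 1) / c1 * N ?X" using prb[OF mX] by (simp add: norm_mult)
      then have "cmod ?s \<le> ((2 * C + 1) / c1 * N ?X) / cmod (pr w j0)"
        using w0 by (simp only: pos_le_divide_eq zero_less_norm_iff not_False_eq_True simp_thms)
      then have s: "cmod ?s \<le> \<gamma> * N ?X" unfolding \<gamma>_def by (simp only: times_divide_eq_left)
      have "?B = ?X - ?s *\<^sub>C w" by simp
      then have "N ?B \<le> N ?X + N (?s *\<^sub>C w)"
        using is_norm_on_triangle_diff[OF N Z_subspace mX complex_vec.subspace_0[OF Z_subspace] msw]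
          is_norm_on_minus_commute[OF N Z_subspace complex_vec.subspace_0[OF Z_subspace] msw] by simp
      then have "c * dom_norm \<Phi> a \<le> N ?X + cmod ?s * N w" using t nsw by linarith
      also have "\<dots> \<le> N ?X + \<gamma> * N ?X * N w" using s Nw by (intro add_left_mono mult_right_mono) auto
      finally have "dom_norm \<Phi> a \<le> (1 + \<gamma> * N w) / c * N ?X" using c by (simp add: field_simps)
      then show "cmod ?s + dom_norm \<Phi> a \<le> (\<gamma> + (1 + \<gamma> * N w) / c) * N ?X" using s by (simp add: distrib_right)
    qed
    define D where "D = \<gamma> + (1 + \<gamma> * N w) / c"
    have D: "0 < D" unfolding D_def using \<gamma> c Nw by (intro add_pos_nonneg divide_nonneg_pos) auto
    have LL: "cmod (seq_total a) + dom_norm \<Phi> a \<le> D * L a \<and> L a \<le> (N w + c') * (cmod (seq_total a) + dom_norm \<Phi> a)"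
      if aa: "a \<in> c00" for a
    proof -
      obtain n where n: "\<forall>j\<ge>n. a j = 0" using aa c00_support by auto
      show ?thesis
        by (intro conjI LIMSEQ_le_const[OF tendsto_mult_left[OF lim[OF n]]] LIMSEQ_le_const2[OF lim[OF n]]
            exI[of _ "max n (Suc j0)"]) (use up[OF n] low[OF n, folded D_def] in auto)
    qed
    obtain e e' where e: "0 < e" "0 < e'"
      "\<And>a. a \<in> c00 \<Longrightarrow> e * (cmod (seq_total a) + dom_norm \<Phi> a) \<le> dom_norm \<Phi> (augment a)"
      "\<And>a. a \<in> c00 \<Longrightarrow> dom_norm \<Phi> (augment a) \<le> e' * (cmod (seq_total a) + dom_norm \<Phi> a)"
      using \<Phi>.augment_equiv by blast
    have bnd: "inverse (e' * D) * dom_norm \<Phi> (augment a) \<le> L a \<and> L a \<le> ((N w + c') / e) * dom_norm \<Phi> (augment a)"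
      if aa: "a \<in> c00" for a
    proof -
      have "dom_norm \<Phi> (augment a) \<le> e' * (D * L a)"
        using e(4)[OF aa] LL[OF aa] e(2) by (meson less_imp_le mult_left_mono order_trans)
      moreover have "cmod (seq_total a) + dom_norm \<Phi> a \<le> dom_norm \<Phi> (augment a) / e"
        using e(3)[OF aa] e(1) by (simp add: pos_le_divide_eq mult.commute)
      then have "(N w + c') * (cmod (seq_total a) + dom_norm \<Phi> a) \<le> (N w + c') * (dom_norm \<Phi> (augment a) / e)"
        using Nw c by (intro mult_left_mono) auto
      ultimately have "dom_norm \<Phi> (augment a) \<le> L a * (e' * D)"
        and 2: "L a \<le> (N w + c') * (dom_norm \<Phi> (augment a) / e)"
        using LL[OF aa] by (simp_all add: ac_simps)
      then have "dom_norm \<Phi> (augment a) / (e' * D) \<le> L a" using e D by (simp only: pos_divide_le_eq mult_pos_pos)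
      then show ?thesis using 2 by (simp add: divide_inverse ac_simps)
    qed
    moreover have "0 < inverse (e' * D)" "0 < (N w + c') / e" using e D Nw c by (auto intro: add_nonneg_pos)
    ultimately show ?thesis unfolding if_not_P[OF False] by blast
  qed
qed

end


section \<open>The spreading models\<close>

lemma frequently_subseq:
  fixes P :: "nat \<Rightarrow> nat \<Rightarrow> bool"
  assumes "\<And>n m. \<exists>i\<ge>m. P n i"
  obtains \<sigma> where "strict_mono \<sigma>" "\<And>n. P n (\<sigma> n)"
proof -
  have "\<exists>f. \<forall>n. P n (f n) \<and> f n < f (Suc n)"
  proof (rule dependent_nat_choice)
    show "\<exists>i. P 0 i" using assms by blast
    show "\<exists>j. P (Suc n) j \<and> i < j" for i n using assms[of "Suc i" "Suc n"] by (meson Suc_le_lessD)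
  qed
  then show ?thesis using that by (metis strict_mono_Suc_iff)
qed

text \<open>The flag \<open>z\<close> stands for \<open>w = 0\<close>. In both cases the target is
  the same space, since the images of \<open>c00\<close> under the identity and under
  \<open>augment\<close> are both dense in it.\<close>

lemma (in quasilinear_domain) completion_isomorphic_augment:
  assumes comp: "is_completion \<lparr>carr = c00, nrm = L\<rparr> S"
    and est: "\<exists>e>0. \<exists>e'>0. \<forall>a\<in>c00. e * q (if z then a else augment a) \<le> L a \<and> L a \<le> e' * q (if z then a else augment a)"
  shows "S \<simeq>\<^sub>B dom_space \<Phi>"
proof -
  obtain e e' where e: "0 < e" "0 < e'"
    and Le: "\<And>a. a \<in> c00 \<Longrightarrow> e * q (if z then a else augment a) \<le> L a"
      "\<And>a. a \<in> c00 \<Longrightarrow> L a \<le> e' * q (if z then a else augment a)"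
    using est by blast
  show ?thesis
  proof (rule completion_isomorphic[OF comp _ _ _ e Le])
    show "linear_on_space c00 (\<lambda>a. if z then a else augment a)"
      using augment_linear by (cases z) (simp_all add: linear_on_space_def)
    show "(if z then a else augment a) \<in> W" if "a \<in> c00" for a
      using c00_W[OF that] c00_W[OF augment_c00[OF that]] by simp
    show "\<exists>a\<in>c00. q (y - (if z then a else augment a)) < e" if "y \<in> W" "0 < e" for y e
      using c00_dense[OF that] augment_dense[OF that] by (cases z) simp_all
  qed
qed

section \<open>Realisation and classification of spreading models\<close>

context twisted_renorming
begin

abbreviation "Y \<equiv> \<lparr>carr = Z, nrm = N\<rparr>"

lemma N_zero [simp]: "N 0 = 0"
  using is_norm_onD(2)[OF N complex_vec.subspace_0[OF Z_subspace]] by simp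

lemma N_triangle_diff: "p \<in> Z \<Longrightarrow> p' \<in> Z \<Longrightarrow> N (p - p') \<le> N p + N p'"
  using is_norm_on_triangle_diff[OF N Z_subspace _ complex_vec.subspace_0[OF Z_subspace]]
    is_norm_on_minus_commute[OF N Z_subspace complex_vec.subspace_0[OF Z_subspace]] by fastforce

text \<open>Separation excludes convergent subsequences, and the lower estimate makes
  \<open>L\<close> definite, so that \<open>c00\<close> with \<open>L\<close> is a normed space and
  has a completion.\<close>

lemma spreading_model_exists:
  assumes \<Phi>: "quasilinear_domain \<Phi> K"
    and \<beta>: "\<And>i. \<beta> i \<in> Z" and I: "block_sets I" and supp: "\<And>i. restrict_pair (I i) (\<beta> i) = \<beta> i"
    and M: "\<And>i. N (\<beta> i) \<le> M" and sep: "\<And>i j. i \<noteq> j \<Longrightarrow> s \<le> N (\<beta> i - \<beta> j)" "0 < s"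
    and c: "0 < c" "0 < c'"
    and est: "\<And>n a k. strict_mono_on {..<n} k \<Longrightarrow> \<forall>j<n. n \<le> k j \<Longrightarrow> \<forall>j\<ge>n. a j = 0 \<Longrightarrow>
      c * dom_norm \<Phi> a \<le> N (\<Sum>j<n. a j *\<^sub>C \<beta> (k j)) \<and> N (\<Sum>j<n. a j *\<^sub>C \<beta> (k j)) \<le> c' * dom_norm \<Phi> a"
  shows "\<exists>S :: cseq nspace. spreading_model Y S \<and> S \<simeq>\<^sub>B dom_space \<Phi>"
proof -
  interpret \<Phi>: quasilinear_domain \<Phi> K by (rule \<Phi>)
  have NY: "is_norm_on (carr Y) (nrm Y)" "csubspace (carr Y)" using N Z_subspace by simp_all
  obtain r L where r: "strict_mono r" and L: "spreading_limit Y (\<beta> \<circ> r) L"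
    using brunel_sucheston[OF NY, of \<beta> M] \<beta> M by auto
  \<comment> \<open>The transfer result is applied with \<open>w = 0\<close>, the blocks themselves
    and the identity subsequence; the trivial condition \<open>0 = 0\<close> keeps its form.\<close>
  have "\<exists>e>0. \<exists>e'>0. \<forall>a\<in>c00. e * dom_norm \<Phi> (if (0 :: cseq \<times> cseq) = 0 then a else augment a) \<le> L a \<and>
    L a \<le> e' * dom_norm \<Phi> (if (0 :: cseq \<times> cseq) = 0 then a else augment a)"
  proof (rule spreading_limit_transfer[OF \<Phi>, where x = "\<beta> \<circ> r" and \<rho> = id and \<beta> = "\<beta> \<circ> r" and I = "\<lambda>i. I (r i)" and c = c and c' = c'])
    show "0 \<in> Z" by (rule complex_vec.subspace_0[OF Z_subspace])
    show "strict_mono (id :: nat \<Rightarrow> nat)" by (simp add: strict_mono_def)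
    show "spreading_limit Y (\<beta> \<circ> r) L" by (rule L)
    show "block_sets (\<lambda>i. I (r i))" by (rule block_sets_subseq[OF I r])
    fix n :: nat and a :: cseq and k :: "nat \<Rightarrow> nat"
    assume k: "strict_mono_on {..<n} k" "\<forall>j<n. n \<le> k j" "\<forall>j\<ge>n. a j = 0"
    have "strict_mono_on {..<n} (r \<circ> k)" using k(1) r by (auto simp: strict_mono_on_def strict_mono_def)
    moreover have "\<forall>j<n. n \<le> (r \<circ> k) j" using k(2) seq_suble[OF r] order_trans by fastforce
    ultimately show "c * dom_norm \<Phi> a \<le> N (\<Sum>j<n. a j *\<^sub>C (\<beta> \<circ> r) (k j)) \<and> N (\<Sum>j<n. a j *\<^sub>C (\<beta> \<circ> r) (k j)) \<le> c' * dom_norm \<Phi> a"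
      using est[of n "r \<circ> k" a] k(3) by simp
  qed (use \<beta> supp c in auto)
  then obtain e e' where e: "0 < e" "0 < e'"
    and Le: "\<And>a. a \<in> c00 \<Longrightarrow> e * dom_norm \<Phi> a \<le> L a" "\<And>a. a \<in> c00 \<Longrightarrow> L a \<le> e' * dom_norm \<Phi> a"
    by auto
  have Lnorm: "is_norm_on c00 L"
  proof (rule spreading_limit_norm[OF NY _ L])
    show "(\<beta> \<circ> r) j \<in> carr Y" for j using \<beta> by simp
    fix a assume a: "a \<in> c00" "L a = 0"
    then have "dom_norm \<Phi> a \<le> 0" using Le(1)[OF a(1)] e(1) by (simp add: mult_le_0_iff)
    then show "a = 0" using \<Phi>.q_nonneg[OF \<Phi>.c00_W[OF a(1)]] \<Phi>.q_eq_0[OF \<Phi>.c00_W[OF a(1)]] by simp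
  qed
  obtain S :: "cseq nspace" where S: "is_completion \<lparr>carr = c00, nrm = L\<rparr> S"
    using \<Phi>.completion_exists[OF Lnorm e Le] by blast
  have "S \<simeq>\<^sub>B dom_space \<Phi>"
    by (rule \<Phi>.completion_isomorphic_augment[OF S, where z = True]) (use e Le in auto)
  moreover have "\<nexists>v. converges_in Y (\<beta> \<circ> \<rho>) v" if \<rho>: "strict_mono \<rho>" for \<rho> :: "nat \<Rightarrow> nat"
  proof
    assume "\<exists>v. converges_in Y (\<beta> \<circ> \<rho>) v"
    then obtain v where v: "v \<in> Z" "(\<lambda>n. N (\<beta> (\<rho> n) - v)) \<longlonglongrightarrow> 0" unfolding converges_in_def by auto
    have "\<forall>\<^sub>F n in sequentially. N (\<beta> (\<rho> n) - v) < s / 2" using v(2) sep(2) by (intro order_tendstoD(2)) auto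
    then obtain n where n: "\<And>m. m \<ge> n \<Longrightarrow> N (\<beta> (\<rho> m) - v) < s / 2" by (auto simp: eventually_sequentially)
    have "\<rho> n \<noteq> \<rho> (Suc n)" using strict_monoD[OF \<rho>, of n "Suc n"] by simp
    then have "s \<le> N (\<beta> (\<rho> n) - \<beta> (\<rho> (Suc n)))" by (rule sep(1))
    also have "\<dots> \<le> N (\<beta> (\<rho> n) - v) + N (v - \<beta> (\<rho> (Suc n)))"
      by (rule is_norm_on_triangle_diff[OF N Z_subspace \<beta> v(1) \<beta>])
    also have "\<dots> < s"
      using n[of n] n[of "Suc n"] is_norm_on_minus_commute[OF N Z_subspace v(1) \<beta>, of "\<rho> (Suc n)"] by simp
    finally show False by simp
  qed
  ultimately show ?thesis
    unfolding spreading_model_def using \<beta> M r L S by (intro exI[of _ S] conjI exI[of _ \<beta>] exI[of _ M] exI[of _ r] exI[of _ L]) auto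
qed

lemma singleton_block_sets: "block_sets (\<lambda>i. {i})"
  by (simp add: block_sets_def)

lemma unit_seq_separated: "i \<noteq> j \<Longrightarrow> 1 \<le> l2norm (unit_seq i - unit_seq j)"
  using l2norm_coord[OF ell2_diff[OF l2norm_unit_seq(1) l2norm_unit_seq(1)], of i j i]
  by (simp add: unit_seq_def)

lemma ell2_spreading_model: "\<exists>S :: cseq nspace. spreading_model Y S \<and> S \<simeq>\<^sub>B ell2"
proof -
  let ?\<beta> = "\<lambda>i. (unit_seq i, 0 :: cseq)"
  have m: "?\<beta> i \<in> Z" for i by (intro c00_pair) simp_all
  have z: "zn (?\<beta> i) = 1" for i by (simp add: zn_eq l2norm_unit_seq)
  have u: "unit_seq i j = 0" if "j \<notin> {i}" for i j using that by (simp add: unit_seq_def)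
  have "\<exists>S :: cseq nspace. spreading_model Y S \<and> S \<simeq>\<^sub>B dom_space (\<lambda>_. 0)"
  proof (rule spreading_model_exists[OF ell2.quasilinear_domain_axioms m singleton_block_sets])
    show "restrict_pair {i} (?\<beta> i) = ?\<beta> i" for i
      by (auto simp: restrict_pair_def restrict_seq_def unit_seq_def fun_eq_iff)
    show "N (?\<beta> i) \<le> C1 * 1" for i using N_le[OF m] unfolding z .
    show "c1 \<le> N (?\<beta> i - ?\<beta> j)" if "i \<noteq> j" for i j
    proof -
      have "c1 * 1 \<le> c1 * zn (?\<beta> i - ?\<beta> j)"
        unfolding zn_eq using unit_seq_separated[OF that] c1 by (intro mult_left_mono) auto
      then show ?thesis using N_ge[OF Z_diff[OF m m], of i j] by simp
    qed
    show "0 < c1" "0 < c1 * 1" "0 < C1 * 1" using c1 C1 by simp_all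
    show "c1 * 1 * dom_norm (\<lambda>_. 0) a \<le> N (\<Sum>j<n. a j *\<^sub>C ?\<beta> (k j)) \<and> N (\<Sum>j<n. a j *\<^sub>C ?\<beta> (k j)) \<le> C1 * 1 * dom_norm (\<lambda>_. 0) a"
      if "strict_mono_on {..<n} k" "\<forall>j\<ge>n. a j = 0" for n a k
      using first_coordinate_estimate[where h = unit_seq and d = 1 and R = 1, OF singleton_block_sets
          l2norm_unit_seq(1) u _ _ zero_less_one that] l2norm_unit_seq(2)
      by (simp add: dom_norm_def)
  qed
  then show ?thesis by (simp only: dom_space_0)
qed

lemma ell_M_spreading_model: "\<exists>S :: cseq nspace. spreading_model Y S \<and> S \<simeq>\<^sub>B ell_M"
proof -
  let ?\<beta> = "\<lambda>i. (0 :: cseq, unit_seq i)"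
  have m: "?\<beta> i \<in> Z" for i by (intro c00_pair) simp_all
  \<comment> \<open>The l_1 norm of a unit vector is 1, so \<open>finite_support\<close> bounds
    \<open>\<Omega>\<close> on unit vectors by \<open>C\<close>.\<close>
  have zle: "zn (?\<beta> i) \<le> C + 1" for i
  proof -
    have s: "\<forall>j\<ge>Suc i. unit_seq i j = 0" by (simp add: unit_seq_def)
    have "(\<Sum>j<Suc i. cmod (unit_seq i j)) = (\<Sum>j\<in>{i}. cmod (unit_seq i j))"
      by (rule sum.mono_neutral_right) (auto simp: unit_seq_def)
    also have "\<dots> = 1" by (simp add: unit_seq_def)
    finally show ?thesis using ell2_le_le[OF finite_support[OF s]] by (simp add: zn_eq l2norm_unit_seq l2norm_minus)
  qed
  have r: "restrict_pair {i} (?\<beta> i) = ?\<beta> i" for i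
    by (auto simp: restrict_pair_def restrict_seq_def unit_seq_def fun_eq_iff)
  have d: "1 \<le> l2norm (snd (?\<beta> i))" for i by (simp add: l2norm_unit_seq)
  obtain c c' where c: "0 < c" "0 < c'"
    "\<And>n a k. strict_mono_on {..<n} k \<Longrightarrow> \<forall>j<n. n \<le> k j \<Longrightarrow> \<forall>j\<ge>n. a j = 0 \<Longrightarrow>
      c * dom_norm kalton_peck a \<le> N (\<Sum>j<n. a j *\<^sub>C ?\<beta> (k j)) \<and>
      N (\<Sum>j<n. a j *\<^sub>C ?\<beta> (k j)) \<le> c' * dom_norm kalton_peck a"
    by (rule block_estimate[OF singleton_block_sets m r zle d zero_less_one]) (rule that)
  have "\<exists>S :: cseq nspace. spreading_model Y S \<and> S \<simeq>\<^sub>B dom_space kalton_peck"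
  proof (rule spreading_model_exists[OF kp.quasilinear_domain_axioms m singleton_block_sets r _ _ c1 c])
    show "N (?\<beta> i) \<le> C1 * (C + 1)" for i
      using N_le[OF m, of i] mult_left_mono[OF zle less_imp_le[OF C1], of i] by linarith
    show "c1 \<le> N (?\<beta> i - ?\<beta> j)" if "i \<noteq> j" for i j
    proof -
      have "c1 * 1 \<le> c1 * zn (?\<beta> i - ?\<beta> j)"
      proof (rule mult_left_mono)
        have "?\<beta> i - ?\<beta> j \<in> Z" by (rule Z_diff[OF m m])
        then have "0 \<le> l2norm (fst (?\<beta> i - ?\<beta> j) - \<Omega> (snd (?\<beta> i - ?\<beta> j)))" by (simp only: Z_iff l2norm_nonneg)
        then show "1 \<le> zn (?\<beta> i - ?\<beta> j)" unfolding zn_eq using unit_seq_separated[OF that] by simp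
      qed (use c1 in simp)
      then show ?thesis using N_ge[OF Z_diff[OF m m], of i j] by simp
    qed
  qed
  then show ?thesis using isomorphic_trans[OF _ dom_space_kalton_peck_isomorphic] by blast
qed

lemma spreading_model_classification:
  fixes S :: "'v::complex_vec nspace"
  assumes S: "spreading_model Y S"
  shows "S \<simeq>\<^sub>B ell2 \<or> S \<simeq>\<^sub>B ell_M"
proof -
  from S obtain x0 r L M where x0: "\<And>j. x0 j \<in> Z" and M0: "\<And>j. N (x0 j) \<le> M"
    and nc0: "\<And>r :: nat \<Rightarrow> nat. strict_mono r \<Longrightarrow> \<nexists>v. converges_in Y (x0 \<circ> r) v"
    and r: "strict_mono r" and L: "spreading_limit Y (x0 \<circ> r) L" and comp: "is_completion \<lparr>carr = c00, nrm = L\<rparr> S"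
    unfolding spreading_model_def by auto
  define x where "x = x0 \<circ> r"
  have x: "x j \<in> Z" and M: "N (x j) \<le> M" for j using x0 M0 by (simp_all add: x_def)
  have nc: "\<nexists>v. converges_in Y (x \<circ> \<rho>) v" if "strict_mono \<rho>" for \<rho>
    using nc0[OF strict_mono_o[OF r that]] by (simp add: x_def comp_assoc)
  have zM: "zn (x j) \<le> M / c1" for j
    using N_ge[OF x] M c1 by (metis mult.commute order_trans pos_le_divide_eq)
  \<comment> \<open>Both entries are combined into one pair of complex numbers per coordinate, so
    that a single diagonal argument makes both converge.\<close>
  define f where "f n j = (fst (x n) j, snd (x n) j)" for n j
  have fb: "norm (f n j) \<le> (2 * C + 2) * (M / c1)" for n j
  proof -
    have "norm (f n j) \<le> cmod (fst (x n) j) + cmod (snd (x n) j)"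
      unfolding f_def by (rule norm_Pair_le)
    also have "\<dots> \<le> (2 * C + 1) * zn (x n) + zn (x n)" by (intro add_mono coord_bound x)
    also have "\<dots> = (2 * C + 2) * zn (x n)" by (simp add: algebra_simps)
    also have "\<dots> \<le> (2 * C + 2) * (M / c1)" using zM C_nonneg by (intro mult_left_mono) auto
    finally show ?thesis .
  qed
  have cs: "countable (UNIV :: nat set)" by simp
  obtain k where k: "strict_mono k" and kl: "\<And>j. j \<in> UNIV \<Longrightarrow> \<exists>l. (\<lambda>n. f (k n) j) \<longlonglongrightarrow> l"
    by (rule function_convergent_subsequence[OF cs fb]) (rule that)
  from kl obtain l where l: "\<And>j. (\<lambda>n. f (k n) j) \<longlonglongrightarrow> l j" by (metis UNIV_I)
  define w where "w = ((\<lambda>j. fst (l j)), (\<lambda>j. snd (l j)))"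
  have w1: "(\<lambda>n. fst (x (k n)) j) \<longlonglongrightarrow> fst w j" and w2: "(\<lambda>n. snd (x (k n)) j) \<longlonglongrightarrow> snd w j" for j
    using tendsto_fst[OF l[of j]] tendsto_snd[OF l[of j]] by (simp_all add: f_def w_def)
  \<comment> \<open>The coordinatewise limit takes the place of a weak limit; bounded closedness
    puts it into the space.\<close>
  have w: "w \<in> Z"
    using Z_closed[of "\<lambda>n. x (k n)" "M / c1" "fst w" "snd w"] x zM w1 w2 by simp
  define g where "g n = x (k n) - w" for n
  have g: "g n \<in> Z" for n unfolding g_def by (rule Z_diff[OF x w])
  have g1: "(\<lambda>n. fst (g n) j) \<longlonglongrightarrow> 0" for j using tendsto_diff[OF w1[of j] tendsto_const[of "fst w j"]] by (simp add: g_def)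
  have g2: "(\<lambda>n. snd (g n) j) \<longlonglongrightarrow> 0" for j using tendsto_diff[OF w2[of j] tendsto_const[of "snd w j"]] by (simp add: g_def)
  obtain \<kappa> I where \<kappa>: "strict_mono \<kappa>" and I: "block_sets I"
    and hump: "\<And>i. N (g (\<kappa> i) - restrict_pair (I i) (g (\<kappa> i))) < inverse (real (Suc i))"
    using gliding_hump[OF g g1 g2] by blast
  define b where "b i = restrict_pair (I i) (g (\<kappa> i))" for i
  define \<tau> where "\<tau> = k \<circ> \<kappa>"
  have \<tau>: "strict_mono \<tau>" unfolding \<tau>_def by (rule strict_mono_o[OF k \<kappa>])
  have b: "b i \<in> Z" for i unfolding b_def by (rule restrict_pair_Z(1)[OF g])
  have near: "(\<lambda>i. N (x (\<tau> i) - w - b i)) \<longlonglongrightarrow> 0"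
  proof (rule inverse_bound_null)
    show "0 \<le> N (x (\<tau> i) - w - b i)" for i by (intro N_nonneg Z_diff x w b)
    show "N (x (\<tau> i) - w - b i) < inverse (real (Suc i))" for i using hump[of i] by (simp add: b_def g_def \<tau>_def)
  qed
  define R where "R = (C + 1) * ((M + N w) / c1)"
  have bR: "zn (b i) \<le> R" for i
  proof -
    have "c1 * zn (g (\<kappa> i)) \<le> M + N w"
      using N_ge[OF g, of "\<kappa> i"] N_triangle_diff[OF x w, of "k (\<kappa> i)"] M[of "k (\<kappa> i)"] unfolding g_def by linarith
    then have "zn (g (\<kappa> i)) \<le> (M + N w) / c1" using c1 by (simp add: pos_le_divide_eq mult.commute)
    then have "(C + 1) * zn (g (\<kappa> i)) \<le> R" unfolding R_def using C_nonneg by (intro mult_left_mono) auto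
    then show ?thesis unfolding b_def using restrict_pair_Z(2)[OF g] order_trans by blast
  qed
  have bsupp: "restrict_pair (I i) (b i) = b i" for i
    by (simp add: b_def restrict_pair_def restrict_seq_restrict)
  \<comment> \<open>Blocks tending to 0 along a subsequence would make the original sequence
    converge to \<open>w\<close> along it, which is excluded.\<close>
  have "\<exists>\<delta>>0. \<exists>i0. \<forall>i\<ge>i0. \<delta> \<le> N (b i)"
  proof (rule ccontr)
    assume "\<not> ?thesis"
    then have "\<exists>i\<ge>m. N (b i) < inverse (real (Suc n))" for n m by (meson inverse_positive_iff_positive not_le of_nat_0_less_iff zero_less_Suc)
    then obtain \<sigma> where \<sigma>: "strict_mono \<sigma>" "\<And>n. N (b (\<sigma> n)) < inverse (real (Suc n))"
      using frequently_subseq[of "\<lambda>n i. N (b i) < inverse (real (Suc n))"] by blast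
    have bn: "(\<lambda>n. N (b (\<sigma> n))) \<longlonglongrightarrow> 0" by (rule inverse_bound_null[OF N_nonneg[OF b] \<sigma>(2)])
    have le: "N (x (\<tau> (\<sigma> n)) - w) \<le> N (x (\<tau> (\<sigma> n)) - w - b (\<sigma> n)) + N (b (\<sigma> n))" for n
      using N_triangle[OF Z_diff[OF Z_diff[OF x w] b] b, of "\<tau> (\<sigma> n)" "\<sigma> n" "\<sigma> n"] by (simp only: diff_add_cancel)
    have "(\<lambda>n. N (x (\<tau> (\<sigma> n)) - w - b (\<sigma> n)) + N (b (\<sigma> n))) \<longlonglongrightarrow> 0"
      using LIMSEQ_subseq_LIMSEQ[OF near \<sigma>(1)] bn by (auto simp: o_def intro: tendsto_add_zero)
    then have "(\<lambda>n. N (x (\<tau> (\<sigma> n)) - w)) \<longlonglongrightarrow> 0"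
      by (rule tendsto_sandwich[OF always_eventually always_eventually tendsto_const, rotated 2])
        (use le N_nonneg[OF Z_diff[OF x w]] in blast)+
    then have "converges_in Y (x \<circ> (\<tau> \<circ> \<sigma>)) w" unfolding converges_in_def using w by (simp add: o_def)
    then show False using nc[OF strict_mono_o[OF \<tau> \<sigma>(1)]] by blast
  qed
  then obtain \<delta> i0 where \<delta>: "0 < \<delta>" "\<And>i. i \<ge> i0 \<Longrightarrow> \<delta> \<le> N (b i)" by blast
  have v2: "snd (b i) \<in> carr ell2" and u2: "fst (b i) - \<Omega> (snd (b i)) \<in> carr ell2" for i
    using b[of i] by (auto simp: Z_iff)
  note L' = L[folded x_def]
  show ?thesis
  proof (cases "\<exists>d>0. \<exists>i1. \<forall>i\<ge>i1. d \<le> l2norm (snd (b i))")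
    case True
    then obtain d i1 where d: "0 < d" "\<And>i. i \<ge> i1 \<Longrightarrow> d \<le> l2norm (snd (b i))" by blast
    define \<sigma> where "\<sigma> i = i1 + i" for i
    have \<sigma>: "strict_mono \<sigma>" by (simp add: \<sigma>_def strict_mono_def)
    have d\<sigma>: "d \<le> l2norm (snd (b (\<sigma> i)))" for i using d(2)[of "\<sigma> i"] by (simp add: \<sigma>_def)
    obtain c c' where c: "0 < c" "0 < c'" "\<And>n a k. strict_mono_on {..<n} k \<Longrightarrow> \<forall>j<n. n \<le> k j \<Longrightarrow> \<forall>j\<ge>n. a j = 0 \<Longrightarrow>
        c * dom_norm kalton_peck a \<le> N (\<Sum>j<n. a j *\<^sub>C b (\<sigma> (k j))) \<and>
        N (\<Sum>j<n. a j *\<^sub>C b (\<sigma> (k j))) \<le> c' * dom_norm kalton_peck a"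
      by (rule block_estimate[OF block_sets_subseq[OF I \<sigma>], where \<beta> = "\<lambda>i. b (\<sigma> i)", OF b bsupp bR d\<sigma> d(1)]) (rule that)
    have near': "(\<lambda>i. N (x ((\<tau> \<circ> \<sigma>) i) - w - b (\<sigma> i))) \<longlonglongrightarrow> 0"
      using LIMSEQ_subseq_LIMSEQ[OF near \<sigma>] by (simp add: o_def)
    have "S \<simeq>\<^sub>B dom_space kalton_peck"
      by (rule kp.completion_isomorphic_augment[OF comp],
          rule spreading_limit_transfer[OF kp.quasilinear_domain_axioms x w strict_mono_o[OF \<tau> \<sigma>] L' b
            block_sets_subseq[OF I \<sigma>] bsupp near' c])
    then show ?thesis using isomorphic_trans[OF _ dom_space_kalton_peck_isomorphic] by blast
  next
    case False
    \<comment> \<open>Chosen so that replacing a block by \<open>(h n, 0)\<close> costs at most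
      \<open>\<delta> / 2\<close> for every \<open>n\<close>, which keeps the norms of
      \<open>h n\<close> bounded below, while the factor \<open>inverse (Suc n)\<close> makes the
      cost null, as the transfer requires.\<close>
    define \<epsilon> where "\<epsilon> n = \<delta> / (2 * ((C + 1) * C1)) * inverse (real (Suc n))" for n
    have CC: "0 < (C + 1) * C1" using C_nonneg C1 by simp
    have \<epsilon>: "0 < \<epsilon> n" for n unfolding \<epsilon>_def using \<delta> CC by simp
    have "\<exists>i\<ge>m. i0 \<le> i \<and> l2norm (snd (b i)) < \<epsilon> n" for n m
    proof -
      obtain i where "i \<ge> max m i0" "l2norm (snd (b i)) < \<epsilon> n" using False \<epsilon>[of n] by (meson not_le)
      then show ?thesis by auto
    qed
    then obtain \<sigma> where \<sigma>: "strict_mono \<sigma>" "\<And>n. i0 \<le> \<sigma> n \<and> l2norm (snd (b (\<sigma> n))) < \<epsilon> n"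
      using frequently_subseq[of "\<lambda>n i. i0 \<le> i \<and> l2norm (snd (b i)) < \<epsilon> n"] by blast
    define h where "h n = restrict_seq (I (\<sigma> n)) (fst (b (\<sigma> n)) - \<Omega> (snd (b (\<sigma> n))))" for n
    have h2: "h n \<in> carr ell2" for n unfolding h_def by (rule ell2_restrict[OF u2])
    have hR: "l2norm (h n) \<le> R" for n
    proof -
      have "l2norm (h n) \<le> l2norm (fst (b (\<sigma> n)) - \<Omega> (snd (b (\<sigma> n))))" unfolding h_def by (rule l2norm_restrict_le[OF u2])
      also have "\<dots> \<le> zn (b (\<sigma> n))" unfolding zn_eq using v2 by simp
      finally show ?thesis using bR order_trans by blast
    qed
    have hsupp: "h n j = 0" if "j \<notin> I (\<sigma> n)" for n j using that by (simp add: h_def restrict_seq_def)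
    have hZ: "(h n, 0) \<in> Z" for n using h2 by (simp add: Z_iff)
    \<comment> \<open>The difference has second entry \<open>snd (b (\<sigma> n))\<close>, and its
      deviation from \<open>\<Omega>\<close> is the commutator of \<open>\<Omega>\<close> with
      restriction to the block. Both are controlled by the small norm of that second entry.\<close>
    have bh: "N (b (\<sigma> n) - (h n, 0)) \<le> \<delta> / 2 * inverse (real (Suc n))" for n
    proof -
      let ?i = "\<sigma> n"
      have rb: "restrict_seq (I ?i) (fst (b ?i)) = fst (b ?i)" "restrict_seq (I ?i) (snd (b ?i)) = snd (b ?i)"
        using bsupp[of ?i] by (auto simp: restrict_pair_def prod_eq_iff)
      have "fst (b ?i - (h n, 0)) - \<Omega> (snd (b ?i - (h n, 0))) = restrict_seq (I ?i) (\<Omega> (snd (b ?i))) - \<Omega> (restrict_seq (I ?i) (snd (b ?i)))"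
        unfolding h_def restrict_seq_diff rb by simp
      then have "zn (b ?i - (h n, 0)) \<le> C * l2norm (snd (b ?i)) + l2norm (snd (b ?i))"
        unfolding zn_eq using ell2_le_le[OF centralizer[OF v2]] by simp
      also have "\<dots> = (C + 1) * l2norm (snd (b ?i))" by (simp add: algebra_simps)
      also have "\<dots> \<le> (C + 1) * \<epsilon> n" using \<sigma>(2)[of n] C_nonneg by (intro mult_left_mono) auto
      finally have "C1 * zn (b ?i - (h n, 0)) \<le> C1 * ((C + 1) * \<epsilon> n)" using C1 by simp
      also have "C1 * ((C + 1) * \<epsilon> n) = ((C + 1) * C1) * \<epsilon> n" by simp
      also have "\<dots> = \<delta> / 2 * inverse (real (Suc n))" unfolding \<epsilon>_def using C_nonneg C1 by simp
      finally show ?thesis using N_le[OF Z_diff[OF b hZ], of ?i n] by linarith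
    qed
    define d where "d = \<delta> / (2 * C1)"
    have d0: "0 < d" using \<delta> C1 by (simp add: d_def)
    have d: "d \<le> l2norm (h n)" for n
    proof -
      have "\<delta> \<le> N (b (\<sigma> n) - (h n, 0) + (h n, 0))" using \<delta>(2) \<sigma>(2) by (simp only: diff_add_cancel)
      also have "\<dots> \<le> N (b (\<sigma> n) - (h n, 0)) + N (h n, 0)" by (rule N_triangle[OF Z_diff[OF b hZ] hZ])
      also have "N (h n, 0) \<le> C1 * zn (h n, 0)" by (rule N_le[OF hZ])
      also have "zn (h n, 0) = l2norm (h n)" by (simp add: zn_eq)
      also have "N (b (\<sigma> n) - (h n, 0)) \<le> \<delta> / 2"
      proof -
        have "\<delta> / 2 * inverse (real (Suc n)) \<le> \<delta> / 2 * 1" using \<delta>(1) by (intro mult_left_mono) (auto simp: inverse_le_1_iff)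
        then show ?thesis using bh[of n] by linarith
      qed
      finally have "\<delta> / 2 \<le> C1 * l2norm (h n)" by simp
      then show ?thesis unfolding d_def using C1 by (simp add: field_simps)
    qed
    have R0: "0 < R" using d[of 0] hR[of 0] d0 by linarith
    have near': "(\<lambda>i. N (x ((\<tau> \<circ> \<sigma>) i) - w - (h i, 0))) \<longlonglongrightarrow> 0"
    proof (rule tendsto_sandwich[OF always_eventually always_eventually tendsto_const])
      show "\<forall>i. 0 \<le> N (x ((\<tau> \<circ> \<sigma>) i) - w - (h i, 0))" by (intro allI N_nonneg Z_diff x w hZ)
      show "\<forall>i. N (x ((\<tau> \<circ> \<sigma>) i) - w - (h i, 0)) \<le> N (x (\<tau> (\<sigma> i)) - w - b (\<sigma> i)) + \<delta> / 2 * inverse (real (Suc i))"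
      proof
        fix i
        have "N (x ((\<tau> \<circ> \<sigma>) i) - w - (h i, 0)) \<le> N (x ((\<tau> \<circ> \<sigma>) i) - w - b (\<sigma> i)) + N (b (\<sigma> i) - (h i, 0))"
          by (rule is_norm_on_triangle_diff[OF N Z_subspace Z_diff[OF x w] b hZ])
        then show "N (x ((\<tau> \<circ> \<sigma>) i) - w - (h i, 0)) \<le> N (x (\<tau> (\<sigma> i)) - w - b (\<sigma> i)) + \<delta> / 2 * inverse (real (Suc i))"
          using bh[of i] by simp
      qed
      have "(\<lambda>i. N (x (\<tau> (\<sigma> i)) - w - b (\<sigma> i))) \<longlonglongrightarrow> 0" using LIMSEQ_subseq_LIMSEQ[OF near \<sigma>(1)] by (simp add: o_def)
      then show "(\<lambda>i. N (x (\<tau> (\<sigma> i)) - w - b (\<sigma> i)) + \<delta> / 2 * inverse (real (Suc i))) \<longlonglongrightarrow> 0"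
        using tendsto_add[OF _ tendsto_mult_left[OF LIMSEQ_inverse_real_of_nat, of "\<delta> / 2"]] by fastforce
    qed
    have I\<sigma>: "block_sets (\<lambda>i. I (\<sigma> i))" by (rule block_sets_subseq[OF I \<sigma>(1)])
    have hr: "restrict_pair (I (\<sigma> i)) (h i, 0) = (h i, 0)" for i
      by (simp add: restrict_pair_def h_def restrict_seq_restrict)
    have est: "c1 * d * dom_norm (\<lambda>_. 0) a \<le> N (\<Sum>j<n. a j *\<^sub>C (h (k j), 0)) \<and>
        N (\<Sum>j<n. a j *\<^sub>C (h (k j), 0)) \<le> C1 * R * dom_norm (\<lambda>_. 0) a"
      if "strict_mono_on {..<n} k" "\<forall>j<n. n \<le> k j" "\<forall>j\<ge>n. a j = 0" for n a k
      using first_coordinate_estimate[where h = h, OF I\<sigma> h2 hsupp hR d d0 that(1,3)] by (simp add: dom_norm_def)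
    have "S \<simeq>\<^sub>B dom_space (\<lambda>_. 0)"
      by (rule ell2.completion_isomorphic_augment[OF comp],
          rule spreading_limit_transfer[OF ell2.quasilinear_domain_axioms x w strict_mono_o[OF \<tau> \<sigma>(1)] L' hZ I\<sigma> hr near'
            mult_pos_pos[OF c1 d0] mult_pos_pos[OF C1 R0] est])
    then show ?thesis by (simp add: dom_space_0)
  qed
qed

end

theorem proposition7:
  fixes B :: "cseq \<Rightarrow> complex \<Rightarrow> cseq"
    and N :: "cseq \<times> cseq \<Rightarrow> real"
    and Y :: "(cseq \<times> cseq) nspace"
  assumes selection: "homogeneous_selection tsirelson B"
    and norm: "is_norm_on (carr (Z_space B)) N"
    and equiv: "equivalent_on (carr (Z_space B)) (nrm (Z_space B)) N"
    and Y: "Y = \<lparr>carr = carr (Z_space B), nrm = N\<rparr>"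
  shows "(\<forall>S :: 'v::complex_vec nspace. spreading_model Y S \<longrightarrow> S \<simeq>\<^sub>B ell2 \<or> S \<simeq>\<^sub>B ell_M) \<and>
         (\<exists>S :: cseq nspace. spreading_model Y S \<and> S \<simeq>\<^sub>B ell2) \<and>
         (\<exists>S :: cseq nspace. spreading_model Y S \<and> S \<simeq>\<^sub>B ell_M)"
proof -
  obtain C where C: "tsirelson_twist (Omega B) C" using tsirelson_twist_exists[OF selection] .
  obtain c1 C1 where "0 < c1" "0 < C1"
    "\<forall>p\<in>carr (Z_space B). c1 * nrm (Z_space B) p \<le> N p \<and> N p \<le> C1 * nrm (Z_space B) p"
    using equiv unfolding equivalent_on_def by blast
  then interpret twisted_renorming "Omega B" C N c1 C1
    using C norm by (simp add: twisted_renorming_def twisted_renorming_axioms_def Z_space_def)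
  show ?thesis
    unfolding Y Z_space_def
    using spreading_model_classification ell2_spreading_model ell_M_spreading_model by blast
qed

end
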